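(* Let $a,b\in\mathbb{Z}_{\ge0}\cup\{\infty\}$ and let $A=D(a|b)$ or $A=Cl(a|b)$. (a) Every simple weight $A$-module is multiplicity free. (b) For every $\mu\in\mathfrak{h}_A^\vee$, up to isomorphism, there exist precisely two simple weight $A$-modules $X(\mu)$ and $\Pi X(\mu)$ whose supports contain $\mu$, and such that $X(\mu)$ is preferred. (c) $\operatorname{supp}X(\mu)=\{\lambda\in\mathfrak{h}_A^\vee\mid\lambda\approx\mu\}$. (d) Let $\mu,\nu\in\mathfrak{h}_A^\vee$ with $\mu-\nu\in Q_A$. The modules $X(\mu)$ and $X(\nu)$ are isomorphic if and only if $\mu\approx\nu$.
   Context: The ground field is $\mathbb{C}$; all modules are $\mathbb{Z}_2$-graded, homomorphisms preserve the grading, $\bar u$ denotes parity, and $\Pi$ is the parity change functor. Let $I=\{1,\dots,a\}\cup\{-1,\dots,-b\}$ (all positive, resp. negative, integers if $a=\infty$, resp. $b=\infty$). The Weyl superalgebra $D(a|b)$ has generators $x_i,\partial_i$ ($i\in I$), even for $i>0$ and odd for $i<0$, with relations $[x_i,x_j]=[\partial_i,\partial_j]=0$, $[\partial_i,x_j]=\delta_{ij}$, where $[u,v]=uv-(-1)^{\bar u\bar v}vu$. The Clifford superalgebra $Cl(a|b)$ has generators $\xi_i,\eta_i$ ($i\in I$), even for $i>0$ and odd for $i<0$, with relations $\{\xi_i,\xi_j\}=\{\eta_i,\eta_j\}=0$, $\{\eta_i,\xi_j\}=\delta_{ij}$, where $\{u,v\}=uv+(-1)^{\bar u\bar v}vu$.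 Set $u_i=x_i\partial_i$ if $A=D(a|b)$, $u_i=\xi_i\eta_i$ if $A=Cl(a|b)$; $\mathfrak{h}_A=\operatorname{span}\{u_i\mid i\in I\}$; $\zeta_i\in\mathfrak{h}_A^*$ is dual to $u_i$, and $\mu\in\mathfrak{h}_A^*$ is written as a (possibly infinite) formal sum $\sum_i\mu_i\zeta_i$ with $\mu_i=\mu(u_i)$. $Q_A=\bigoplus_{i\in I}\mathbb{Z}\zeta_i$. The algebra $A$ is the direct sum of its weight spaces $A^\alpha$, $\alpha\in Q_A$, for the adjoint action of $\mathfrak{h}_A$; $H_A:=A^0$ is generated by $\mathfrak{h}_A$. The set of weights is $\mathfrak{h}_A^\vee=\{\mu\in\mathfrak{h}_A^*\mid\mu_i\in\{0,1\}\text{ for all }i<0\}$ if $A=D(a|b)$, and $\mathfrak{h}_A^\vee=\{\mu\in\mathfrak{h}_A^*\mid\mu_i\in\{0,1\}\text{ for all }i>0\}$ if $A=Cl(a|b)$. A weight $A$-module is an $A$-module $X$ semisimple over $H_A$, i.e. $X=\bigoplus_{\mu\in\mathfrak{h}_A^\vee}X^\mu$ with $X^\mu=\{x\mid hx=\mu(h)x\ \forall h\in\mathfrak{h}_A\}$; $\operatorname{supp}X=\{\mu\mid X^\mu\ne0\}$. $X$ is multiplicity free if all its nonzero weight spaces have total dimension $1$. Let $p:Q_A\to\mathbb{Z}_2$ be the homomorphism with $p(\zeta_i)=\bar 0$ for $i>0$, $p(\zeta_i)=\bar1$ for $i<0$, and fix once and for all a map $p:\mathfrak{h}_A^\vee\to\mathbb{Z}_2$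 such that $p(\mu+\alpha)=p(\mu)+p(\alpha)$ whenever $\mu,\mu+\alpha\in\mathfrak{h}_A^\vee$, $\alpha\in Q_A$. A weight module $X$ is preferred if for each $\mu\in\operatorname{supp}X$ the space $X^\mu$ is purely of parity $p(\mu)$. For $\mu,\nu\in\mathfrak{h}_A^\vee$ write $\mu\approx\nu$ if $\mu-\nu\in Q_A$ and $\{i\mid\mu_i\in\mathbb{Z}_{\ge0}\}=\{i\mid\nu_i\in\mathbb{Z}_{\ge0}\}$. *)

theory Defs
  imports
    "HOL-Algebra.QuotRing"
    "HOL-Algebra.Module"
    "HOL-Library.Poly_Mapping"
    "HOL-Library.Extended_Nat"
    "HOL-Library.Z2"
begin

section \<open>Associative superalgebras and their graded left modules\<close>

text \<open>
  Parities are elements of the field \<^typ>\<open>bit\<close>.  A complex superalgebra is a ring together with the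
  map \<open>c \<mapsto> c \<cdot> 1\<close> and its homogeneous components.  The complex vector space structure
  of a module is the action of the elements \<open>c \<cdot> 1\<close>, so \<open>A\<close>-linear maps are automatically
  \<open>\<complex>\<close>-linear.  HOL-Algebra's locale \<^locale>\<open>module\<close> requires a commutative base ring, so
  only its record type is reused (the fields \<open>mult\<close> and \<open>one\<close> of a module play no role).
\<close>

record 'a superalgebra = "'a ring" +
  scal :: "complex \<Rightarrow> 'a"
  part :: "bit \<Rightarrow> 'a set"

record ('a, 'm) supermodule = "('a, 'm) module" +
  mpart :: "bit \<Rightarrow> 'm set"

definition internal_direct_sum ::
    "('m, 'z) ring_scheme \<Rightarrow> ('i \<Rightarrow> 'm set) \<Rightarrow> 'i set \<Rightarrow> bool" where
  "internal_direct_sum M S C \<longleftrightarrow>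
     (\<forall>c\<in>C. additive_subgroup (S c) M) \<and>
     (\<forall>x\<in>carrier M. \<exists>!f.
        (\<forall>c\<in>C. f c \<in> S c) \<and> (\<forall>c. c \<notin> C \<longrightarrow> f c = \<zero>\<^bsub>M\<^esub>) \<and>
        finite {c. f c \<noteq> \<zero>\<^bsub>M\<^esub>} \<and> x = (\<Oplus>\<^bsub>M\<^esub>c\<in>{c. f c \<noteq> \<zero>\<^bsub>M\<^esub>}. f c))"

locale left_supermodule =
  A?: ring A + M?: abelian_group M
  for A :: "('a, 'y) superalgebra_scheme" and M :: "('a, 'm, 'z) supermodule_scheme" +
  assumes smult_closed: "\<lbrakk>r \<in> carrier A; x \<in> carrier M\<rbrakk> \<Longrightarrow> r \<odot>\<^bsub>M\<^esub> x \<in> carrier M"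
    and smult_l_distr: "\<lbrakk>r \<in> carrier A; s \<in> carrier A; x \<in> carrier M\<rbrakk> \<Longrightarrow>
      (r \<oplus>\<^bsub>A\<^esub> s) \<odot>\<^bsub>M\<^esub> x = r \<odot>\<^bsub>M\<^esub> x \<oplus>\<^bsub>M\<^esub> s \<odot>\<^bsub>M\<^esub> x"
    and smult_r_distr: "\<lbrakk>r \<in> carrier A; x \<in> carrier M; y \<in> carrier M\<rbrakk> \<Longrightarrow>
      r \<odot>\<^bsub>M\<^esub> (x \<oplus>\<^bsub>M\<^esub> y) = r \<odot>\<^bsub>M\<^esub> x \<oplus>\<^bsub>M\<^esub> r \<odot>\<^bsub>M\<^esub> y"
    and smult_assoc: "\<lbrakk>r \<in> carrier A; s \<in> carrier A; x \<in> carrier M\<rbrakk> \<Longrightarrow>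
      (r \<otimes>\<^bsub>A\<^esub> s) \<odot>\<^bsub>M\<^esub> x = r \<odot>\<^bsub>M\<^esub> (s \<odot>\<^bsub>M\<^esub> x)"
    and smult_one: "x \<in> carrier M \<Longrightarrow> \<one>\<^bsub>A\<^esub> \<odot>\<^bsub>M\<^esub> x = x"
    and graded: "internal_direct_sum M (mpart M) UNIV"
    and smult_graded: "\<lbrakk>r \<in> part A d; x \<in> mpart M e\<rbrakk> \<Longrightarrow> r \<odot>\<^bsub>M\<^esub> x \<in> mpart M (d + e)"

definition graded_submodule ::
    "('a, 'y) superalgebra_scheme \<Rightarrow> ('a, 'm, 'z) supermodule_scheme \<Rightarrow> 'm set \<Rightarrow> bool" where
  "graded_submodule A M N \<longleftrightarrow>
     additive_subgroup N M \<and>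
     (\<forall>r\<in>carrier A. \<forall>x\<in>N. r \<odot>\<^bsub>M\<^esub> x \<in> N) \<and>
     (\<forall>x\<in>N. \<exists>y\<in>N \<inter> mpart M 0. \<exists>z\<in>N \<inter> mpart M 1. x = y \<oplus>\<^bsub>M\<^esub> z)"

definition simple_supermodule ::
    "('a, 'y) superalgebra_scheme \<Rightarrow> ('a, 'm, 'z) supermodule_scheme \<Rightarrow> bool" where
  "simple_supermodule A M \<longleftrightarrow>
     left_supermodule A M \<and> carrier M \<noteq> {\<zero>\<^bsub>M\<^esub>} \<and>
     (\<forall>N. graded_submodule A M N \<longrightarrow> N = {\<zero>\<^bsub>M\<^esub>} \<or> N = carrier M)"

definition supermodule_hom ::
    "('a, 'y) superalgebra_scheme \<Rightarrow> ('a, 'm, 'z) supermodule_scheme \<Rightarrow>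
     ('a, 'n, 'w) supermodule_scheme \<Rightarrow> ('m \<Rightarrow> 'n) set" where
  "supermodule_hom A M N =
     {f. f \<in> carrier M \<rightarrow> carrier N \<and>
         (\<forall>x\<in>carrier M. \<forall>y\<in>carrier M. f (x \<oplus>\<^bsub>M\<^esub> y) = f x \<oplus>\<^bsub>N\<^esub> f y) \<and>
         (\<forall>r\<in>carrier A. \<forall>x\<in>carrier M. f (r \<odot>\<^bsub>M\<^esub> x) = r \<odot>\<^bsub>N\<^esub> f x) \<and>
         (\<forall>d. f ` mpart M d \<subseteq> mpart N d)}"

definition supermodule_iso ::
    "('a, 'y) superalgebra_scheme \<Rightarrow> ('a, 'm, 'z) supermodule_scheme \<Rightarrow>
     ('a, 'n, 'w) supermodule_scheme \<Rightarrow> bool" where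
  "supermodule_iso A M N \<longleftrightarrow>
     (\<exists>f\<in>supermodule_hom A M N. bij_betw f (carrier M) (carrier N))"

text \<open>
  Parity change.  Some authors twist the action on \<open>\<Pi>M\<close> by the sign \<open>(-1)\<close> to the parity of
  the acting element; \<open>x \<mapsto> (-1)\<close> to the parity of \<open>x\<close> times \<open>x\<close> is an even isomorphism
  between the two versions.
\<close>

definition parity_change ::
    "('a, 'm, 'z) supermodule_scheme \<Rightarrow> ('a, 'm, 'z) supermodule_scheme" where
  "parity_change M = M\<lparr>mpart := (\<lambda>d. mpart M (d + 1))\<rparr>"


section \<open>The Weyl and Clifford superalgebras\<close>

definition index_set :: "enat \<Rightarrow> enat \<Rightarrow> int set" where
  "index_set a b = {i. 0 < i \<and> enat (nat i) \<le> a} \<union> {i. i < 0 \<and> enat (nat (- i)) \<le> b}"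

text \<open>
  \<open>Cre i\<close> stands for \<open>x\<^sub>i\<close> (Weyl) or \<open>\<xi>\<^sub>i\<close> (Clifford), and \<open>Ann i\<close> for
  \<open>\<partial>\<^sub>i\<close> or \<open>\<eta>\<^sub>i\<close>.
\<close>

datatype generator = Cre int | Ann int

fun gindex :: "generator \<Rightarrow> int" where
  "gindex (Cre i) = i"
| "gindex (Ann i) = i"

definition index_parity :: "int \<Rightarrow> bit" where
  "index_parity i = (if i < 0 then 1 else 0)"

text \<open>
  The free monoid, written additively so that \<open>(generator word \<Rightarrow>\<^sub>0 complex)\<close> with the convolution
  product of \<^theory>\<open>HOL-Library.Poly_Mapping\<close> is the free associative algebra.
\<close>

datatype 'g word = Word (letters: "'g list")

instantiation word :: (type) monoid_add
begin

definition zero_word :: "'a word" where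
  "zero_word = Word []"

definition plus_word :: "'a word \<Rightarrow> 'a word \<Rightarrow> 'a word" where
  "plus_word v w = Word (letters v @ letters w)"

instance
  by standard (simp_all add: zero_word_def plus_word_def)

end

type_synonym free_elt = "generator word \<Rightarrow>\<^sub>0 complex"

definition const :: "complex \<Rightarrow> free_elt" where
  "const c = Poly_Mapping.single 0 c"

definition gen :: "generator \<Rightarrow> free_elt" where
  "gen g = Poly_Mapping.single (Word [g]) 1"

definition word_parity :: "generator word \<Rightarrow> bit" where
  "word_parity w = (\<Sum>g\<leftarrow>letters w. index_parity (gindex g))"

definition free_algebra :: "int set \<Rightarrow> free_elt ring" where
  "free_algebra I =
     \<lparr>carrier = {f. \<forall>w\<in>Poly_Mapping.keys f. gindex ` set (letters w) \<subseteq> I},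
      mult = (*), one = 1, zero = 0, add = (+)\<rparr>"

datatype kind = Weyl | Clifford

definition parity_sign :: "bit \<Rightarrow> complex" where
  "parity_sign d = (if d = 1 then - 1 else 1)"

text \<open>
  \<open>bracket Weyl\<close> is the supercommutator \<open>[g,h]\<close> and \<open>bracket Clifford\<close> the superanticommutator
  \<open>{g,h}\<close> of two generators.
\<close>

fun bracket :: "kind \<Rightarrow> generator \<Rightarrow> generator \<Rightarrow> free_elt" where
  "bracket Weyl g h = gen g * gen h -
     const (parity_sign (index_parity (gindex g) * index_parity (gindex h))) * (gen h * gen g)"
| "bracket Clifford g h = gen g * gen h +
     const (parity_sign (index_parity (gindex g) * index_parity (gindex h))) * (gen h * gen g)"

definition relators :: "kind \<Rightarrow> int set \<Rightarrow> free_elt set" where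
  "relators k I =
     {bracket k (Cre i) (Cre j) | i j. i \<in> I \<and> j \<in> I} \<union>
     {bracket k (Ann i) (Ann j) | i j. i \<in> I \<and> j \<in> I} \<union>
     {bracket k (Ann i) (Cre j) - const (if i = j then 1 else 0) | i j. i \<in> I \<and> j \<in> I}"

definition relation_ideal :: "kind \<Rightarrow> enat \<Rightarrow> enat \<Rightarrow> free_elt set" where
  "relation_ideal k a b =
     genideal (free_algebra (index_set a b)) (relators k (index_set a b))"

text \<open>The class in \<open>D(a|b)\<close> or \<open>Cl(a|b)\<close> of an element of the free algebra.\<close>

definition cls :: "kind \<Rightarrow> enat \<Rightarrow> enat \<Rightarrow> free_elt \<Rightarrow> free_elt set" where
  "cls k a b f = relation_ideal k a b +>\<^bsub>free_algebra (index_set a b)\<^esub> f"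

text \<open>\<open>salg Weyl a b\<close> is \<open>D(a|b)\<close> and \<open>salg Clifford a b\<close> is \<open>Cl(a|b)\<close>.\<close>

definition salg :: "kind \<Rightarrow> enat \<Rightarrow> enat \<Rightarrow> free_elt set superalgebra" where
  "salg k a b =
     (let F = free_algebra (index_set a b); R = F Quot relation_ideal k a b in
      \<lparr>carrier = carrier R, mult = mult R, one = one R, zero = zero R, add = add R,
       scal = (\<lambda>c. cls k a b (const c)),
       part = (\<lambda>d. cls k a b `
         {f \<in> carrier F. \<forall>w\<in>Poly_Mapping.keys f. word_parity w = d})\<rparr>)"


section \<open>Weights and weight modules\<close>

text \<open>
  A functional \<open>\<mu>\<close> on \<open>\<hh>\<^sub>A\<close> is represented by its coordinates \<open>\<mu>\<^sub>i = \<mu>(u\<^sub>i)\<close>,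
  extended by 0 outside the index set.
\<close>

type_synonym weight = "int \<Rightarrow> complex"

definition weights :: "kind \<Rightarrow> enat \<Rightarrow> enat \<Rightarrow> weight set" where
  "weights k a b =
     {\<mu>. (\<forall>i. i \<notin> index_set a b \<longrightarrow> \<mu> i = 0) \<and>
         (\<forall>i\<in>index_set a b.
            (case k of Weyl \<Rightarrow> i < 0 | Clifford \<Rightarrow> 0 < i) \<longrightarrow> \<mu> i \<in> {0, 1})}"

definition root_lattice :: "enat \<Rightarrow> enat \<Rightarrow> (int \<Rightarrow> int) set" where
  "root_lattice a b = {\<alpha>. finite {i. \<alpha> i \<noteq> 0} \<and> {i. \<alpha> i \<noteq> 0} \<subseteq> index_set a b}"

definition shift :: "weight \<Rightarrow> (int \<Rightarrow> int) \<Rightarrow> weight" where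
  "shift \<mu> \<alpha> = (\<lambda>i. \<mu> i + of_int (\<alpha> i))"

definition lattice_parity :: "(int \<Rightarrow> int) \<Rightarrow> bit" where
  "lattice_parity \<alpha> = (\<Sum>i\<in>{i. \<alpha> i \<noteq> 0}. of_int (\<alpha> i) * index_parity i)"

definition parity_map :: "kind \<Rightarrow> enat \<Rightarrow> enat \<Rightarrow> (weight \<Rightarrow> bit) \<Rightarrow> bool" where
  "parity_map k a b p \<longleftrightarrow>
     (\<forall>\<mu>\<in>weights k a b. \<forall>\<alpha>\<in>root_lattice a b.
        shift \<mu> \<alpha> \<in> weights k a b \<longrightarrow> p (shift \<mu> \<alpha>) = p \<mu> + lattice_parity \<alpha>)"

definition diff_in_lattice :: "enat \<Rightarrow> enat \<Rightarrow> weight \<Rightarrow> weight \<Rightarrow> bool" where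
  "diff_in_lattice a b \<mu> \<nu> \<longleftrightarrow> (\<exists>\<alpha>\<in>root_lattice a b. \<mu> = shift \<nu> \<alpha>)"

definition weight_equiv :: "enat \<Rightarrow> enat \<Rightarrow> weight \<Rightarrow> weight \<Rightarrow> bool" where
  "weight_equiv a b \<mu> \<nu> \<longleftrightarrow>
     diff_in_lattice a b \<mu> \<nu> \<and>
     {i \<in> index_set a b. \<mu> i \<in> \<nat>} = {i \<in> index_set a b. \<nu> i \<in> \<nat>}"

text \<open>
  The element \<open>\<Sum>\<^sub>i c\<^sub>i u\<^sub>i\<close> of \<open>\<hh>\<^sub>A\<close>; the value of \<open>\<mu>\<close> on it is
  \<open>\<Sum>\<^sub>i c\<^sub>i \<mu>\<^sub>i\<close>.
\<close>

definition cartan_elt :: "kind \<Rightarrow> enat \<Rightarrow> enat \<Rightarrow> (int \<Rightarrow>\<^sub>0 complex) \<Rightarrow> free_elt set" where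
  "cartan_elt k a b c = cls k a b
     (\<Sum>i\<in>Poly_Mapping.keys c. const (Poly_Mapping.lookup c i) * (gen (Cre i) * gen (Ann i)))"

definition weight_eval :: "weight \<Rightarrow> (int \<Rightarrow>\<^sub>0 complex) \<Rightarrow> complex" where
  "weight_eval \<mu> c = (\<Sum>i\<in>Poly_Mapping.keys c. Poly_Mapping.lookup c i * \<mu> i)"

definition weight_space ::
    "kind \<Rightarrow> enat \<Rightarrow> enat \<Rightarrow> (free_elt set, 'm) supermodule \<Rightarrow> weight \<Rightarrow> 'm set" where
  "weight_space k a b M \<mu> =
     {x \<in> carrier M. \<forall>c. Poly_Mapping.keys c \<subseteq> index_set a b \<longrightarrow>
        cartan_elt k a b c \<odot>\<^bsub>M\<^esub> x = scal (salg k a b) (weight_eval \<mu> c) \<odot>\<^bsub>M\<^esub> x}"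

definition weight_module ::
    "kind \<Rightarrow> enat \<Rightarrow> enat \<Rightarrow> (free_elt set, 'm) supermodule \<Rightarrow> bool" where
  "weight_module k a b M \<longleftrightarrow>
     left_supermodule (salg k a b) M \<and>
     internal_direct_sum M (weight_space k a b M) (weights k a b)"

definition simple_weight_module ::
    "kind \<Rightarrow> enat \<Rightarrow> enat \<Rightarrow> (free_elt set, 'm) supermodule \<Rightarrow> bool" where
  "simple_weight_module k a b M \<longleftrightarrow>
     weight_module k a b M \<and> simple_supermodule (salg k a b) M"

definition supp ::
    "kind \<Rightarrow> enat \<Rightarrow> enat \<Rightarrow> (free_elt set, 'm) supermodule \<Rightarrow> weight set" where
  "supp k a b M = {\<mu> \<in> weights k a b. weight_space k a b M \<mu> \<noteq> {\<zero>\<^bsub>M\<^esub>}}"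

definition one_dimensional ::
    "('a, 'y) superalgebra_scheme \<Rightarrow> ('a, 'm, 'z) supermodule_scheme \<Rightarrow> 'm set \<Rightarrow> bool" where
  "one_dimensional A M V \<longleftrightarrow>
     (\<exists>v\<in>V. v \<noteq> \<zero>\<^bsub>M\<^esub> \<and> V = {scal A c \<odot>\<^bsub>M\<^esub> v | c. True})"

definition multiplicity_free ::
    "kind \<Rightarrow> enat \<Rightarrow> enat \<Rightarrow> (free_elt set, 'm) supermodule \<Rightarrow> bool" where
  "multiplicity_free k a b M \<longleftrightarrow>
     (\<forall>\<mu>\<in>supp k a b M. one_dimensional (salg k a b) M (weight_space k a b M \<mu>))"

definition preferred ::
    "kind \<Rightarrow> enat \<Rightarrow> enat \<Rightarrow> (weight \<Rightarrow> bit) \<Rightarrow> (free_elt set, 'm) supermodule \<Rightarrow> bool" where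
  "preferred k a b p M \<longleftrightarrow>
     weight_module k a b M \<and>
     (\<forall>\<mu>\<in>supp k a b M. weight_space k a b M \<mu> \<subseteq> mpart M (p \<mu>))"

end

(*
  A word in the generators shifts weights, and a word of total weight zero can be rewritten, by
  exchanging neighbours and contracting a pair x_i, d_i, into a scalar on each weight space X^mu,
  the scalar depending on mu only.  Hence in a simple weight module X^mu is spanned by any of its
  nonzero vectors, and nonzero vectors of weight mu in two simple weight modules have the same
  annihilator; when they have the same parity, r u |-> r v is an isomorphism.  Existence: the formal
  monomials x^kappa, with kappa in one equivalence class, carry the action
  x_i x^kappa = +- x^(kappa + zeta_i), d_i x^kappa = +- kappa_i x^(kappa - zeta_i), where monomials
  outside the class are set to zero.
*)

theory Submission
  imports Defs
begin

subsection \<open>The free algebra\<close>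

text \<open>All computation takes place in the free algebra, where words have visible weights and
  parities; the quotient enters only through the way an element acts on a vector. Acting by a scalar
  on weight \<mu> becomes a congruence modulo a left ideal that depends on \<mu> alone, so one
  scalar serves every module. Truncation to a class is consistent with the relations because a class
  has few borders. The letter d_i leaves it only at \<kappa>_i = 0, where its factor \<kappa>_i is 0
  already; x_i leaves it only at \<kappa>_i = -1, or at \<kappa>_i = 1 when the letters of index i
  square to zero, and there d_i x_i has to act by 0. Inside a class no coefficient vanishes, which
  is why the module is simple. The signs cannot be read off \<kappa> itself, whose coordinates are
  complex numbers, infinitely many of them possibly nonzero. They are counted relative to a base
  point \<nu> of the class, from which \<kappa> differs by integers in finitely many
  coordinates.\<close>

lemma free_elt_induct [consumes 1, case_names zero add]:
  fixes f :: "'a \<Rightarrow>\<^sub>0 'b::ab_group_add"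
  assumes "Poly_Mapping.keys f \<subseteq> A"
    and "P 0"
    and "\<And>w c f. w \<in> A \<Longrightarrow> Poly_Mapping.keys f \<subseteq> A \<Longrightarrow> P f \<Longrightarrow> P (Poly_Mapping.single w c + f)"
  shows "P f"
  using assms(1)
proof (induction "card (Poly_Mapping.keys f)" arbitrary: f)
  case 0
  then show ?case using assms(2) by (simp add: card_eq_0_iff)
next
  case (Suc n)
  then obtain w where w: "w \<in> Poly_Mapping.keys f"
    by fastforce
  define g where "g = f - Poly_Mapping.single w (Poly_Mapping.lookup f w)"
  have lg: "Poly_Mapping.lookup g v = (if v = w then 0 else Poly_Mapping.lookup f v)" for v
    by (simp add: g_def lookup_minus lookup_single when_def)
  have "Poly_Mapping.keys g = Poly_Mapping.keys f - {w}"
    by (auto simp: in_keys_iff lg split: if_splits)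
  then have "n = card (Poly_Mapping.keys g)" "Poly_Mapping.keys g \<subseteq> A"
    using Suc w by auto
  with Suc.hyps(1) have "P g" "Poly_Mapping.keys g \<subseteq> A"
    by auto
  moreover have "f = Poly_Mapping.single w (Poly_Mapping.lookup f w) + g"
    by (simp add: g_def)
  ultimately show ?case
    using assms(3) w Suc.prems by (metis subsetD)
qed

abbreviation word_elt :: "generator list \<Rightarrow> free_elt" where
  "word_elt gs \<equiv> Poly_Mapping.single (Word gs) 1"

lemma gen_eq_word_elt: "gen g = word_elt [g]"
  by (simp add: gen_def)

lemma word_elt_Nil [simp]: "word_elt [] = 1"
  by (simp add: single_one flip: zero_word_def)

lemma word_elt_append: "word_elt (gs @ hs) = word_elt gs * word_elt hs"
  by (simp add: mult_single plus_word_def)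

lemma word_elt_Cons: "word_elt (g # gs) = gen g * word_elt gs"
  by (simp add: gen_eq_word_elt word_elt_append [symmetric])

lemma const_0 [simp]: "const 0 = 0" and const_1 [simp]: "const 1 = 1"
  by (simp_all add: const_def single_one)

lemma const_add: "const (c + d) = const c + const d"
  by (simp add: const_def single_add)

lemma const_uminus: "const (- c) = - const c"
  by (simp add: const_def single_uminus)

lemma const_diff: "const (c - d) = const c - const d"
  by (simp add: const_def single_diff)

lemma const_mult: "const (c * d) = const c * const d"
  by (simp add: const_def mult_single)

lemma single_eq_const_word_elt: "Poly_Mapping.single w c = const c * word_elt (letters w)"
  by (simp add: const_def mult_single)

lemma const_commute: "f * const c = const c * f"
proof -
  have "Poly_Mapping.keys f \<subseteq> UNIV" by simp
  then show ?thesis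
    by (induction rule: free_elt_induct)
       (simp_all add: algebra_simps const_def mult_single)
qed

lemma gen_const_left:
  "gen g * const c = const c * gen g" "gen g * (const c * f) = const c * (gen g * f)"
  by (simp_all add: const_commute flip: mult.assoc)

text \<open>Scalars move to the front of every product under these rules and
  \<open>const_collect_left\<close>; what remains of a noncommutative identity is then within reach
  of \<open>algebra_simps\<close>.\<close>

lemmas const_collect = gen_const_left
  const_commute [of "word_elt gs" for gs]
  const_mult [symmetric]

lemma const_collect_left:
  "word_elt gs * (const c * f) = const c * (word_elt gs * f)"
  "const c * (const d * f) = const (c * d) * f"
  by (simp_all add: const_commute [of "word_elt gs"] const_mult flip: mult.assoc)

definition words_over :: "int set \<Rightarrow> generator word set" where
  "words_over I = {w. gindex ` set (letters w) \<subseteq> I}"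

lemma free_carrier: "carrier (free_algebra I) = {f. Poly_Mapping.keys f \<subseteq> words_over I}"
  by (auto simp: free_algebra_def words_over_def)

lemma free_ops [simp]:
  "mult (free_algebra I) = (*)" "one (free_algebra I) = 1"
  "zero (free_algebra I) = 0" "add (free_algebra I) = (+)"
  by (simp_all add: free_algebra_def)

lemma free_add: "f \<in> carrier (free_algebra I) \<Longrightarrow> g \<in> carrier (free_algebra I) \<Longrightarrow>
    f + g \<in> carrier (free_algebra I)"
  using keys_add [of f g] by (auto simp: free_carrier)

lemma free_uminus: "f \<in> carrier (free_algebra I) \<Longrightarrow> - f \<in> carrier (free_algebra I)"
  by (simp add: free_carrier)

lemma free_diff: "f \<in> carrier (free_algebra I) \<Longrightarrow> g \<in> carrier (free_algebra I) \<Longrightarrow>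
    f - g \<in> carrier (free_algebra I)"
  using free_add [of f I "- g"] free_uminus by simp

lemma free_mult: "f \<in> carrier (free_algebra I) \<Longrightarrow> g \<in> carrier (free_algebra I) \<Longrightarrow>
    f * g \<in> carrier (free_algebra I)"
  using keys_mult [of f g] by (fastforce simp: free_carrier words_over_def plus_word_def)

lemma free_zero: "0 \<in> carrier (free_algebra I)"
  by (simp add: free_carrier)

lemma free_single: "w \<in> words_over I \<Longrightarrow> Poly_Mapping.single w c \<in> carrier (free_algebra I)"
  by (simp add: free_carrier)

lemma free_const: "const c \<in> carrier (free_algebra I)"
  unfolding const_def by (rule free_single) (simp add: words_over_def zero_word_def)

lemma free_one: "1 \<in> carrier (free_algebra I)"
  using free_const [of 1] by simp

lemma free_gen: "gindex g \<in> I \<Longrightarrow> gen g \<in> carrier (free_algebra I)"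
  unfolding gen_def by (rule free_single) (simp add: words_over_def)

lemma free_word_elt: "gindex ` set gs \<subseteq> I \<Longrightarrow> word_elt gs \<in> carrier (free_algebra I)"
  by (rule free_single) (simp add: words_over_def)

lemmas free_intros = free_add free_uminus free_diff free_mult free_zero free_const free_one
  free_gen free_word_elt

lemma ring_free_algebra: "ring (free_algebra I)"
proof (rule ringI)
  show "abelian_group (free_algebra I)"
  proof (rule abelian_groupI)
    fix f assume "f \<in> carrier (free_algebra I)"
    then show "\<exists>g\<in>carrier (free_algebra I). g \<oplus>\<^bsub>free_algebra I\<^esub> f = \<zero>\<^bsub>free_algebra I\<^esub>"
      by (intro bexI [of _ "- f"]) (simp_all add: free_uminus)
  qed (simp_all add: free_add free_zero add.assoc add.commute)
  show "Group.monoid (free_algebra I)"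
    by (rule monoidI) (simp_all add: free_mult free_one mult.assoc)
qed (simp_all add: algebra_simps)


subsection \<open>The defining relations\<close>

text \<open>The super sign for Weyl and its negative for Clifford. With it the relations of both
  algebras take the shape g h = s h g + c, and all later arguments treat the two kinds at
  once.\<close>

definition exchange_sign :: "kind \<Rightarrow> generator \<Rightarrow> generator \<Rightarrow> complex" where
  "exchange_sign k g h =
     (case k of Weyl \<Rightarrow> 1 | Clifford \<Rightarrow> - 1) *
     parity_sign (index_parity (gindex g) * index_parity (gindex h))"

text \<open>The scalar left over when two letters are swapped. The value for \<open>Cre\<close>
  before \<open>Ann\<close> comes from solving the defining relation for the opposite order, which
  divides by a sign equal to its own inverse.\<close>

fun contraction :: "kind \<Rightarrow> generator \<Rightarrow> generator \<Rightarrow> complex" where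
  "contraction k (Ann i) (Cre j) = (if i = j then 1 else 0)"
| "contraction k (Cre i) (Ann j) = (if i = j then - exchange_sign k (Cre i) (Ann j) else 0)"
| "contraction k _ _ = 0"

definition exchange_relator :: "kind \<Rightarrow> generator \<Rightarrow> generator \<Rightarrow> free_elt" where
  "exchange_relator k g h =
     gen g * gen h - const (exchange_sign k g h) * (gen h * gen g) - const (contraction k g h)"

lemma exchange_sign_cases: "exchange_sign k g h = 1 \<or> exchange_sign k g h = - 1"
  by (simp add: exchange_sign_def parity_sign_def split: kind.split)

lemma exchange_sign_commute: "exchange_sign k g h = exchange_sign k h g"
  by (simp add: exchange_sign_def mult.commute)

lemma exchange_sign_cong:
  "gindex g = gindex g' \<Longrightarrow> gindex h = gindex h' \<Longrightarrow> exchange_sign k g h = exchange_sign k g' h'"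
  by (simp add: exchange_sign_def)

lemma exchange_sign_square [simp]: "exchange_sign k g h * exchange_sign k g h = 1"
  using exchange_sign_cases [of k g h] by auto

lemma bracket_eq:
  "bracket k g h = gen g * gen h - const (exchange_sign k g h) * (gen h * gen g)"
  by (cases k) (simp_all add: exchange_sign_def const_uminus)

lemma relators_subset: "relators k I \<subseteq> carrier (free_algebra I)"
  unfolding relators_def bracket_eq by (auto intro!: free_intros)

abbreviation rel_ideal :: "kind \<Rightarrow> int set \<Rightarrow> free_elt set" where
  "rel_ideal k I \<equiv> genideal (free_algebra I) (relators k I)"

lemma rel_ideal_ideal: "ideal (rel_ideal k I) (free_algebra I)"
  by (rule ring.genideal_ideal [OF ring_free_algebra relators_subset])

lemma rel_ideal_carrier: "f \<in> rel_ideal k I \<Longrightarrow> f \<in> carrier (free_algebra I)"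
  using ideal.Icarr [OF rel_ideal_ideal] .

lemma rel_ideal_zero: "0 \<in> rel_ideal k I"
  using additive_subgroup.zero_closed [OF ideal.axioms(1) [OF rel_ideal_ideal]] by simp

lemma rel_ideal_add: "f \<in> rel_ideal k I \<Longrightarrow> g \<in> rel_ideal k I \<Longrightarrow> f + g \<in> rel_ideal k I"
  using additive_subgroup.a_closed [OF ideal.axioms(1) [OF rel_ideal_ideal]] by simp

lemma rel_ideal_left:
  "f \<in> carrier (free_algebra I) \<Longrightarrow> g \<in> rel_ideal k I \<Longrightarrow> f * g \<in> rel_ideal k I"
  using ideal.I_l_closed [OF rel_ideal_ideal] by simp

lemma rel_ideal_right:
  "f \<in> rel_ideal k I \<Longrightarrow> g \<in> carrier (free_algebra I) \<Longrightarrow> f * g \<in> rel_ideal k I"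
  using ideal.I_r_closed [OF rel_ideal_ideal] by simp

lemma rel_ideal_relator: "r \<in> relators k I \<Longrightarrow> r \<in> rel_ideal k I"
  using ring.genideal_self [OF ring_free_algebra relators_subset] by blast

lemma rel_ideal_uminus: "f \<in> rel_ideal k I \<Longrightarrow> - f \<in> rel_ideal k I"
  using rel_ideal_left [where f = "const (- 1)" and g = f, OF free_const] by (simp add: const_uminus)

text \<open>Three of the four letter patterns are defining relators. The fourth, \<open>Cre\<close>
  before \<open>Ann\<close>, is the reversed relator times the negated sign.\<close>

lemma exchange_relator_in_rel_ideal:
  assumes "gindex g \<in> I" "gindex h \<in> I"
  shows "exchange_relator k g h \<in> rel_ideal k I"
proof -
  have relator: "exchange_relator k g h \<in> rel_ideal k I"
    if "bracket k g h - const (contraction k g h) \<in> relators k I" for g h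
    using rel_ideal_relator [OF that] unfolding exchange_relator_def bracket_eq .
  have same: "bracket k (Cre i) (Cre j) \<in> relators k I" "bracket k (Ann i) (Ann j) \<in> relators k I"
    and mixed: "bracket k (Ann i) (Cre j) - const (if i = j then 1 else 0) \<in> relators k I"
    if "i \<in> I" "j \<in> I" for i j
    unfolding relators_def using that by blast+
  show ?thesis
  proof (cases g; cases h)
    fix i j assume gh: "g = Cre i" "h = Ann j"
    let ?s = "exchange_sign k (Ann j) (Cre i)"
    have "const (- ?s) * exchange_relator k h g \<in> rel_ideal k I"
      using assms gh mixed [of j i] by (intro rel_ideal_left free_const relator) simp
    also have "const (- ?s) * exchange_relator k h g = exchange_relator k g h"
    proof -
      have "?s = 1 \<and> exchange_sign k (Cre i) (Ann j) = 1 \<or>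
            ?s = - 1 \<and> exchange_sign k (Cre i) (Ann j) = - 1"
        using exchange_sign_cases [of k "Ann j" "Cre i"] exchange_sign_commute by metis
      then show ?thesis by (auto simp: gh exchange_relator_def const_uminus)
    qed
    finally show ?thesis .
  next
    fix i j assume "g = Cre i" "h = Cre j"
    then show ?thesis using assms same [of i j] by (intro relator) simp
  next
    fix i j assume "g = Ann i" "h = Cre j"
    then show ?thesis using assms mixed [of i j] by (intro relator) simp
  next
    fix i j assume "g = Ann i" "h = Ann j"
    then show ?thesis using assms same [of i j] by (intro relator) simp
  qed
qed

text \<open>The indices whose letters square to zero: the odd ones for Weyl, the even ones for
  Clifford. They are also the indices at which \<open>weights\<close> confines a coordinate to 0 and
  1; the other indices behave like polynomial variables.\<close>

definition fermionic :: "kind \<Rightarrow> int \<Rightarrow> bool" where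
  "fermionic k i \<longleftrightarrow> (case k of Weyl \<Rightarrow> i < 0 | Clifford \<Rightarrow> 0 < i)"

text \<open>Index 0 must be excluded: for Clifford it would count as even and receive the sign -1
  without being \<open>fermionic\<close>.\<close>

lemma exchange_sign_same:
  assumes "gindex g = i" "gindex h = i" "i \<noteq> 0"
  shows "exchange_sign k g h = (if fermionic k i then - 1 else 1)"
  using assms
  by (auto simp: exchange_sign_def fermionic_def parity_sign_def index_parity_def split: kind.split)

text \<open>A swap of a letter with itself has sign -1 here, so the relator is twice the square;
  halving it is the whole argument.\<close>

lemma fermionic_square:
  assumes "fermionic k (gindex g)" "gindex g \<in> I" "gindex g \<noteq> 0"
  shows "gen g * gen g \<in> rel_ideal k I"
proof -
  have "contraction k g g = 0" by (cases g) auto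
  then have "const (1/2) * exchange_relator k g g = const (1/2 + 1/2) * (gen g * gen g)"
    unfolding const_add exchange_relator_def
    using exchange_sign_same [of g "gindex g" g k] assms by (simp add: const_uminus algebra_simps)
  then show ?thesis
    using rel_ideal_left [OF free_const exchange_relator_in_rel_ideal [of g I g k], of "1/2"] assms
    by simp
qed


subsection \<open>The left ideal of a weight\<close>

fun letter_weight :: "generator \<Rightarrow> int \<Rightarrow> int" where
  "letter_weight (Cre i) = (\<lambda>j. if j = i then 1 else 0)"
| "letter_weight (Ann i) = (\<lambda>j. if j = i then - 1 else 0)"

definition word_weight :: "generator word \<Rightarrow> int \<Rightarrow> int" where
  "word_weight w = (\<lambda>j. \<Sum>g\<leftarrow>letters w. letter_weight g j)"

lemma word_weight_Cons:
  "word_weight (Word (g # gs)) = (\<lambda>j. letter_weight g j + word_weight (Word gs) j)"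
  by (simp add: word_weight_def)

lemma word_weight_Nil [simp]: "word_weight (Word []) = (\<lambda>j. 0)"
  by (simp add: word_weight_def)

lemma shift_zero [simp]: "shift \<mu> (\<lambda>j. 0) = \<mu>"
  by (simp add: shift_def)

lemma shift_shift: "shift (shift \<mu> \<alpha>) \<beta> = shift \<mu> (\<lambda>j. \<beta> j + \<alpha> j)"
  by (simp add: shift_def fun_eq_iff)

text \<open>The left ideal whose quotient is the universal cyclic module on a vector of weight
  \<mu>: a vector has weight \<mu> exactly when this ideal kills it, as \<open>wspace_iff\<close>
  shows. Generating it inductively turns claims about it into rule inductions.\<close>

inductive left_rel :: "kind \<Rightarrow> int set \<Rightarrow> weight \<Rightarrow> free_elt \<Rightarrow> bool" for k I \<mu> where
  left_rel_ideal: "f \<in> rel_ideal k I \<Longrightarrow> left_rel k I \<mu> f"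
| left_rel_cartan: "i \<in> I \<Longrightarrow> left_rel k I \<mu> (gen (Cre i) * gen (Ann i) - const (\<mu> i))"
| left_rel_add: "left_rel k I \<mu> f \<Longrightarrow> left_rel k I \<mu> g \<Longrightarrow> left_rel k I \<mu> (f + g)"
| left_rel_mult: "f \<in> carrier (free_algebra I) \<Longrightarrow> left_rel k I \<mu> g \<Longrightarrow> left_rel k I \<mu> (f * g)"

lemma left_rel_uminus: "left_rel k I \<mu> f \<Longrightarrow> left_rel k I \<mu> (- f)"
  using left_rel_mult [where f = "const (- 1)" and g = f, OF free_const] by (simp add: const_uminus)

lemma left_rel_diff: "left_rel k I \<mu> f \<Longrightarrow> left_rel k I \<mu> g \<Longrightarrow> left_rel k I \<mu> (f - g)"
  using left_rel_add [of k I \<mu> f "- g"] left_rel_uminus by simp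

lemma left_rel_trans:
  "left_rel k I \<mu> (f - g) \<Longrightarrow> left_rel k I \<mu> (g - h) \<Longrightarrow> left_rel k I \<mu> (f - h)"
  using left_rel_add [of k I \<mu> "f - g" "g - h"] by simp

text \<open>Modulo the relations the commutator of \<open>u_i\<close> and \<open>g\<close> is the
  weight of \<open>g\<close> at \<open>i\<close> times \<open>g\<close>, so the product is congruent
  to \<open>g\<close> times \<open>u_i - \<mu>_i\<close>.\<close>

lemma left_rel_cartan_gen:
  assumes "gindex g \<in> I" "i \<in> I" "0 \<notin> I"
  shows "left_rel k I \<mu> ((gen (Cre i) * gen (Ann i) - const (shift \<mu> (letter_weight g) i)) * gen g)"
    (is "left_rel k I \<mu> ?E")
proof (cases "gindex g = i")
  case False
  let ?s = "exchange_sign k (Cre i) g"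
  have s: "exchange_sign k (Ann i) g = ?s"
    by (rule exchange_sign_cong) auto
  have l: "letter_weight g i = 0" "contraction k (Ann i) g = 0" "contraction k (Cre i) g = 0"
    using False by (cases g; auto)+
  \<comment> \<open>The letter \<open>g\<close> passes \<open>Ann i\<close> and then
    \<open>Cre i\<close>; both swaps carry the same sign, and its square is 1.\<close>
  have "?E = gen (Cre i) * exchange_relator k (Ann i) g
     + const ?s * (exchange_relator k (Cre i) g * gen (Ann i))
     + gen g * (gen (Cre i) * gen (Ann i) - const (\<mu> i))"
    using exchange_sign_cases [of k "Cre i" g]
    by (auto simp: exchange_relator_def s l shift_def const_uminus algebra_simps const_collect const_collect_left)
  also have "left_rel k I \<mu> \<dots>"
    using assms
    by (intro left_rel_add left_rel_mult [OF free_gen] left_rel_cartan left_rel_ideal rel_ideal_left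
        rel_ideal_right exchange_relator_in_rel_ideal free_intros) auto
  finally show ?thesis .
next
  case True
  have i: "i \<noteq> 0" using assms by auto
  let ?R = "exchange_relator k (Ann i) (Cre i)"
  have R: "?R \<in> rel_ideal k I"
    using assms by (intro exchange_relator_in_rel_ideal) auto
  have s: "exchange_sign k (Ann i) (Cre i) = (if fermionic k i then - 1 else 1)"
    by (rule exchange_sign_same) (use i in auto)
  have C: "fermionic k i \<Longrightarrow> gen (Cre i) * gen (Cre i) * gen (Ann i) \<in> rel_ideal k I"
    using assms i by (intro rel_ideal_right fermionic_square free_intros) auto
  have A: "fermionic k i \<Longrightarrow> gen (Cre i) * (gen (Ann i) * gen (Ann i)) \<in> rel_ideal k I"
    using assms i by (intro rel_ideal_left fermionic_square free_intros) auto
  have u: "left_rel k I \<mu> (gen g * (gen (Cre i) * gen (Ann i) - const (\<mu> i)))"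
    using assms by (intro left_rel_mult left_rel_cartan free_intros) auto
  show ?thesis
  proof (cases g)
    case (Cre j)
    with True have g: "g = Cre i" by simp
    have CR: "left_rel k I \<mu> (gen (Cre i) * ?R)"
      using assms R by (intro left_rel_ideal rel_ideal_left free_intros) auto
    \<comment> \<open>With swap sign -1 two copies of \<open>Cre Cre Ann\<close> survive instead of
      cancelling; they lie in the ideal because the square of \<open>Cre i\<close> does. The case of
      \<open>Ann\<close> below is parallel.\<close>
    have D: "(if fermionic k i then gen (Cre i) * gen (Cre i) * gen (Ann i)
           + gen (Cre i) * gen (Cre i) * gen (Ann i) else 0) \<in> rel_ideal k I" (is "?D \<in> _")
      using C by (auto intro: rel_ideal_add rel_ideal_zero)
    have "?E = gen (Cre i) * ?R + gen (Cre i) * (gen (Cre i) * gen (Ann i) - const (\<mu> i))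
      - (if fermionic k i then gen (Cre i) * gen (Cre i) * gen (Ann i)
           + gen (Cre i) * gen (Cre i) * gen (Ann i) else 0)"
      by (simp add: g exchange_relator_def s shift_def const_add const_uminus algebra_simps const_collect const_collect_left)
    also have "left_rel k I \<mu> \<dots>"
      by (rule left_rel_diff [OF left_rel_add [OF CR u [unfolded g]] left_rel_ideal [OF D]])
    finally show ?thesis .
  next
    case (Ann j)
    with True have g: "g = Ann i" by simp
    have AR: "left_rel k I \<mu> (?R * gen (Ann i))"
      using assms R by (intro left_rel_ideal rel_ideal_right free_intros) auto
    have D: "(if fermionic k i then gen (Cre i) * (gen (Ann i) * gen (Ann i))
           + gen (Cre i) * (gen (Ann i) * gen (Ann i)) else 0) \<in> rel_ideal k I" (is "?D \<in> _")
      using A by (auto intro: rel_ideal_add rel_ideal_zero)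
    have "?E = gen (Ann i) * (gen (Cre i) * gen (Ann i) - const (\<mu> i)) - ?R * gen (Ann i)
      + (if fermionic k i then gen (Cre i) * (gen (Ann i) * gen (Ann i))
           + gen (Cre i) * (gen (Ann i) * gen (Ann i)) else 0)"
      by (simp add: g exchange_relator_def s shift_def const_diff const_add const_uminus algebra_simps const_collect const_collect_left)
    also have "left_rel k I \<mu> \<dots>"
      by (rule left_rel_add [OF left_rel_diff [OF u [unfolded g] AR] left_rel_ideal [OF D]])
    finally show ?thesis .
  qed
qed

text \<open>Right multiplication is the transpose of acting on vectors: a letter moves a vector of
  weight \<mu> to the shifted weight, so it carries the left ideal of the shifted weight into that
  of \<mu>.\<close>

lemma left_rel_shift_gen:
  assumes "left_rel k I (shift \<mu> (letter_weight g)) f" "gindex g \<in> I" "0 \<notin> I"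
  shows "left_rel k I \<mu> (f * gen g)"
  using assms(1)
proof induction
  case (left_rel_ideal f)
  then show ?case
    using assms by (intro left_rel.left_rel_ideal rel_ideal_right free_intros)
next
  case (left_rel_cartan i)
  then show ?case using assms by (intro left_rel_cartan_gen)
next
  case (left_rel_add f g)
  then show ?case by (auto simp: distrib_right intro: left_rel.left_rel_add)
next
  case (left_rel_mult f g)
  then show ?case by (auto simp: mult.assoc intro: left_rel.left_rel_mult)
qed

lemma left_rel_shift_word_elt:
  assumes "left_rel k I (shift \<mu> (word_weight (Word gs))) f" "gindex ` set gs \<subseteq> I" "0 \<notin> I"
  shows "left_rel k I \<mu> (f * word_elt gs)"
  using assms(1,2)
proof (induction gs arbitrary: f)
  case (Cons g gs)
  have "left_rel k I (shift \<mu> (word_weight (Word gs))) (f * gen g)"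
    using Cons.prems assms(3) by (intro left_rel_shift_gen) (simp_all add: shift_shift word_weight_Cons)
  then show ?case
    using Cons by (simp add: word_elt_Cons flip: mult.assoc)
qed simp

text \<open>At such an index \<open>u_i\<close> is idempotent modulo the relations, so \<mu>_i has
  to be a root of \<open>z^2 - z\<close> as soon as a nonzero vector of weight \<mu> exists. This is
  the source of the values 0 and 1 in \<open>weights\<close>.\<close>

lemma left_rel_fermionic:
  assumes "fermionic k i" "i \<in> I" "0 \<notin> I"
  shows "left_rel k I \<mu> (const (\<mu> i * \<mu> i - \<mu> i))"
proof -
  let ?C = "gen (Cre i)" and ?A = "gen (Ann i)"
  let ?R = "exchange_relator k (Ann i) (Cre i)" and ?u = "?C * ?A"
  have s: "exchange_sign k (Ann i) (Cre i) = - 1"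
    using assms exchange_sign_same [of "Ann i" i "Cre i" k] by auto
  have J: "?C * ?R * ?A - ?C * ?C * (?A * ?A) \<in> rel_ideal k I"
  proof -
    have "?C * ?R * ?A \<in> rel_ideal k I"
      using assms by (intro rel_ideal_left rel_ideal_right exchange_relator_in_rel_ideal free_intros) auto
    moreover have "?C * ?C * (?A * ?A) \<in> rel_ideal k I"
      using assms by (intro rel_ideal_right fermionic_square free_intros) auto
    ultimately show ?thesis
      using rel_ideal_add rel_ideal_uminus by fastforce
  qed
  have L: "left_rel k I \<mu> (?u - const (\<mu> i))"
    using assms by (intro left_rel_cartan)
  \<comment> \<open>The first bracket equals \<open>u^2 - u\<close>, and the product after it equals
    \<open>u^2 - \<mu>_i^2\<close>.\<close>
  have "const (\<mu> i * \<mu> i - \<mu> i) =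
      (?C * ?R * ?A - ?C * ?C * (?A * ?A)) - (?u + const (\<mu> i)) * (?u - const (\<mu> i)) + (?u - const (\<mu> i))"
    by (simp add: exchange_relator_def s const_diff const_uminus algebra_simps const_collect const_collect_left)
  also have "left_rel k I \<mu> \<dots>"
    using assms
    by (intro left_rel_add [OF left_rel_diff [OF left_rel_ideal [OF J] left_rel_mult [OF _ L]] L]
        free_intros) auto
  finally show ?thesis .
qed

lemma left_rel_pair:
  assumes "i \<in> I" "(g = Cre i \<and> h = Ann i) \<or> (g = Ann i \<and> h = Cre i)"
  shows "\<exists>c. left_rel k I \<mu> (gen g * gen h - const c)"
proof -
  let ?s = "exchange_sign k (Ann i) (Cre i)"
  have L: "left_rel k I \<mu> (gen (Cre i) * gen (Ann i) - const (\<mu> i))"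
    using assms by (intro left_rel_cartan)
  have "left_rel k I \<mu> (exchange_relator k (Ann i) (Cre i)
       + const ?s * (gen (Cre i) * gen (Ann i) - const (\<mu> i)))"
    using assms(1)
    by (intro left_rel_add [OF left_rel_ideal left_rel_mult [OF free_const L]]
        exchange_relator_in_rel_ideal) auto
  also have "exchange_relator k (Ann i) (Cre i)
       + const ?s * (gen (Cre i) * gen (Ann i) - const (\<mu> i)) =
      gen (Ann i) * gen (Cre i) - const (1 + ?s * \<mu> i)"
    by (simp add: exchange_relator_def const_add algebra_simps const_collect const_collect_left)
  finally show ?thesis using assms L by blast
qed

text \<open>Contractions occur between equal indices only, so crossing a block of another index
  costs just a scalar factor.\<close>

lemma exchange_past:
  assumes "gindex ` set hs \<subseteq> {i}" "gindex g \<noteq> i" "i \<in> I" "gindex g \<in> I"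
  shows "\<exists>s. word_elt (g # hs) - const s * word_elt (hs @ [g]) \<in> rel_ideal k I"
  using assms(1)
proof (induction hs)
  case Nil
  then show ?case by (intro exI [of _ 1]) (simp add: rel_ideal_zero)
next
  case (Cons h hs)
  then obtain s where s: "word_elt (g # hs) - const s * word_elt (hs @ [g]) \<in> rel_ideal k I"
    by auto
  have h: "gindex h = i" using Cons by simp
  let ?t = "exchange_sign k g h"
  have d: "contraction k g h = 0"
    using assms h by (cases g; cases h) auto
  have "word_elt (g # h # hs) - const (?t * s) * word_elt ((h # hs) @ [g]) =
      exchange_relator k g h * word_elt hs
      + const ?t * (gen h * (word_elt (g # hs) - const s * word_elt (hs @ [g])))"
    by (simp add: word_elt_Cons word_elt_append exchange_relator_def d algebra_simps const_collect const_collect_left)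
  also have "\<dots> \<in> rel_ideal k I"
    using assms h Cons.prems s
    by (intro rel_ideal_add rel_ideal_right rel_ideal_left exchange_relator_in_rel_ideal free_intros) auto
  finally show ?case by blast
qed

text \<open>With the letters of index \<open>i\<close> gathered in front, a weight condition at
  coordinate \<open>i\<close> speaks about a block in a single pair of generators.\<close>

lemma collect_index:
  assumes "gindex ` set gs \<subseteq> I" "i \<in> I"
  shows "\<exists>s. word_elt gs - const s *
     word_elt (filter (\<lambda>g. gindex g = i) gs @ filter (\<lambda>g. gindex g \<noteq> i) gs) \<in> rel_ideal k I"
  using assms(1)
proof (induction gs)
  case Nil
  then show ?case by (intro exI [of _ 1]) (simp add: rel_ideal_zero)
next
  case (Cons g gs)
  let ?p = "filter (\<lambda>g. gindex g = i) gs" and ?q = "filter (\<lambda>g. gindex g \<noteq> i) gs"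
  obtain s where "word_elt gs - const s * word_elt (?p @ ?q) \<in> rel_ideal k I"
    using Cons by auto
  then have 1: "gen g * (word_elt gs - const s * word_elt (?p @ ?q)) \<in> rel_ideal k I"
    using Cons.prems by (intro rel_ideal_left free_intros) auto
  show ?case
  proof (cases "gindex g = i")
    case True
    then show ?thesis using 1
      by (intro exI [of _ s]) (simp add: word_elt_Cons word_elt_append algebra_simps const_collect const_collect_left)
  next
    case False
    obtain t where t: "word_elt (g # ?p) - const t * word_elt (?p @ [g]) \<in> rel_ideal k I"
      using exchange_past [of ?p i g I k] False assms Cons.prems by auto
    then have 2: "const s * ((word_elt (g # ?p) - const t * word_elt (?p @ [g])) * word_elt ?q) \<in> rel_ideal k I"
      using Cons.prems by (intro rel_ideal_left rel_ideal_right free_intros) auto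
    have "word_elt (g # gs) - const (s * t) * word_elt (?p @ g # ?q) =
       gen g * (word_elt gs - const s * word_elt (?p @ ?q))
       + const s * ((word_elt (g # ?p) - const t * word_elt (?p @ [g])) * word_elt ?q)"
      by (simp add: word_elt_Cons word_elt_append algebra_simps const_collect const_collect_left)
    then show ?thesis using rel_ideal_add [OF 1 2] False by (intro exI [of _ "s*t"]) simp
  qed
qed

text \<open>If all neighbours agreed, the word would be a power of one letter, and its weight at
  \<open>i\<close> would be plus or minus its length.\<close>

lemma opposite_pair:
  assumes "gindex ` set gs \<subseteq> {i}" "gs \<noteq> []" "word_weight (Word gs) i = 0"
  obtains us g h vs where "gs = us @ [g, h] @ vs"
    "(g = Cre i \<and> h = Ann i) \<or> (g = Ann i \<and> h = Cre i)"
proof -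
  have letters: "g = Cre i \<or> g = Ann i" if "g \<in> set gs" for g
    using assms(1) that by (cases g) auto
  have "\<exists>us g h vs. gs = us @ [g, h] @ vs \<and> g \<noteq> h" 
  proof (rule ccontr)
    assume *: "\<not> ?thesis"
    have "\<exists>g n. xs = replicate n g" if "\<nexists>us g h vs. xs = us @ [g, h] @ vs \<and> g \<noteq> h"
      for xs :: "generator list"
      using that
    proof (induction xs)
      case (Cons x xs)
      have "\<nexists>us g h vs. xs = us @ [g, h] @ vs \<and> g \<noteq> h"
        using Cons.prems by (metis append_Cons)
      then obtain g n where g: "xs = replicate n g" using Cons by blast
      show ?case
      proof (cases n)
        case 0
        then show ?thesis using g by (intro exI [of _ x] exI [of _ 1]) simp
      next
        case (Suc m)
        then have "x = g" using Cons.prems g by (metis append_Cons append_Nil replicate_Suc)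
        then show ?thesis using g by (intro exI [of _ x] exI [of _ "Suc n"]) simp
      qed
    qed auto
    then obtain g n where g: "gs = replicate n g" using * by blast
    then have "g = Cre i \<or> g = Ann i" "n \<noteq> 0" using assms(2) letters by auto
    then show False using assms(3) by (auto simp: word_weight_def g sum_list_replicate)
  qed
  then obtain us g h vs where "gs = us @ [g, h] @ vs" "g \<noteq> h" by blast
  moreover from this have "g = Cre i \<or> g = Ann i" "h = Cre i \<or> h = Ann i"
    using letters by auto
  ultimately show ?thesis using that by blast
qed

text \<open>Among the letters of the first index an opposite pair is contracted, and the induction
  continues with the word shortened by two. The resulting scalar multiplies the factor of the
  rearrangement, the scalar of the pair and the scalar of the shorter word.\<close>

lemma left_rel_weight_zero:
  assumes "gindex ` set gs \<subseteq> I" "word_weight (Word gs) = (\<lambda>j. 0)" "0 \<notin> I"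
  shows "\<exists>c. left_rel k I \<mu> (word_elt gs - const c)"
  using assms(1,2)
proof (induction gs rule: length_induct)
  case (1 gs)
  show ?case
  proof (cases "gs = []")
    case True
    then show ?thesis by (intro exI [of _ 1]) (simp add: left_rel_ideal rel_ideal_zero)
  next
    case False
    define i where "i = gindex (hd gs)"
    have i: "i \<in> I" using 1 False by (auto simp: i_def)
    let ?p = "filter (\<lambda>g. gindex g = i) gs" and ?q = "filter (\<lambda>g. gindex g \<noteq> i) gs"
    \<comment> \<open>Letters of other indices contribute nothing to coordinate
      \<open>i\<close>.\<close>
    have weight_p: "word_weight (Word ?p) i = word_weight (Word hs) i" if "hs = gs" for hs
    proof -
      have "(\<Sum>g\<leftarrow>filter (\<lambda>g. gindex g = i) gs. letter_weight g i) = (\<Sum>g\<leftarrow>gs. letter_weight g i)" for gs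
      proof (induction gs)
        case (Cons g gs)
        then show ?case by (cases g) auto
      qed simp
      then show ?thesis using that by (simp add: word_weight_def)
    qed
    have "?p \<noteq> []" using False by (cases gs) (auto simp: i_def)
    then obtain us g h vs where p: "?p = us @ [g, h] @ vs"
      and gh: "(g = Cre i \<and> h = Ann i) \<or> (g = Ann i \<and> h = Cre i)"
      using weight_p [OF refl] 1 by (elim opposite_pair [of ?p i, rotated 3]) auto
    have in_I: "gindex ` set (us @ vs @ ?q) \<subseteq> I"
    proof -
      have "set (us @ vs) \<subseteq> set ?p" unfolding p by auto
      then show ?thesis using 1 by fastforce
    qed
    have len: "length (us @ vs @ ?q) < length gs"
    proof -
      have "length gs = length ?p + length ?q" by (simp add: sum_length_filter_compl)
      then show ?thesis by (simp add: p)
    qed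
    have sum_zero: "letter_weight g j + letter_weight h j = 0" for j
      using gh by auto
    have weight: "word_weight (Word (us @ vs @ ?q)) j = 0" for j
    proof -
      have "(\<Sum>g\<leftarrow>filter P gs. letter_weight g j) + (\<Sum>g\<leftarrow>filter (\<lambda>x. \<not> P x) gs. letter_weight g j)
           = (\<Sum>g\<leftarrow>gs. letter_weight g j)" for P gs
        by (induction gs) auto
      from this [of "\<lambda>g. gindex g = i" gs] have
        "(\<Sum>g\<leftarrow>?p. letter_weight g j) + (\<Sum>g\<leftarrow>?q. letter_weight g j) = 0"
        using fun_cong [OF "1.prems"(2), of j] by (simp add: word_weight_def)
      then show ?thesis using sum_zero [of j] by (simp add: p word_weight_def)
    qed
    then obtain c where c: "left_rel k I \<mu> (word_elt (us @ vs @ ?q) - const c)"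
      using 1 in_I len by (metis ext)
    \<comment> \<open>The pair acts after the letters to its right, so its scalar is taken at the
      weight to which they lead.\<close>
    obtain d where d: "left_rel k I (shift \<mu> (word_weight (Word (vs @ ?q)))) (gen g * gen h - const d)"
      using left_rel_pair [OF i gh] by blast
    have "left_rel k I \<mu> (word_elt us * ((gen g * gen h - const d) * word_elt (vs @ ?q)))"
      using in_I d assms(3) by (intro left_rel_mult left_rel_shift_word_elt free_intros) auto
    also have "word_elt us * ((gen g * gen h - const d) * word_elt (vs @ ?q)) =
        word_elt (?p @ ?q) - const d * word_elt (us @ vs @ ?q)"
      by (simp only: p word_elt_append word_elt_Cons word_elt_Nil left_diff_distrib right_diff_distrib
          mult.assoc const_collect_left mult_1_left)
    finally have "left_rel k I \<mu> (word_elt (?p @ ?q) - const d * word_elt (us @ vs @ ?q))" .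
    moreover have "left_rel k I \<mu> (const d * word_elt (us @ vs @ ?q) - const (d * c))"
      using left_rel_mult [OF free_const c, of d] by (simp only: right_diff_distrib const_mult)
    ultimately have "left_rel k I \<mu> (word_elt (?p @ ?q) - const (d * c))"
      by (rule left_rel_trans)
    from left_rel_mult [OF free_const this]
    have "left_rel k I \<mu> (const s * word_elt (?p @ ?q) - const (s * (d * c)))" for s
      by (simp only: right_diff_distrib const_mult)
    moreover obtain s where "word_elt gs - const s * word_elt (?p @ ?q) \<in> rel_ideal k I"
      using collect_index [of gs I i k] 1 i by auto
    ultimately have "left_rel k I \<mu> (word_elt gs - const (s * (d * c)))"
      by (blast intro: left_rel_trans left_rel_ideal)
    then show ?thesis by blast
  qed
qed


subsection \<open>Projections of an internal direct sum\<close>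

text \<open>Coordinate maps replace the unique finitely supported families: finite sums disappear
  from later proofs, and a vector is shown to be zero one component at a time.\<close>

definition direct_sum_projections ::
    "('m, 'z) ring_scheme \<Rightarrow> ('i \<Rightarrow> 'm set) \<Rightarrow> 'i set \<Rightarrow> ('i \<Rightarrow> 'm \<Rightarrow> 'm) \<Rightarrow> bool" where
  "direct_sum_projections M S C P \<longleftrightarrow>
    (\<forall>c\<in>C. \<forall>x\<in>carrier M. P c x \<in> S c) \<and>
    (\<forall>c\<in>C. \<forall>x\<in>carrier M. \<forall>y\<in>carrier M. P c (x \<oplus>\<^bsub>M\<^esub> y) = P c x \<oplus>\<^bsub>M\<^esub> P c y) \<and>
    (\<forall>c\<in>C. \<forall>x\<in>S c. P c x = x) \<and>
    (\<forall>c\<in>C. \<forall>d\<in>C. \<forall>x\<in>S d. c \<noteq> d \<longrightarrow> P c x = \<zero>\<^bsub>M\<^esub>) \<and>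
    (\<forall>x\<in>carrier M. (\<forall>c\<in>C. P c x = \<zero>\<^bsub>M\<^esub>) \<longrightarrow> x = \<zero>\<^bsub>M\<^esub>)"

lemma direct_sum_projectionsD:
  assumes "direct_sum_projections M S C P"
  shows "c \<in> C \<Longrightarrow> x \<in> carrier M \<Longrightarrow> P c x \<in> S c"
    and "c \<in> C \<Longrightarrow> x \<in> carrier M \<Longrightarrow> y \<in> carrier M \<Longrightarrow> P c (x \<oplus>\<^bsub>M\<^esub> y) = P c x \<oplus>\<^bsub>M\<^esub> P c y"
    and "c \<in> C \<Longrightarrow> x \<in> S c \<Longrightarrow> P c x = x"
    and "c \<in> C \<Longrightarrow> d \<in> C \<Longrightarrow> c \<noteq> d \<Longrightarrow> x \<in> S d \<Longrightarrow> P c x = \<zero>\<^bsub>M\<^esub>"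
    and "x \<in> carrier M \<Longrightarrow> (\<And>c. c \<in> C \<Longrightarrow> P c x = \<zero>\<^bsub>M\<^esub>) \<Longrightarrow> x = \<zero>\<^bsub>M\<^esub>"
  using assms unfolding direct_sum_projections_def by simp_all

lemma internal_direct_sum_projections:
  fixes M :: "('m, 'z) ring_scheme"
  assumes "abelian_group M" "internal_direct_sum M S C"
  obtains P where "direct_sum_projections M S C P"
proof -
  interpret M: abelian_group M by fact
  define dec where "dec x f \<longleftrightarrow> (\<forall>c\<in>C. f c \<in> S c) \<and> (\<forall>c. c \<notin> C \<longrightarrow> f c = \<zero>\<^bsub>M\<^esub>) \<and>
        finite {c. f c \<noteq> \<zero>\<^bsub>M\<^esub>} \<and> x = (\<Oplus>\<^bsub>M\<^esub>c\<in>{c. f c \<noteq> \<zero>\<^bsub>M\<^esub>}. f c)" for x f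
  have sub: "additive_subgroup (S c) M" if "c \<in> C" for c
    using assms(2) that unfolding internal_direct_sum_def by blast
  have ex1: "\<exists>!f. dec x f" if "x \<in> carrier M" for x
    using assms(2) that unfolding internal_direct_sum_def dec_def by blast
  define D where "D x = (THE f. dec x f)" for x
  have D: "dec x (D x)" if "x \<in> carrier M" for x
    unfolding D_def by (rule theI' [OF ex1 [OF that]])
  have D_eq: "D x = f" if "x \<in> carrier M" "dec x f" for x f
    using D ex1 that by blast
  have dec_in: "c \<in> C \<Longrightarrow> f c \<in> S c" and dec_out: "c \<notin> C \<Longrightarrow> f c = \<zero>\<^bsub>M\<^esub>"
    and dec_finite: "finite {c. f c \<noteq> \<zero>\<^bsub>M\<^esub>}"
    and dec_sum: "(\<Oplus>\<^bsub>M\<^esub>c\<in>{c. f c \<noteq> \<zero>\<^bsub>M\<^esub>}. f c) = x" if "dec x f" for x f c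
    using that unfolding dec_def by blast+
  have S_carrier: "x \<in> carrier M" if "c \<in> C" "x \<in> S c" for c x
    using additive_subgroup.a_Hcarr [OF sub] that by blast
  have S_zero: "\<zero>\<^bsub>M\<^esub> \<in> S c" if "c \<in> C" for c
    using additive_subgroup.zero_closed [OF sub [OF that]] .
  have dec_carrier: "f c \<in> carrier M" if "dec x f" for f c x
    using S_carrier dec_in [OF that] dec_out [OF that] by (cases "c \<in> C") auto
  \<comment> \<open>Two vectors may have different supports; their decompositions can be added only
    over a common finite set.\<close>
  have finsum_extend: "(\<Oplus>\<^bsub>M\<^esub>c\<in>{c. f c \<noteq> \<zero>\<^bsub>M\<^esub>}. f c) = (\<Oplus>\<^bsub>M\<^esub>c\<in>B. f c)"
    if "finite B" "{c. f c \<noteq> \<zero>\<^bsub>M\<^esub>} \<subseteq> B" "\<And>c. f c \<in> carrier M" for f :: "_ \<Rightarrow> 'm" and B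
    using that by (intro M.add.finprod_mono_neutral_cong_left) auto
  have single: "D x = (\<lambda>d. if d = c then x else \<zero>\<^bsub>M\<^esub>)" if "c \<in> C" "x \<in> S c" for c x
  proof (rule D_eq)
    show x: "x \<in> carrier M" using S_carrier that by blast
    let ?f = "\<lambda>d. if d = c then x else \<zero>\<^bsub>M\<^esub>"
    have "(\<Oplus>\<^bsub>M\<^esub>d\<in>{d. ?f d \<noteq> \<zero>\<^bsub>M\<^esub>}. ?f d) = (\<Oplus>\<^bsub>M\<^esub>d\<in>{c}. ?f d)"
      using x by (intro finsum_extend) auto
    also have "\<dots> = x" using x by simp
    finally have "x = (\<Oplus>\<^bsub>M\<^esub>d\<in>{d. ?f d \<noteq> \<zero>\<^bsub>M\<^esub>}. ?f d)" by simp
    moreover have "finite {d. ?f d \<noteq> \<zero>\<^bsub>M\<^esub>}"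
      by (rule finite_subset [of _ "{c}"]) auto
    ultimately show "dec x ?f" unfolding dec_def using that S_zero by simp
  qed
  have add: "D (x \<oplus>\<^bsub>M\<^esub> y) = (\<lambda>c. D x c \<oplus>\<^bsub>M\<^esub> D y c)"
    if x: "x \<in> carrier M" and y: "y \<in> carrier M" for x y
  proof (rule D_eq)
    let ?B = "{c. D x c \<noteq> \<zero>\<^bsub>M\<^esub>} \<union> {c. D y c \<noteq> \<zero>\<^bsub>M\<^esub>}"
    let ?f = "\<lambda>c. D x c \<oplus>\<^bsub>M\<^esub> D y c"
    have fin: "finite ?B" using dec_finite [OF D] x y by blast
    have car: "D x c \<in> carrier M" "D y c \<in> carrier M" for c
      using dec_carrier D x y by blast+
    have supp_sub: "{c. ?f c \<noteq> \<zero>\<^bsub>M\<^esub>} \<subseteq> ?B" by auto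
    have "(\<Oplus>\<^bsub>M\<^esub>c\<in>?B. D x c) = x" "(\<Oplus>\<^bsub>M\<^esub>c\<in>?B. D y c) = y"
      using finsum_extend [OF fin, of "D x"] finsum_extend [OF fin, of "D y"] car
        dec_sum [OF D [OF x]] dec_sum [OF D [OF y]] by auto
    then have "x \<oplus>\<^bsub>M\<^esub> y = (\<Oplus>\<^bsub>M\<^esub>c\<in>?B. D x c) \<oplus>\<^bsub>M\<^esub> (\<Oplus>\<^bsub>M\<^esub>c\<in>?B. D y c)"
      by simp
    also have "\<dots> = (\<Oplus>\<^bsub>M\<^esub>c\<in>?B. ?f c)"
      using car by (intro M.finsum_addf [symmetric]) auto
    also have "\<dots> = (\<Oplus>\<^bsub>M\<^esub>c\<in>{c. ?f c \<noteq> \<zero>\<^bsub>M\<^esub>}. ?f c)"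
      using car by (intro finsum_extend [OF fin supp_sub, symmetric]) auto
    finally show "dec (x \<oplus>\<^bsub>M\<^esub> y) ?f"
      unfolding dec_def
      using dec_in [OF D [OF x]] dec_in [OF D [OF y]] dec_out [OF D [OF x]] dec_out [OF D [OF y]]
        additive_subgroup.a_closed [OF sub] finite_subset [OF supp_sub fin]
      by simp
    show "x \<oplus>\<^bsub>M\<^esub> y \<in> carrier M" using x y by simp
  qed
  have sep: "x = \<zero>\<^bsub>M\<^esub>" if x: "x \<in> carrier M" and *: "\<And>c. c \<in> C \<Longrightarrow> D x c = \<zero>\<^bsub>M\<^esub>" for x
  proof -
    have "D x c = \<zero>\<^bsub>M\<^esub>" for c using dec_out [OF D [OF x]] * by (cases "c \<in> C") blast+
    then show ?thesis using dec_sum [OF D [OF x]] by simp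
  qed
  have "direct_sum_projections M S C (\<lambda>c x. D x c)"
    unfolding direct_sum_projections_def
  proof (intro conjI ballI impI)
    show "D x c \<in> S c" if "c \<in> C" "x \<in> carrier M" for c x
      using dec_in [OF D] that by blast
    show "D (x \<oplus>\<^bsub>M\<^esub> y) c = D x c \<oplus>\<^bsub>M\<^esub> D y c" if "x \<in> carrier M" "y \<in> carrier M" for c x y
      using add that by simp
    show "D x c = x" if "c \<in> C" "x \<in> S c" for c x using single that by simp
    show "D x c = \<zero>\<^bsub>M\<^esub>" if "d \<in> C" "c \<noteq> d" "x \<in> S d" for c d x using single that by simp
    show "x = \<zero>\<^bsub>M\<^esub>" if "x \<in> carrier M" "\<forall>c\<in>C. D x c = \<zero>\<^bsub>M\<^esub>" for x
      using sep that by blast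
  qed
  then show thesis by (rule that)
qed


subsection \<open>Modules over the free algebra\<close>

lemma zero_not_in_index_set: "0 \<notin> index_set a b"
  by (simp add: index_set_def)

section \<open>The quotient map from the free algebra onto the superalgebra\<close>

lemma cls_hom: "cls k a b \<in> ring_hom (free_algebra (index_set a b))
    (free_algebra (index_set a b) Quot rel_ideal k (index_set a b))"
proof -
  have "cls k a b = (+>\<^bsub>free_algebra (index_set a b)\<^esub>) (rel_ideal k (index_set a b))"
    by (rule ext) (simp add: cls_def relation_ideal_def)
  then show ?thesis using ideal.rcos_ring_hom [OF rel_ideal_ideal] by simp
qed

lemma salg_simps:
  "carrier (salg k a b) =
     carrier (free_algebra (index_set a b) Quot rel_ideal k (index_set a b))"
  "mult (salg k a b) = mult (free_algebra (index_set a b) Quot rel_ideal k (index_set a b))"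
  "add (salg k a b) = add (free_algebra (index_set a b) Quot rel_ideal k (index_set a b))"
  "one (salg k a b) = one (free_algebra (index_set a b) Quot rel_ideal k (index_set a b))"
  "zero (salg k a b) = zero (free_algebra (index_set a b) Quot rel_ideal k (index_set a b))"
  "scal (salg k a b) c = cls k a b (const c)"
  "part (salg k a b) d = cls k a b `
     {f \<in> carrier (free_algebra (index_set a b)). \<forall>w\<in>Poly_Mapping.keys f. word_parity w = d}"
  by (simp_all add: salg_def Let_def relation_ideal_def)

lemma cls_closed:
  "f \<in> carrier (free_algebra (index_set a b)) \<Longrightarrow> cls k a b f \<in> carrier (salg k a b)"
  unfolding salg_simps by (rule ring_hom_closed [OF cls_hom])

lemma cls_add:
  assumes "f \<in> carrier (free_algebra (index_set a b))" "g \<in> carrier (free_algebra (index_set a b))"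
  shows "cls k a b (f + g) = cls k a b f \<oplus>\<^bsub>salg k a b\<^esub> cls k a b g"
  using ring_hom_add [OF cls_hom assms] by (simp add: salg_simps)

lemma cls_mult:
  assumes "f \<in> carrier (free_algebra (index_set a b))" "g \<in> carrier (free_algebra (index_set a b))"
  shows "cls k a b (f * g) = cls k a b f \<otimes>\<^bsub>salg k a b\<^esub> cls k a b g"
  using ring_hom_mult [OF cls_hom assms] by (simp add: salg_simps)

lemma cls_one: "cls k a b 1 = \<one>\<^bsub>salg k a b\<^esub>"
  using ring_hom_one [OF cls_hom] by (simp add: salg_simps)

lemma cls_mem: "h \<in> cls k a b f \<longleftrightarrow> h - f \<in> rel_ideal k (index_set a b)"
proof -
  have "h \<in> cls k a b f \<longleftrightarrow> (\<exists>j\<in>rel_ideal k (index_set a b). h = j + f)"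
    by (simp add: cls_def relation_ideal_def a_r_coset_def')
  then show ?thesis by (metis add_diff_cancel_right' diff_add_cancel)
qed

lemma cls_cong:
  assumes "f - g \<in> rel_ideal k (index_set a b)"
  shows "cls k a b f = cls k a b g"
proof (rule Set.set_eqI)
  fix h
  show "h \<in> cls k a b f \<longleftrightarrow> h \<in> cls k a b g"
    unfolding cls_mem using assms rel_ideal_add [of "h - f" _ _ "f - g"]
      rel_ideal_add [of "h - g" _ _ "- (f - g)"] rel_ideal_uminus by fastforce
qed

lemma cls_surj:
  assumes "r \<in> carrier (salg k a b)"
  obtains f where "f \<in> carrier (free_algebra (index_set a b))" "r = cls k a b f"
  using assms unfolding salg_simps
  by (auto simp: FactRing_def A_RCOSETS_def' cls_def relation_ideal_def)

text \<open>Components of a given weight or parity are cut out in the free algebra, where the words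
  make them well defined.\<close>

definition word_restrict :: "(generator word \<Rightarrow> bool) \<Rightarrow> free_elt \<Rightarrow> free_elt" where
  "word_restrict P f = Poly_Mapping.mapp (\<lambda>w c. c when P w) f"

lemma lookup_word_restrict: 
  "Poly_Mapping.lookup (word_restrict P f) w = (Poly_Mapping.lookup f w when P w)"
  by (auto simp: word_restrict_def lookup_mapp when_def in_keys_iff)

lemma keys_word_restrict: "Poly_Mapping.keys (word_restrict P f) = {w \<in> Poly_Mapping.keys f. P w}"
  by (auto simp: in_keys_iff lookup_word_restrict)

lemma word_restrict_zero [simp]: "word_restrict P 0 = 0"
  by (rule poly_mapping_eqI) (simp add: lookup_word_restrict)

lemma word_restrict_single_add:
  "word_restrict P (Poly_Mapping.single w c + f) =
     (if P w then Poly_Mapping.single w c else 0) + word_restrict P f"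
  by (rule poly_mapping_eqI) (simp add: lookup_word_restrict lookup_add lookup_single when_def)

lemma free_word_restrict:
  "f \<in> carrier (free_algebra I) \<Longrightarrow> word_restrict P f \<in> carrier (free_algebra I)"
  by (auto simp: free_carrier keys_word_restrict)

lemma word_restrict_split: "f = word_restrict P f + word_restrict (\<lambda>w. \<not> P w) f"
  by (rule poly_mapping_eqI) (simp add: lookup_word_restrict lookup_add when_def)

lemma left_rel_weight_zero_combination:
  assumes "Poly_Mapping.keys f \<subseteq> {w \<in> words_over I. word_weight w = (\<lambda>j. 0)}" "0 \<notin> I"
  shows "\<exists>c. left_rel k I \<mu> (f - const c)"
  using assms(1)
proof (induction rule: free_elt_induct)
  case zero
  show ?case by (intro exI [of _ 0]) (simp add: left_rel_ideal rel_ideal_zero)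
next
  case (add w d f)
  obtain c where c: "left_rel k I \<mu> (f - const c)" using add by blast
  obtain e where "left_rel k I \<mu> (word_elt (letters w) - const e)"
    using left_rel_weight_zero [of "letters w" I k \<mu>] add assms(2) by (auto simp: words_over_def)
  from left_rel_add [OF left_rel_mult [OF free_const this, of d] c]
  have "left_rel k I \<mu> (Poly_Mapping.single w d + f - const (d * e + c))"
    by (simp only: single_eq_const_word_elt [of w d] const_add const_mult right_diff_distrib
        diff_add_eq diff_diff_eq add_diff_eq)
  then show ?case by blast
qed

section \<open>Evaluating elements of the free algebra on the vectors of a module\<close>

locale salg_module = left_supermodule "salg k a b" M
  for k a b and M :: "(free_elt set, 'm) supermodule"
begin

abbreviation "I \<equiv> index_set a b"
abbreviation "F \<equiv> carrier (free_algebra (index_set a b))"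
abbreviation wspace where "wspace \<equiv> weight_space k a b M"

definition ev :: "free_elt \<Rightarrow> 'm \<Rightarrow> 'm" where
  "ev f x = cls k a b f \<odot>\<^bsub>M\<^esub> x"

lemma ev_closed [simp, intro]: "f \<in> F \<Longrightarrow> x \<in> carrier M \<Longrightarrow> ev f x \<in> carrier M"
  by (simp add: ev_def smult_closed cls_closed)

lemma ev_add: "f \<in> F \<Longrightarrow> g \<in> F \<Longrightarrow> x \<in> carrier M \<Longrightarrow> ev (f + g) x = ev f x \<oplus>\<^bsub>M\<^esub> ev g x"
  by (simp add: ev_def cls_add smult_l_distr cls_closed)

lemma ev_mult: "f \<in> F \<Longrightarrow> g \<in> F \<Longrightarrow> x \<in> carrier M \<Longrightarrow> ev (f * g) x = ev f (ev g x)"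
  by (simp add: ev_def cls_mult smult_assoc cls_closed)

lemma ev_add_right:
  "f \<in> F \<Longrightarrow> x \<in> carrier M \<Longrightarrow> y \<in> carrier M \<Longrightarrow> ev f (x \<oplus>\<^bsub>M\<^esub> y) = ev f x \<oplus>\<^bsub>M\<^esub> ev f y"
  by (simp add: ev_def smult_r_distr cls_closed)

lemma ev_one [simp]: "x \<in> carrier M \<Longrightarrow> ev 1 x = x"
  by (simp add: ev_def cls_one smult_one)

lemma ev_zero [simp]: "x \<in> carrier M \<Longrightarrow> ev 0 x = \<zero>\<^bsub>M\<^esub>"
  using ev_add [of 0 0 x] ev_closed [of 0 x] by (simp add: free_zero)

lemma ev_zero_right [simp]: "f \<in> F \<Longrightarrow> ev f \<zero>\<^bsub>M\<^esub> = \<zero>\<^bsub>M\<^esub>"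
  using ev_add_right [of f "\<zero>\<^bsub>M\<^esub>" "\<zero>\<^bsub>M\<^esub>"] ev_closed [of f "\<zero>\<^bsub>M\<^esub>"] by simp

lemma ev_cong: "f - g \<in> rel_ideal k I \<Longrightarrow> ev f x = ev g x"
  by (simp add: ev_def cls_cong)

lemma ev_eq_iff:
  assumes "f \<in> F" "g \<in> F" "x \<in> carrier M"
  shows "ev f x = ev g x \<longleftrightarrow> ev (f - g) x = \<zero>\<^bsub>M\<^esub>"
proof -
  have "ev f x = ev (f - g) x \<oplus>\<^bsub>M\<^esub> ev g x"
    using assms by (simp add: free_diff flip: ev_add)
  then show ?thesis
    using assms by (metis M.add.r_cancel_one' ev_closed free_diff)
qed

lemma ev_const_zero:
  assumes "x \<in> carrier M" "ev (const c) x = \<zero>\<^bsub>M\<^esub>" "c \<noteq> 0"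
  shows "x = \<zero>\<^bsub>M\<^esub>"
proof -
  have "x = ev (const (1 / c) * const c) x"
    using assms by (simp flip: const_mult)
  also have "\<dots> = \<zero>\<^bsub>M\<^esub>"
    using assms by (simp add: ev_mult free_const)
  finally show ?thesis .
qed

lemma ev_uminus: "f \<in> F \<Longrightarrow> x \<in> carrier M \<Longrightarrow> ev (- f) x = \<ominus>\<^bsub>M\<^esub> ev f x"
  using ev_add [of "- f" f x] M.minus_equality [of "ev (- f) x" "ev f x"] by (simp add: free_uminus)

lemma left_rel_free: "left_rel k I \<mu> f \<Longrightarrow> f \<in> F"
proof (induction rule: left_rel.induct)
  case (left_rel_ideal f)
  then show ?case by (rule rel_ideal_carrier)
next
  case (left_rel_cartan i)
  then show ?case by (intro free_intros) auto
qed (auto intro: free_add free_mult)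

text \<open>The annihilator of a vector is a left ideal containing the relations, so killing the
  generators \<open>u_i - \<mu>_i\<close> already kills all of \<open>left_rel\<close>. Conversely,
  a Cartan element is a finite combination of the \<open>u_i\<close>, and additivity reduces it to
  single indices.\<close>

lemma wspace_iff:
  "x \<in> wspace \<mu> \<longleftrightarrow> x \<in> carrier M \<and> (\<forall>f. left_rel k I \<mu> f \<longrightarrow> ev f x = \<zero>\<^bsub>M\<^esub>)"
proof
  assume "x \<in> carrier M \<and> (\<forall>f. left_rel k I \<mu> f \<longrightarrow> ev f x = \<zero>\<^bsub>M\<^esub>)"
  then have x: "x \<in> carrier M" and *: "\<And>f. left_rel k I \<mu> f \<Longrightarrow> ev f x = \<zero>\<^bsub>M\<^esub>" by auto
  show "x \<in> wspace \<mu>"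
    unfolding weight_space_def
  proof (intro CollectI conjI allI impI x)
    fix c :: "int \<Rightarrow>\<^sub>0 complex" assume c: "Poly_Mapping.keys c \<subseteq> I"
    let ?l = "Poly_Mapping.lookup c"
    let ?s = "\<lambda>A. \<Sum>i\<in>A. const (?l i) * (gen (Cre i) * gen (Ann i))"
    have "left_rel k I \<mu> (?s A - const (\<Sum>i\<in>A. ?l i * \<mu> i)) \<and> ?s A \<in> F" if "finite A" "A \<subseteq> I" for A
      using that
    proof (induction A rule: finite_induct)
      case empty
      then show ?case by (simp add: left_rel_ideal rel_ideal_zero free_zero)
    next
      case (insert i A)
      have "left_rel k I \<mu> (const (?l i) * (gen (Cre i) * gen (Ann i) - const (\<mu> i)))"
        using insert by (intro left_rel_mult left_rel_cartan free_intros) auto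
      with insert have "left_rel k I \<mu> (const (?l i) * (gen (Cre i) * gen (Ann i) - const (\<mu> i))
          + (?s A - const (\<Sum>i\<in>A. ?l i * \<mu> i)))"
        by (intro left_rel_add) auto
      moreover have "const (?l i) * (gen (Cre i) * gen (Ann i) - const (\<mu> i))
          + (?s A - const (\<Sum>i\<in>A. ?l i * \<mu> i)) = ?s (insert i A) - const (\<Sum>i\<in>insert i A. ?l i * \<mu> i)"
        using insert by (simp add: const_add const_mult right_diff_distrib)
      moreover have "?s (insert i A) \<in> F"
      proof -
        have "const (?l i) * (gen (Cre i) * gen (Ann i)) \<in> F"
          using insert by (intro free_intros) auto
        then show ?thesis using insert by (simp add: free_add)
      qed
      ultimately show ?case by simp
    qed
    from this [OF _ c] have "left_rel k I \<mu> (?s (Poly_Mapping.keys c) - const (weight_eval \<mu> c))"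
      "?s (Poly_Mapping.keys c) \<in> F"
      by (simp_all add: weight_eval_def)
    then have "ev (?s (Poly_Mapping.keys c)) x = ev (const (weight_eval \<mu> c)) x"
      using * x by (subst ev_eq_iff) (auto intro: free_const)
    then show "cartan_elt k a b c \<odot>\<^bsub>M\<^esub> x = scal (salg k a b) (weight_eval \<mu> c) \<odot>\<^bsub>M\<^esub> x"
      by (simp add: ev_def cartan_elt_def salg_simps)
  qed
next
  assume "x \<in> wspace \<mu>"
  then have x: "x \<in> carrier M" and
    c: "\<And>c. Poly_Mapping.keys c \<subseteq> I \<Longrightarrow>
      cartan_elt k a b c \<odot>\<^bsub>M\<^esub> x = scal (salg k a b) (weight_eval \<mu> c) \<odot>\<^bsub>M\<^esub> x"
    unfolding weight_space_def by auto
  have "ev f x = \<zero>\<^bsub>M\<^esub>" if "left_rel k I \<mu> f" for f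
    using that
  proof (induction rule: left_rel.induct)
    case (left_rel_ideal f)
    then show ?case using ev_cong [of f 0 x] x by simp
  next
    case (left_rel_cartan i)
    then have "ev (gen (Cre i) * gen (Ann i)) x = ev (const (\<mu> i)) x"
      \<comment> \<open>The coefficient family concentrated at \<open>i\<close> turns the Cartan
        element into \<open>u_i\<close>.\<close>
      using c [of "Poly_Mapping.single i 1"]
      by (simp add: cartan_elt_def weight_eval_def salg_simps ev_def)
    then show ?case
      using left_rel_cartan x by (subst (asm) ev_eq_iff) (auto intro!: free_intros)
  next
    case (left_rel_add f g)
    then show ?case using x by (simp add: ev_add left_rel_free)
  next
    case (left_rel_mult f g)
    then show ?case using x by (simp add: ev_mult left_rel_free)
  qed
  then show "x \<in> carrier M \<and> (\<forall>f. left_rel k I \<mu> f \<longrightarrow> ev f x = \<zero>\<^bsub>M\<^esub>)" using x by blast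
qed

lemma wspace_carrier: "x \<in> wspace \<mu> \<Longrightarrow> x \<in> carrier M"
  by (simp add: wspace_iff)

lemma wspace_ev_eq:
  "x \<in> wspace \<mu> \<Longrightarrow> left_rel k I \<mu> (f - g) \<Longrightarrow> f \<in> F \<Longrightarrow> g \<in> F \<Longrightarrow> ev f x = ev g x"
  by (simp add: ev_eq_iff wspace_iff)

lemma zero_in_wspace: "\<zero>\<^bsub>M\<^esub> \<in> wspace \<mu>"
  by (simp add: wspace_iff left_rel_free)

lemma wspace_ev_single:
  assumes "x \<in> wspace \<mu>" "w \<in> words_over I"
  shows "ev (Poly_Mapping.single w c) x \<in> wspace (shift \<mu> (word_weight w))"
  unfolding wspace_iff
proof (intro conjI allI impI)
  have x: "x \<in> carrier M" using assms(1) wspace_carrier by blast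
  then show "ev (Poly_Mapping.single w c) x \<in> carrier M"
    using assms free_single by blast
  fix f assume f: "left_rel k I (shift \<mu> (word_weight w)) f"
  have "ev f (ev (Poly_Mapping.single w c) x) = ev (f * Poly_Mapping.single w c) x"
    using x f assms by (simp add: ev_mult free_single left_rel_free)
  also have "f * Poly_Mapping.single w c = const c * (f * word_elt (letters w))"
    by (simp only: single_eq_const_word_elt [of w c] const_commute [of f] flip: mult.assoc)
  also have "left_rel k I \<mu> \<dots>"
    using f assms by (intro left_rel_mult free_const left_rel_shift_word_elt zero_not_in_index_set)
       (auto simp: words_over_def)
  then have "ev (const c * (f * word_elt (letters w))) x = \<zero>\<^bsub>M\<^esub>"
    using assms(1) by (simp add: wspace_iff)
  finally show "ev f (ev (Poly_Mapping.single w c) x) = \<zero>\<^bsub>M\<^esub>" .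
qed

text \<open>At a fermionic index the scalar \<open>\<mu>_i^2 - \<mu>_i\<close> kills the nonzero
  vector \<open>x\<close>, so it is 0. The last hypothesis fixes the coordinates outside the index
  set, on which the weight space does not depend.\<close>

lemma wspace_nonzero_weights:
  assumes "x \<in> wspace \<mu>" "x \<noteq> \<zero>\<^bsub>M\<^esub>" "\<And>i. i \<notin> I \<Longrightarrow> \<mu> i = 0"
  shows "\<mu> \<in> weights k a b"
proof -
  have "\<mu> i \<in> {0, 1}" if "i \<in> I" "fermionic k i" for i
  proof -
    have "ev (const (\<mu> i * \<mu> i - \<mu> i)) x = \<zero>\<^bsub>M\<^esub>"
      using left_rel_fermionic [OF that(2,1) zero_not_in_index_set] assms(1) by (auto simp: wspace_iff)
    then have "\<mu> i * \<mu> i - \<mu> i = 0"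
      using ev_const_zero assms wspace_carrier by blast
    then have "\<mu> i * (\<mu> i - 1) = 0" by (simp add: algebra_simps)
    then show ?thesis by auto
  qed
  then show ?thesis using assms(3) unfolding weights_def fermionic_def by blast
qed

lemma word_weight_outside: "w \<in> words_over I \<Longrightarrow> i \<notin> I \<Longrightarrow> word_weight w i = 0"
proof -
  have "gindex ` set gs \<subseteq> I \<Longrightarrow> i \<notin> I \<Longrightarrow> word_weight (Word gs) i = 0" for gs
  proof (induction gs)
    case (Cons g gs)
    then show ?case by (cases g) (auto simp: word_weight_Cons)
  qed simp
  then show "w \<in> words_over I \<Longrightarrow> i \<notin> I \<Longrightarrow> word_weight w i = 0"
    by (cases w) (simp add: words_over_def)
qed

lemma shift_word_outside:
  "\<mu> \<in> weights k a b \<Longrightarrow> w \<in> words_over I \<Longrightarrow> i \<notin> I \<Longrightarrow> shift \<mu> (word_weight w) i = 0"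
  by (simp add: shift_def word_weight_outside weights_def)

lemma ev_const_mpart: "x \<in> mpart M e \<Longrightarrow> ev (const c) x \<in> mpart M e"
proof -
  assume x: "x \<in> mpart M e"
  have "word_parity w = 0" if "w \<in> Poly_Mapping.keys (const c)" for w
    using that by (simp add: const_def word_parity_def zero_word_def split: if_splits)
  then have "cls k a b (const c) \<in> part (salg k a b) 0"
    unfolding salg_simps by (intro imageI CollectI conjI free_const ballI)
  from smult_graded [OF this x] show ?thesis unfolding ev_def add_0_left .
qed

lemma ev_mpart:
  "f \<in> F \<Longrightarrow> (\<And>w. w \<in> Poly_Mapping.keys f \<Longrightarrow> word_parity w = d) \<Longrightarrow> x \<in> mpart M e \<Longrightarrow>
    ev f x \<in> mpart M (d + e)"
  unfolding ev_def by (rule smult_graded) (auto simp: salg_simps)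

lemma mpart_subgroup: "additive_subgroup (mpart M e) M"
  using graded unfolding internal_direct_sum_def by simp

lemma mpart_carrier: "x \<in> mpart M e \<Longrightarrow> x \<in> carrier M"
  using additive_subgroup.a_Hcarr [OF mpart_subgroup] .

lemma mpart_disjoint:
  assumes "x \<in> mpart M d" "x \<in> mpart M e" "d \<noteq> e"
  shows "x = \<zero>\<^bsub>M\<^esub>"
proof -
  obtain P where "direct_sum_projections M (mpart M) UNIV P"
    by (rule internal_direct_sum_projections [OF M.abelian_group_axioms graded])
  note P = direct_sum_projectionsD [OF this]
  have "P d x = x" "P d x = \<zero>\<^bsub>M\<^esub>"
    using P(3) [of d x] P(4) [of d e x] assms by simp_all
  then show ?thesis by simp
qed

lemma mpart_zero: "\<zero>\<^bsub>M\<^esub> \<in> mpart M e"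
  using additive_subgroup.zero_closed [OF mpart_subgroup] .

lemma mpart_add: "x \<in> mpart M e \<Longrightarrow> y \<in> mpart M e \<Longrightarrow> x \<oplus>\<^bsub>M\<^esub> y \<in> mpart M e"
  using additive_subgroup.a_closed [OF mpart_subgroup] .

text \<open>The last clause is what passes weights on to homogeneous components: an even element
  preserves both parities, so if it kills \<open>x\<close>, it kills each component
  separately.\<close>

lemma mpart_decomposition:
  assumes "x \<in> carrier M"
  obtains y z where "y \<in> mpart M 0" "z \<in> mpart M 1" "x = y \<oplus>\<^bsub>M\<^esub> z"
    and "\<forall>f\<in>F. (\<forall>w\<in>Poly_Mapping.keys f. word_parity w = 0) \<longrightarrow>
      ev f x = \<zero>\<^bsub>M\<^esub> \<longrightarrow> ev f y = \<zero>\<^bsub>M\<^esub> \<and> ev f z = \<zero>\<^bsub>M\<^esub>"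
proof -
  obtain P where P: "direct_sum_projections M (mpart M) UNIV P"
    by (rule internal_direct_sum_projections [OF M.abelian_group_axioms graded])
  note P_in = direct_sum_projectionsD(1) [OF P UNIV_I]
    and P_add = direct_sum_projectionsD(2) [OF P UNIV_I]
    and P_same = direct_sum_projectionsD(3) [OF P UNIV_I]
    and P_other = direct_sum_projectionsD(4) [OF P UNIV_I UNIV_I]
    and P_sep = direct_sum_projectionsD(5) [OF P]
  have P_car: "P c x \<in> carrier M" if "x \<in> carrier M" for c x
    using P_in [OF that] mpart_carrier by blast
  define y z where "y = P 0 x" and "z = P 1 x"
  have yz: "y \<in> mpart M 0" "z \<in> mpart M 1"
    using P_in assms by (simp_all add: y_def z_def)
  then have car: "y \<in> carrier M" "z \<in> carrier M" using mpart_carrier by blast+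
  have P_neg: "P c (\<ominus>\<^bsub>M\<^esub> v) = \<ominus>\<^bsub>M\<^esub> P c v" if "v \<in> carrier M" for c v
  proof -
    have "P c (\<ominus>\<^bsub>M\<^esub> v) \<oplus>\<^bsub>M\<^esub> P c v = P c \<zero>\<^bsub>M\<^esub>"
      using that P_add [of "\<ominus>\<^bsub>M\<^esub> v" v c] by (simp add: M.l_neg)
    then show ?thesis
      using that P_car P_same [of "\<zero>\<^bsub>M\<^esub>" c] mpart_zero by (simp add: M.minus_equality)
  qed
  have "x \<oplus>\<^bsub>M\<^esub> \<ominus>\<^bsub>M\<^esub> (y \<oplus>\<^bsub>M\<^esub> z) = \<zero>\<^bsub>M\<^esub>"
  proof (rule P_sep)
    fix c :: bit
    have "P c (y \<oplus>\<^bsub>M\<^esub> z) = P c x"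
      using P_add [of y z c] car yz P_same [of y c] P_same [of z c] P_other [of c 0 y] P_other [of c 1 z]
      by (cases c) (auto simp: y_def z_def P_car assms)
    then show "P c (x \<oplus>\<^bsub>M\<^esub> \<ominus>\<^bsub>M\<^esub> (y \<oplus>\<^bsub>M\<^esub> z)) = \<zero>\<^bsub>M\<^esub>"
      using assms car P_car P_neg [of "y \<oplus>\<^bsub>M\<^esub> z" c] by (simp add: P_add M.r_neg)
  qed (use assms car in simp)
  then have x: "x = y \<oplus>\<^bsub>M\<^esub> z"
    using assms car by (metis M.a_closed M.a_inv_closed M.minus_equality M.minus_minus M.a_comm)
  have "ev f y = \<zero>\<^bsub>M\<^esub> \<and> ev f z = \<zero>\<^bsub>M\<^esub>"
    if f: "f \<in> F" "\<forall>w\<in>Poly_Mapping.keys f. word_parity w = 0" "ev f x = \<zero>\<^bsub>M\<^esub>" for f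
  proof -
    have parts: "ev f y \<in> mpart M 0" "ev f z \<in> mpart M 1"
      using ev_mpart [OF f(1) bspec [OF f(2)] yz(1)] ev_mpart [OF f(1) bspec [OF f(2)] yz(2)] by simp_all
    have sum: "ev f y \<oplus>\<^bsub>M\<^esub> ev f z = \<zero>\<^bsub>M\<^esub>"
      using f(1,3) car by (simp add: x ev_add_right)
    have "P c (ev f y \<oplus>\<^bsub>M\<^esub> ev f z) = \<zero>\<^bsub>M\<^esub>" for c
      using P_same [of "\<zero>\<^bsub>M\<^esub>" c] mpart_zero by (simp add: sum)
    then have *: "P c (ev f y) \<oplus>\<^bsub>M\<^esub> P c (ev f z) = \<zero>\<^bsub>M\<^esub>" for c
      using P_add [of "ev f y" "ev f z" c] f(1) car by simp
    have "ev f y = \<zero>\<^bsub>M\<^esub>"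
      using * [of 0] P_same [of "ev f y" 0] P_other [of 0 1 "ev f z"] parts f(1) car by simp
    moreover have "ev f z = \<zero>\<^bsub>M\<^esub>"
      using * [of 1] P_same [of "ev f z" 1] P_other [of 1 0 "ev f y"] parts f(1) car by simp
    ultimately show ?thesis ..
  qed
  then show thesis using that [OF yz x] by blast
qed

text \<open>The generators \<open>u_i - \<mu>_i\<close> are even, so both homogeneous components of
  a weight vector have its weight, and one of them is nonzero.\<close>

lemma wspace_homogeneous:
  assumes "x \<in> wspace \<mu>" "x \<noteq> \<zero>\<^bsub>M\<^esub>"
  obtains v e where "v \<in> wspace \<mu>" "v \<in> mpart M e" "v \<noteq> \<zero>\<^bsub>M\<^esub>"
proof -
  have x: "x \<in> carrier M" using assms wspace_carrier by blast
  obtain y z where yz: "y \<in> mpart M 0" "z \<in> mpart M 1" "x = y \<oplus>\<^bsub>M\<^esub> z"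
    and even: "\<forall>f\<in>F. (\<forall>w\<in>Poly_Mapping.keys f. word_parity w = 0) \<longrightarrow>
      ev f x = \<zero>\<^bsub>M\<^esub> \<longrightarrow> ev f y = \<zero>\<^bsub>M\<^esub> \<and> ev f z = \<zero>\<^bsub>M\<^esub>"
    using mpart_decomposition [OF x] .
  have car: "y \<in> carrier M" "z \<in> carrier M" using yz mpart_carrier by blast+
  \<comment> \<open>Elements of \<open>left_rel\<close> need not be even; evenness enters only at
    the generators \<open>u_i - \<mu>_i\<close>, and closure of annihilators does the rest.\<close>
  have "ev f y = \<zero>\<^bsub>M\<^esub> \<and> ev f z = \<zero>\<^bsub>M\<^esub>" if "left_rel k I \<mu> f" for f
    using that
  proof (induction rule: left_rel.induct)
    case (left_rel_ideal f)
    then show ?case using ev_cong [of f 0] car by simp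
  next
    case (left_rel_cartan i)
    let ?f = "gen (Cre i) * gen (Ann i) - const (\<mu> i)"
    have "?f \<in> F"
      using left_rel_cartan by (intro free_intros) simp_all
    moreover have "word_parity w = 0" if "w \<in> Poly_Mapping.keys ?f" for w
    proof -
      have "w \<in> Poly_Mapping.keys (gen (Cre i) * gen (Ann i)) \<union> Poly_Mapping.keys (const (\<mu> i))"
        by (rule subsetD [OF keys_diff that])
      then have "w = Word [Cre i, Ann i] \<or> w = Word []"
        by (simp add: gen_def const_def mult_single plus_word_def zero_word_def split: if_splits)
      then show ?thesis by (auto simp: word_parity_def)
    qed
    moreover have "ev ?f x = \<zero>\<^bsub>M\<^esub>"
      using assms(1) left_rel.left_rel_cartan [OF left_rel_cartan] by (simp add: wspace_iff)
    ultimately show ?case using even by simp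
  next
    case (left_rel_add f g)
    then show ?case using car by (simp add: ev_add left_rel_free)
  next
    case (left_rel_mult f g)
    then show ?case using car by (simp add: ev_mult left_rel_free)
  qed
  then have "y \<in> wspace \<mu>" "z \<in> wspace \<mu>" using car by (simp_all add: wspace_iff)
  moreover have "y \<noteq> \<zero>\<^bsub>M\<^esub> \<or> z \<noteq> \<zero>\<^bsub>M\<^esub>" using assms yz by auto
  ultimately show thesis using yz that by blast
qed

end


subsection \<open>Simple weight modules\<close>

context salg_module
begin

definition orbit :: "'m \<Rightarrow> 'm set" where
  "orbit v = (\<lambda>f. ev f v) ` F"

text \<open>Homogeneity of \<open>v\<close> makes the cyclic submodule graded: splitting
  \<open>f\<close> by word parity puts the words of parity \<open>e\<close> into degree 0 and those
  of parity \<open>e + 1\<close> into degree 1.\<close>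

lemma orbit_graded_submodule:
  assumes v: "v \<in> mpart M e"
  shows "graded_submodule (salg k a b) M (orbit v)"
  unfolding graded_submodule_def
proof (intro conjI ballI)
  have v': "v \<in> carrier M" using v mpart_carrier by blast
  show "additive_subgroup (orbit v) M"
  proof (rule additive_subgroupI, rule M.add.subgroupI)
    show "orbit v \<subseteq> carrier M" using v' by (auto simp: orbit_def)
    show "orbit v \<noteq> {}" using free_zero by (auto simp: orbit_def)
    fix x assume "x \<in> orbit v"
    then obtain f where f: "f \<in> F" "x = ev f v" by (auto simp: orbit_def)
    show "\<ominus>\<^bsub>M\<^esub> x \<in> orbit v"
      unfolding orbit_def using f v' by (intro image_eqI [of _ _ "- f"]) (simp_all add: ev_uminus free_uminus)
    fix y assume "y \<in> orbit v"
    then obtain g where g: "g \<in> F" "y = ev g v" by (auto simp: orbit_def)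
    have "x \<oplus>\<^bsub>M\<^esub> y = ev (f + g) v" using f g v' by (simp add: ev_add)
    then show "x \<oplus>\<^bsub>M\<^esub> y \<in> orbit v"
      using f g free_add by (auto simp: orbit_def)
  qed
  fix x assume "x \<in> orbit v"
  then obtain f where f: "f \<in> F" "x = ev f v" by (auto simp: orbit_def)
  show "r \<odot>\<^bsub>M\<^esub> x \<in> orbit v" if r: "r \<in> carrier (salg k a b)" for r
  proof -
    obtain g where g: "g \<in> F" "r = cls k a b g" using cls_surj [OF r] .
    have "r \<odot>\<^bsub>M\<^esub> x = ev (g * f) v"
      using f g v' by (simp add: ev_mult) (simp add: ev_def)
    then show ?thesis using f g free_mult by (auto simp: orbit_def)
  qed
  let ?f = "\<lambda>d. word_restrict (\<lambda>w. word_parity w = d) f"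
  have part: "ev (?f d) v \<in> mpart M (d + e)" for d
    by (rule ev_mpart [OF free_word_restrict [OF f(1)] _ v]) (simp add: keys_word_restrict)
  have "(\<lambda>w. word_parity w = e + 1) = (\<lambda>w. \<not> word_parity w = e)"
  proof
    fix w
    show "(word_parity w = e + 1) = (\<not> word_parity w = e)"
      by (cases "word_parity w"; cases e; simp)
  qed
  then have "f = ?f e + ?f (e + 1)"
    using word_restrict_split [of f "\<lambda>w. word_parity w = e"] by simp
  then have "x = ev (?f e) v \<oplus>\<^bsub>M\<^esub> ev (?f (e + 1)) v"
    using f v' by (metis ev_add free_word_restrict)
  moreover have "ev (?f e) v \<in> orbit v \<inter> mpart M 0" "ev (?f (e + 1)) v \<in> orbit v \<inter> mpart M 1"
    using part [of e] part [of "e + 1"] f free_word_restrict by (cases e; auto simp: orbit_def)+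
  ultimately show "\<exists>y\<in>orbit v \<inter> mpart M 0. \<exists>z\<in>orbit v \<inter> mpart M 1. x = y \<oplus>\<^bsub>M\<^esub> z"
    by blast
qed

lemma self_in_orbit: "v \<in> carrier M \<Longrightarrow> v \<in> orbit v"
  unfolding orbit_def by (rule image_eqI [of _ _ 1]) (simp_all add: free_one)

lemma simple_generated:
  assumes "simple_supermodule (salg k a b) M" "v \<in> mpart M e" "v \<noteq> \<zero>\<^bsub>M\<^esub>" "y \<in> carrier M"
  obtains f where "f \<in> F" "y = ev f v"
proof -
  have "orbit v = {\<zero>\<^bsub>M\<^esub>} \<or> orbit v = carrier M"
    using assms(1) orbit_graded_submodule [OF assms(2)] unfolding simple_supermodule_def by blast
  then have "orbit v = carrier M"
    using self_in_orbit mpart_carrier assms(2,3) by blast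
  then show thesis using assms(4) that by (auto simp: orbit_def)
qed

end

section \<open>Weight projections and the words that contribute to them\<close>

locale weight_salg_module = salg_module k a b M
  for k a b and M :: "(free_elt set, 'm) supermodule" +
  assumes weight_module: "weight_module k a b M"
begin

definition proj :: "weight \<Rightarrow> 'm \<Rightarrow> 'm" where
  "proj = (SOME P. direct_sum_projections M wspace (weights k a b) P)"

lemma proj: "direct_sum_projections M wspace (weights k a b) proj"
proof -
  have "\<exists>P. direct_sum_projections M wspace (weights k a b) P"
    using weight_module internal_direct_sum_projections [OF M.abelian_group_axioms]
    unfolding weight_module_def by blast
  then show ?thesis unfolding proj_def by (rule someI_ex)
qed

lemmas proj_in = direct_sum_projectionsD(1) [OF proj]
  and proj_add = direct_sum_projectionsD(2) [OF proj]
  and proj_same = direct_sum_projectionsD(3) [OF proj]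
  and proj_other = direct_sum_projectionsD(4) [OF proj]
  and proj_separates = direct_sum_projectionsD(5) [OF proj]

lemma proj_zero: "\<mu> \<in> weights k a b \<Longrightarrow> proj \<mu> \<zero>\<^bsub>M\<^esub> = \<zero>\<^bsub>M\<^esub>"
  by (simp add: proj_same zero_in_wspace)

text \<open>Projecting to a weight amounts to discarding words of the wrong weight. Thus an
  \<open>f\<close> that carries one weight vector to another may be replaced by its part of the
  right weight.\<close>

lemma proj_ev:
  assumes "\<kappa> \<in> weights k a b" "\<mu> \<in> weights k a b" "x \<in> wspace \<mu>" "f \<in> F"
  shows "proj \<kappa> (ev f x) = ev (word_restrict (\<lambda>w. shift \<mu> (word_weight w) = \<kappa>) f) x"
proof -
  let ?R = "word_restrict (\<lambda>w. shift \<mu> (word_weight w) = \<kappa>)"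
  have x: "x \<in> carrier M" using assms wspace_carrier by blast
  have "Poly_Mapping.keys f \<subseteq> words_over I" using assms by (simp add: free_carrier)
  then show ?thesis
  proof (induction rule: free_elt_induct)
    case zero
    then show ?case using x assms by (simp add: proj_zero)
  next
    case (add w c f)
    let ?s = "Poly_Mapping.single w c"
    have car: "?s \<in> F" "f \<in> F" "?R f \<in> F"
      using add by (simp_all add: free_single free_carrier keys_word_restrict subset_iff)
    have w: "ev ?s x \<in> wspace (shift \<mu> (word_weight w))"
      using assms add by (intro wspace_ev_single)
    \<comment> \<open>The projections are controlled on admissible weights only; a nonzero image has
      an admissible weight by \<open>wspace_nonzero_weights\<close>.\<close>
    have "proj \<kappa> (ev ?s x) = (if shift \<mu> (word_weight w) = \<kappa> then ev ?s x else \<zero>\<^bsub>M\<^esub>)"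
    proof (cases "ev ?s x = \<zero>\<^bsub>M\<^esub>")
      case False
      then have "shift \<mu> (word_weight w) \<in> weights k a b"
        using w add shift_word_outside assms by (intro wspace_nonzero_weights) auto
      then show ?thesis using assms w proj_same proj_other by auto
    qed (simp add: proj_zero assms)
    then show ?case
      using x car assms add
      by (auto simp: ev_add proj_add word_restrict_single_add)
  qed
qed

end

section \<open>Weight spaces of a simple module\<close>

locale simple_weight_salg_module = weight_salg_module k a b M
  for k a b and M :: "(free_elt set, 'm) supermodule" +
  assumes simple: "simple_supermodule (salg k a b) M"
begin

lemma generated:
  assumes "v \<in> mpart M e" "v \<noteq> \<zero>\<^bsub>M\<^esub>" "y \<in> carrier M"
  obtains f where "f \<in> F" "y = ev f v"
  using simple_generated [OF simple assms] .

lemma wspace_spanned: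
  assumes "\<mu> \<in> weights k a b" "v \<in> wspace \<mu>" "v \<in> mpart M e" "v \<noteq> \<zero>\<^bsub>M\<^esub>" "y \<in> wspace \<mu>"
  obtains c where "y = ev (const c) v"
proof -
  obtain f where f: "f \<in> F" "y = ev f v"
    using generated assms wspace_carrier by metis
  let ?g = "word_restrict (\<lambda>w. shift \<mu> (word_weight w) = \<mu>) f"
  have "y = ev ?g v"
    using proj_ev [of \<mu> \<mu> v f] assms f by (simp add: proj_same)
  moreover have "Poly_Mapping.keys ?g \<subseteq> {w \<in> words_over I. word_weight w = (\<lambda>j. 0)}"
    using f by (auto simp: keys_word_restrict free_carrier shift_def fun_eq_iff)
  then obtain c where "left_rel k I \<mu> (?g - const c)"
    using left_rel_weight_zero_combination zero_not_in_index_set by blast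
  then have "ev ?g v = ev (const c) v"
    using assms f by (intro wspace_ev_eq) (auto intro: free_word_restrict free_const)
  ultimately show thesis using that by simp
qed

text \<open>Simplicity speaks about graded submodules, so spanning is known first for homogeneous
  vectors; \<open>v\<close> and \<open>y\<close> are compared through such a vector
  \<open>u\<close>.\<close>

lemma wspace_spanned_any:
  assumes "\<mu> \<in> weights k a b" "v \<in> wspace \<mu>" "v \<noteq> \<zero>\<^bsub>M\<^esub>" "y \<in> wspace \<mu>"
  obtains c where "y = ev (const c) v"
proof -
  obtain u e where u: "u \<in> wspace \<mu>" "u \<in> mpart M e" "u \<noteq> \<zero>\<^bsub>M\<^esub>"
    using wspace_homogeneous assms by blast
  obtain c where c: "v = ev (const c) u" using wspace_spanned assms u by blast
  obtain d where d: "y = ev (const d) u" using wspace_spanned assms u by blast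
  have u': "u \<in> carrier M" using u wspace_carrier by blast
  have "c \<noteq> 0" using c assms u' by auto
  then have "y = ev (const (d / c) * const c) u"
    using d by (simp flip: const_mult)
  then have "y = ev (const (d / c)) v"
    using c u' by (simp add: ev_mult free_const)
  then show thesis using that by blast
qed

lemma multiplicity_free: "multiplicity_free k a b M"
  unfolding multiplicity_free_def
proof
  fix \<mu> assume "\<mu> \<in> supp k a b M"
  then obtain v where v: "\<mu> \<in> weights k a b" "v \<in> wspace \<mu>" "v \<noteq> \<zero>\<^bsub>M\<^esub>"
    using zero_in_wspace [of \<mu>] unfolding supp_def by blast
  have "scal (salg k a b) c \<odot>\<^bsub>M\<^esub> v = ev (const c) v" for c
    by (simp add: salg_simps ev_def)
  moreover have "ev (const c) v \<in> wspace \<mu>" for c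
    using wspace_ev_single [OF v(2), of 0 c] by (simp add: words_over_def zero_word_def const_def)
  ultimately have "wspace \<mu> = {scal (salg k a b) c \<odot>\<^bsub>M\<^esub> v |c. True}"
    using wspace_spanned_any [OF v] by auto metis
  then show "one_dimensional (salg k a b) M (wspace \<mu>)"
    unfolding one_dimensional_def using v by blast
qed

text \<open>A weight space is a line spanned by a homogeneous vector, so it lies in a single
  parity.\<close>

lemma weight_vector_homogeneous:
  assumes "\<mu> \<in> weights k a b" "x \<in> wspace \<mu>"
  obtains e where "x \<in> mpart M e"
proof (cases "x = \<zero>\<^bsub>M\<^esub>")
  case True
  then show thesis using that mpart_zero by blast
next
  case False
  obtain u e where u: "u \<in> wspace \<mu>" "u \<in> mpart M e" "u \<noteq> \<zero>\<^bsub>M\<^esub>"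
    using wspace_homogeneous assms False by blast
  obtain c where "x = ev (const c) u" using wspace_spanned assms u by blast
  then show thesis using that ev_const_mpart u by blast
qed

end

section \<open>Comparing two simple weight modules that share a weight\<close>

lemma simple_weight_salg_moduleI:
  "simple_weight_module k a b M \<Longrightarrow> simple_weight_salg_module k a b M"
  unfolding simple_weight_module_def weight_module_def simple_weight_salg_module_def
    weight_salg_module_def salg_module_def weight_salg_module_axioms_def
    simple_weight_salg_module_axioms_def by blast

text \<open>Weight-zero elements act on the \<open>\<mu>\<close>-weight spaces of both modules by the same scalar.\<close>

lemma annihilator_mono:
  fixes M :: "(free_elt set, 'm) supermodule" and N :: "(free_elt set, 'n) supermodule"
  assumes "simple_weight_salg_module k a b M" "simple_weight_salg_module k a b N"
    and \<mu>: "\<mu> \<in> weights k a b"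
    and v: "v \<in> weight_space k a b M \<mu>" "v \<noteq> \<zero>\<^bsub>M\<^esub>"
    and u: "u \<in> weight_space k a b N \<mu>" "u \<noteq> \<zero>\<^bsub>N\<^esub>"
    and f: "f \<in> carrier (free_algebra (index_set a b))" and zero: "salg_module.ev k a b M f v = \<zero>\<^bsub>M\<^esub>"
  shows "salg_module.ev k a b N f u = \<zero>\<^bsub>N\<^esub>"
proof -
  interpret M: simple_weight_salg_module k a b M by fact
  interpret N: simple_weight_salg_module k a b N by fact
  have v': "v \<in> carrier M" and u': "u \<in> carrier N"
    using v u M.wspace_carrier N.wspace_carrier by blast+
  \<comment> \<open>If \<open>f u\<close> had a nonzero component of weight \<kappa>, some
    \<open>h'\<close> would carry it back to \<open>u\<close>, and \<open>h' * g\<close> would fix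
    \<open>u\<close>. Its scalar on weight \<mu> would be 1, hence 1 in the other module as well,
    although \<open>g\<close> kills \<open>v\<close>.\<close>
  have "N.proj \<kappa> (N.ev f u) = \<zero>\<^bsub>N\<^esub>" if \<kappa>: "\<kappa> \<in> weights k a b" for \<kappa>
  proof (rule ccontr)
    assume nonzero: "N.proj \<kappa> (N.ev f u) \<noteq> \<zero>\<^bsub>N\<^esub>"
    define g where "g = word_restrict (\<lambda>w. shift \<mu> (word_weight w) = \<kappa>) f"
    have g: "g \<in> carrier (free_algebra (index_set a b))"
      using f by (simp add: g_def free_word_restrict)
    have gv: "M.ev g v = \<zero>\<^bsub>M\<^esub>"
      using M.proj_ev [OF \<kappa> \<mu> v(1) f] zero M.proj_zero [OF \<kappa>] by (simp add: g_def)
    have gu: "N.ev g u = N.proj \<kappa> (N.ev f u)"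
      using N.proj_ev [OF \<kappa> \<mu> u(1) f] by (simp add: g_def)
    then have gu_in: "N.ev g u \<in> weight_space k a b N \<kappa>"
      using N.proj_in [OF \<kappa>] f u' by simp
    then obtain e where "N.ev g u \<in> mpart N e"
      using N.weight_vector_homogeneous \<kappa> by blast
    then obtain h where h: "h \<in> carrier (free_algebra (index_set a b))" "u = N.ev h (N.ev g u)"
      using N.generated nonzero gu u' by metis
    \<comment> \<open>Only words leading from \<kappa> back to \<mu> are kept, so that
      \<open>h' * g\<close> has weight zero.\<close>
    define h' where "h' = word_restrict (\<lambda>w. shift \<kappa> (word_weight w) = \<mu>) h"
    have h': "h' \<in> carrier (free_algebra (index_set a b))"
      using h by (simp add: h'_def free_word_restrict)
    have "u = N.ev h' (N.ev g u)"
      using N.proj_ev [OF \<mu> \<kappa> gu_in h(1)] h(2) N.proj_same [OF \<mu> u(1)] by (simp add: h'_def)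
    then have u_eq: "u = N.ev (h' * g) u"
      using h' g u' by (simp add: N.ev_mult)
    have "Poly_Mapping.keys (h' * g) \<subseteq> {w \<in> words_over (index_set a b). word_weight w = (\<lambda>j. 0)}"
    proof
      fix w assume w: "w \<in> Poly_Mapping.keys (h' * g)"
      then obtain w1 w2 where w12: "w1 \<in> Poly_Mapping.keys h'" "w2 \<in> Poly_Mapping.keys g" "w = w1 + w2"
        using keys_mult [of h' g] by blast
      then have "shift \<mu> (word_weight w2) = \<kappa>" "shift \<kappa> (word_weight w1) = \<mu>"
        by (simp_all add: g_def h'_def keys_word_restrict)
      then have "shift (shift \<mu> (word_weight w2)) (word_weight w1) j = \<mu> j" for j by simp
      then have "of_int (word_weight w2 j + word_weight w1 j) = (0 :: complex)" for j
        by (simp add: shift_def)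
      then have "word_weight w2 j + word_weight w1 j = 0" for j
        by (simp only: of_int_eq_0_iff)
      moreover have "word_weight w j = word_weight w1 j + word_weight w2 j" for j
        using w12 by (simp add: word_weight_def plus_word_def)
      moreover have "w \<in> words_over (index_set a b)"
        using w free_mult [OF h' g] by (auto simp: free_carrier)
      ultimately show "w \<in> {w \<in> words_over (index_set a b). word_weight w = (\<lambda>j. 0)}"
        by (simp add: fun_eq_iff add.commute)
    qed
    then obtain c where c: "left_rel k (index_set a b) \<mu> (h' * g - const c)"
      using left_rel_weight_zero_combination zero_not_in_index_set by blast
    have hg: "h' * g \<in> carrier (free_algebra (index_set a b))" using h' g by (rule free_mult)
    have "N.ev (const c) u = N.ev 1 u"
      using N.wspace_ev_eq [OF u(1) c hg free_const] u_eq u' by simp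
    then have "N.ev (const (c - 1)) u = \<zero>\<^bsub>N\<^esub>"
      using N.ev_eq_iff [OF free_const free_one u', of c] by (simp add: const_diff)
    then have "c = 1" using N.ev_const_zero [OF u'] u(2) by fastforce
    then have "v = M.ev (h' * g) v"
      using M.wspace_ev_eq [OF v(1) c hg free_const] v' by simp
    also have "\<dots> = \<zero>\<^bsub>M\<^esub>" using gv h' g v' by (simp add: M.ev_mult)
    finally show False using v by simp
  qed
  then show ?thesis using N.proj_separates f u' by (metis N.ev_closed)
qed

text \<open>Each module is the free algebra modulo the annihilator of its generator, so equal
  annihilators identify them. The common parity \<open>e\<close> of the generators makes the
  identification even.\<close>

lemma supermodule_isoI_annihilators:
  fixes M :: "(free_elt set, 'm) supermodule" and N :: "(free_elt set, 'n) supermodule"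
  assumes "simple_weight_salg_module k a b M" "simple_weight_salg_module k a b N"
    and v: "v \<in> mpart M e" "v \<noteq> \<zero>\<^bsub>M\<^esub>" and u: "u \<in> mpart N e" "u \<noteq> \<zero>\<^bsub>N\<^esub>"
    and ann: "\<And>f. f \<in> carrier (free_algebra (index_set a b)) \<Longrightarrow>
      salg_module.ev k a b M f v = \<zero>\<^bsub>M\<^esub> \<longleftrightarrow> salg_module.ev k a b N f u = \<zero>\<^bsub>N\<^esub>"
  shows "supermodule_iso (salg k a b) M N"
proof -
  interpret M: simple_weight_salg_module k a b M by fact
  interpret N: simple_weight_salg_module k a b N by fact
  let ?F = "carrier (free_algebra (index_set a b))"
  have v': "v \<in> carrier M" and u': "u \<in> carrier N"
    using v u M.mpart_carrier N.mpart_carrier by blast+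
  have ev_eq: "M.ev f v = M.ev g v \<longleftrightarrow> N.ev f u = N.ev g u" if "f \<in> ?F" "g \<in> ?F" for f g
    using ann [OF free_diff [OF that]] M.ev_eq_iff [OF that v'] N.ev_eq_iff [OF that u'] by simp
  \<comment> \<open>Any preimage of \<open>y\<close> may be chosen: by \<open>ev_eq\<close> two
    choices have the same value on \<open>u\<close>.\<close>
  define \<phi> where "\<phi> y = N.ev (SOME f. f \<in> ?F \<and> y = M.ev f v) u" for y
  have \<phi>: "\<phi> (M.ev f v) = N.ev f u" if "f \<in> ?F" for f
  proof -
    define g where "g = (SOME g. g \<in> ?F \<and> M.ev f v = M.ev g v)"
    have "g \<in> ?F \<and> M.ev f v = M.ev g v"
      unfolding g_def using that someI [of "\<lambda>g. g \<in> ?F \<and> M.ev f v = M.ev g v" f] by simp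
    then have "N.ev f u = N.ev g u" using ev_eq [OF that, of g] by simp
    then show ?thesis by (simp add: \<phi>_def g_def)
  qed
  have hom: "\<phi> \<in> supermodule_hom (salg k a b) M N"
    unfolding supermodule_hom_def
  proof (intro CollectI conjI ballI allI)
    show "\<phi> \<in> carrier M \<rightarrow> carrier N"
    proof
      fix y assume "y \<in> carrier M"
      then obtain f where "f \<in> ?F" "y = M.ev f v" using M.generated v by blast
      then show "\<phi> y \<in> carrier N" using \<phi> u' by simp
    qed
    fix x assume "x \<in> carrier M"
    then obtain f where f: "f \<in> ?F" "x = M.ev f v" using M.generated v by blast
    show "\<phi> (x \<oplus>\<^bsub>M\<^esub> y) = \<phi> x \<oplus>\<^bsub>N\<^esub> \<phi> y" if "y \<in> carrier M" for y
    proof -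
      obtain g where g: "g \<in> ?F" "y = M.ev g v" using M.generated v \<open>y \<in> carrier M\<close> by blast
      have "x \<oplus>\<^bsub>M\<^esub> y = M.ev (f + g) v" using f g v' by (simp add: M.ev_add)
      then show ?thesis using f g u' by (simp add: \<phi> free_add N.ev_add)
    qed
    show "\<phi> (r \<odot>\<^bsub>M\<^esub> x) = r \<odot>\<^bsub>N\<^esub> \<phi> x" if r: "r \<in> carrier (salg k a b)" for r
    proof -
      obtain g where g: "g \<in> ?F" "r = cls k a b g" using cls_surj [OF r] .
      have "r \<odot>\<^bsub>M\<^esub> x = M.ev (g * f) v"
        using f g v' by (simp add: M.ev_mult) (simp add: M.ev_def)
      then have "\<phi> (r \<odot>\<^bsub>M\<^esub> x) = N.ev g (\<phi> x)"
        using f g u' by (simp add: \<phi> free_mult N.ev_mult)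
      then show ?thesis using g by (simp add: N.ev_def)
    qed
  next
    fix d
    show "\<phi> ` mpart M d \<subseteq> mpart N d"
    proof
      fix z assume "z \<in> \<phi> ` mpart M d"
      then obtain y where y: "y \<in> mpart M d" "z = \<phi> y" by blast
      obtain f where f: "f \<in> ?F" "y = M.ev f v" using M.generated v M.mpart_carrier [OF y(1)] by blast
      \<comment> \<open>For \<open>y\<close> of degree \<open>d\<close> only words of parity
        \<open>d + e\<close> matter: the remaining part sends \<open>v\<close> into the other
        degree, yet it is a difference of two vectors of degree \<open>d\<close>, so it is
        zero.\<close>
      let ?f = "word_restrict (\<lambda>w. word_parity w = d + e) f"
      let ?g = "word_restrict (\<lambda>w. \<not> word_parity w = d + e) f"
      have F: "?f \<in> ?F" "?g \<in> ?F" using f free_word_restrict by blast+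
      have double: "d + e + e = d" by (cases d; cases e; simp)
      have ne: "word_parity w = d + e + 1" if "w \<in> Poly_Mapping.keys ?g" for w
        using that by (cases "word_parity w"; cases d; cases e) (auto simp: keys_word_restrict)
      have part: "M.ev ?f v \<in> mpart M d"
        using M.ev_mpart [OF F(1) _ v(1), of "d + e"] by (simp only: double keys_word_restrict) auto
      have part': "M.ev ?g v \<in> mpart M (d + e + 1 + e)"
        by (rule M.ev_mpart [OF F(2) ne v(1)])
      have flip: "d + e + 1 + e \<noteq> d" by (cases d; cases e; simp)
      have "y = M.ev (?f + ?g) v"
        using f word_restrict_split by metis
      then have sum: "y = M.ev ?f v \<oplus>\<^bsub>M\<^esub> M.ev ?g v"
        using F v' by (simp add: M.ev_add)
      have "M.ev ?g v = y \<oplus>\<^bsub>M\<^esub> \<ominus>\<^bsub>M\<^esub> M.ev ?f v"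
      proof -
        have "q = p \<oplus>\<^bsub>M\<^esub> q \<oplus>\<^bsub>M\<^esub> \<ominus>\<^bsub>M\<^esub> p" if "p \<in> carrier M" "q \<in> carrier M" for p q
          using that by (metis M.M.a_assoc M.M.a_comm M.M.a_inv_closed M.M.r_neg M.M.r_zero)
        from this [OF M.ev_closed M.ev_closed, OF F(1) v' F(2) v'] show ?thesis
          by (simp only: sum [symmetric])
      qed
      also have "\<dots> = y \<oplus>\<^bsub>M\<^esub> M.ev (const (- 1)) (M.ev ?f v)"
        using F v' M.ev_uminus [of 1 "M.ev ?f v"] by (simp add: const_uminus free_one)
      also have "\<dots> \<in> mpart M d"
        using y part M.ev_const_mpart M.mpart_add by blast
      finally have "M.ev ?g v = \<zero>\<^bsub>M\<^esub>"
        using part' flip M.mpart_disjoint by blast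
      then have "y = M.ev ?f v" using sum F v' by simp
      then have "z = N.ev ?f u" using y F \<phi> by simp
      moreover have "N.ev ?f u \<in> mpart N (d + e + e)"
        by (rule N.ev_mpart [OF F(1) _ u(1)]) (simp add: keys_word_restrict)
      ultimately show "z \<in> mpart N d" by (simp only: double)
    qed
  qed
  have "bij_betw \<phi> (carrier M) (carrier N)"
    unfolding bij_betw_def
  proof
    show "inj_on \<phi> (carrier M)"
    proof (rule inj_onI)
      fix x y assume "x \<in> carrier M" "y \<in> carrier M" "\<phi> x = \<phi> y"
      then obtain f g where "f \<in> ?F" "x = M.ev f v" "g \<in> ?F" "y = M.ev g v"
        using M.generated v by metis
      then show "x = y" using \<open>\<phi> x = \<phi> y\<close> ev_eq by (simp add: \<phi>)
    qed
    show "\<phi> ` carrier M = carrier N"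
    proof
      show "\<phi> ` carrier M \<subseteq> carrier N" using hom unfolding supermodule_hom_def by auto
      show "carrier N \<subseteq> \<phi> ` carrier M"
      proof
        fix z assume "z \<in> carrier N"
        then obtain f where "f \<in> ?F" "z = N.ev f u" using N.generated u by blast
        then have "z = \<phi> (M.ev f v)" "M.ev f v \<in> carrier M" using \<phi> v' by simp_all
        then show "z \<in> \<phi> ` carrier M" by blast
      qed
    qed
  qed
  then show ?thesis unfolding supermodule_iso_def using hom by blast
qed

theorem simple_weight_module_iso:
  fixes M :: "(free_elt set, 'm) supermodule" and N :: "(free_elt set, 'n) supermodule"
  assumes "simple_weight_module k a b M" "simple_weight_module k a b N"
    and \<mu>: "\<mu> \<in> weights k a b"
    and v: "v \<in> weight_space k a b M \<mu>" "v \<in> mpart M e" "v \<noteq> \<zero>\<^bsub>M\<^esub>"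
    and u: "u \<in> weight_space k a b N \<mu>" "u \<in> mpart N e" "u \<noteq> \<zero>\<^bsub>N\<^esub>"
  shows "supermodule_iso (salg k a b) M N"
proof (rule supermodule_isoI_annihilators [OF _ _ v(2,3) u(2,3)])
  note MN = assms(1,2) [THEN simple_weight_salg_moduleI]
  show "simple_weight_salg_module k a b M" "simple_weight_salg_module k a b N" by fact+
  show "salg_module.ev k a b M f v = \<zero>\<^bsub>M\<^esub> \<longleftrightarrow> salg_module.ev k a b N f u = \<zero>\<^bsub>N\<^esub>"
    if "f \<in> carrier (free_algebra (index_set a b))" for f
    using annihilator_mono [OF MN \<mu> v(1,3) u(1,3) that]
      annihilator_mono [OF MN(2,1) \<mu> u(1,3) v(1,3) that] by blast
qed

section \<open>Homomorphisms, weights and supports\<close>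

lemma supermodule_hom_weight_space:
  fixes M :: "(free_elt set, 'm) supermodule" and N :: "(free_elt set, 'n) supermodule"
  assumes "\<phi> \<in> supermodule_hom (salg k a b) M N" "x \<in> weight_space k a b M \<mu>"
  shows "\<phi> x \<in> weight_space k a b N \<mu>"
proof -
  have x: "x \<in> carrier M" using assms(2) unfolding weight_space_def by blast
  have lin: "\<phi> (r \<odot>\<^bsub>M\<^esub> x) = r \<odot>\<^bsub>N\<^esub> \<phi> x" if "r \<in> carrier (salg k a b)" for r
    using assms(1) x that unfolding supermodule_hom_def by blast
  have cartan: "cartan_elt k a b c \<in> carrier (salg k a b)" if "Poly_Mapping.keys c \<subseteq> index_set a b" for c
  proof -
    have "(\<Sum>i\<in>A. const (Poly_Mapping.lookup c i) * (gen (Cre i) * gen (Ann i)))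
        \<in> carrier (free_algebra (index_set a b))" if "finite A" "A \<subseteq> index_set a b" for A
      using that
    proof (induction A rule: finite_induct)
      case empty
      then show ?case by (simp add: free_zero)
    next
      case (insert i A)
      moreover from this have "const (Poly_Mapping.lookup c i) * (gen (Cre i) * gen (Ann i))
          \<in> carrier (free_algebra (index_set a b))"
        by (intro free_intros) auto
      ultimately show ?case by (simp add: free_add)
    qed
    then show ?thesis using that by (simp add: cartan_elt_def cls_closed)
  qed
  have scal: "scal (salg k a b) c \<in> carrier (salg k a b)" for c
    by (simp add: salg_simps(6) cls_closed free_const)
  have "\<phi> x \<in> carrier N" using assms(1) x unfolding supermodule_hom_def by blast
  then show ?thesis
    using assms(2) lin [OF cartan] lin [OF scal] unfolding weight_space_def by simp
qed

lemma supermodule_hom_zero: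
  fixes M :: "(free_elt set, 'm) supermodule" and N :: "(free_elt set, 'n) supermodule"
  assumes "left_supermodule (salg k a b) M" "left_supermodule (salg k a b) N"
    "\<phi> \<in> supermodule_hom (salg k a b) M N"
  shows "\<phi> \<zero>\<^bsub>M\<^esub> = \<zero>\<^bsub>N\<^esub>"
proof -
  interpret M: salg_module k a b M using assms(1) by (simp add: salg_module_def)
  interpret N: salg_module k a b N using assms(2) by (simp add: salg_module_def)
  have car: "\<phi> \<zero>\<^bsub>M\<^esub> \<in> carrier N"
    using assms(3) unfolding supermodule_hom_def by blast
  have "\<phi> (\<zero>\<^bsub>M\<^esub> \<oplus>\<^bsub>M\<^esub> \<zero>\<^bsub>M\<^esub>) = \<phi> \<zero>\<^bsub>M\<^esub> \<oplus>\<^bsub>N\<^esub> \<phi> \<zero>\<^bsub>M\<^esub>"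
    using assms(3) M.M.zero_closed unfolding supermodule_hom_def by blast
  then show ?thesis using car by simp
qed

lemma supp_witness:
  assumes "left_supermodule (salg k a b) M"
  shows "\<mu> \<in> supp k a b M \<longleftrightarrow>
    \<mu> \<in> weights k a b \<and> (\<exists>v\<in>weight_space k a b M \<mu>. v \<noteq> \<zero>\<^bsub>M\<^esub>)"
proof -
  interpret M: salg_module k a b M using assms by (simp add: salg_module_def)
  show ?thesis using M.zero_in_wspace [of \<mu>] unfolding supp_def by blast
qed

lemma supermodule_iso_supp:
  fixes M :: "(free_elt set, 'm) supermodule" and N :: "(free_elt set, 'n) supermodule"
  assumes "left_supermodule (salg k a b) M" "left_supermodule (salg k a b) N"
    "supermodule_iso (salg k a b) M N" "\<mu> \<in> supp k a b M"
  shows "\<mu> \<in> supp k a b N"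
proof -
  obtain \<phi> where \<phi>: "\<phi> \<in> supermodule_hom (salg k a b) M N" "bij_betw \<phi> (carrier M) (carrier N)"
    using assms(3) unfolding supermodule_iso_def by blast
  obtain v where v: "\<mu> \<in> weights k a b" "v \<in> weight_space k a b M \<mu>" "v \<noteq> \<zero>\<^bsub>M\<^esub>"
    using assms(4) supp_witness [OF assms(1)] by blast
  interpret M: salg_module k a b M using assms(1) by (simp add: salg_module_def)
  have "\<phi> v \<noteq> \<phi> \<zero>\<^bsub>M\<^esub>"
    using \<phi>(2) v(2,3) M.wspace_carrier M.M.zero_closed unfolding bij_betw_def inj_on_def by blast
  then show ?thesis
    using v(1) supermodule_hom_weight_space [OF \<phi>(1) v(2)] supermodule_hom_zero [OF assms(1,2) \<phi>(1)]
      supp_witness [OF assms(2)] by auto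
qed


subsection \<open>Equivalence classes of weights\<close>

definition weight_class :: "kind \<Rightarrow> enat \<Rightarrow> enat \<Rightarrow> weight \<Rightarrow> weight set" where
  "weight_class k a b \<nu> = {\<kappa> \<in> weights k a b. weight_equiv a b \<kappa> \<nu>}"

lemma root_lattice_add:
  assumes "\<alpha> \<in> root_lattice a b" "\<beta> \<in> root_lattice a b"
  shows "(\<lambda>i. \<alpha> i + \<beta> i) \<in> root_lattice a b"
proof -
  have sub: "{i. \<alpha> i + \<beta> i \<noteq> 0} \<subseteq> {i. \<alpha> i \<noteq> 0} \<union> {i. \<beta> i \<noteq> 0}" by auto
  have "finite ({i. \<alpha> i \<noteq> 0} \<union> {i. \<beta> i \<noteq> 0})"
    "{i. \<alpha> i \<noteq> 0} \<union> {i. \<beta> i \<noteq> 0} \<subseteq> index_set a b"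
    using assms by (simp_all add: root_lattice_def)
  from finite_subset [OF sub this(1)] subset_trans [OF sub this(2)] show ?thesis
    by (simp add: root_lattice_def)
qed

lemma root_lattice_uminus: "\<alpha> \<in> root_lattice a b \<Longrightarrow> (\<lambda>i. - \<alpha> i) \<in> root_lattice a b"
  by (simp add: root_lattice_def)

lemma root_lattice_zero: "(\<lambda>i. 0) \<in> root_lattice a b"
  by (simp add: root_lattice_def)

lemma root_lattice_letter:
  assumes "gindex g \<in> index_set a b"
  shows "letter_weight g \<in> root_lattice a b"
proof -
  have "{i. letter_weight g i \<noteq> 0} = {gindex g}" by (cases g) auto
  then show ?thesis using assms by (simp add: root_lattice_def)
qed

lemma diff_in_lattice_refl: "diff_in_lattice a b \<mu> \<mu>"
  unfolding diff_in_lattice_def by (rule bexI [OF _ root_lattice_zero]) simp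

lemma diff_in_lattice_sym:
  assumes "diff_in_lattice a b \<mu> \<nu>"
  shows "diff_in_lattice a b \<nu> \<mu>"
proof -
  obtain \<alpha> where \<alpha>: "\<alpha> \<in> root_lattice a b" "\<mu> = shift \<nu> \<alpha>"
    using assms unfolding diff_in_lattice_def by blast
  then have "\<nu> = shift \<mu> (\<lambda>i. - \<alpha> i)" by (simp add: shift_shift)
  then show ?thesis unfolding diff_in_lattice_def using root_lattice_uminus [OF \<alpha>(1)] by blast
qed

lemma diff_in_lattice_trans:
  assumes "diff_in_lattice a b \<kappa> \<mu>" "diff_in_lattice a b \<mu> \<nu>"
  shows "diff_in_lattice a b \<kappa> \<nu>"
proof -
  obtain \<alpha> \<beta> where "\<alpha> \<in> root_lattice a b" "\<beta> \<in> root_lattice a b" "\<kappa> = shift \<mu> \<alpha>" "\<mu> = shift \<nu> \<beta>"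
    using assms unfolding diff_in_lattice_def by blast
  then show ?thesis
    unfolding diff_in_lattice_def using root_lattice_add [of \<alpha> a b \<beta>] by (auto simp: shift_shift)
qed

lemma weight_equiv_refl: "weight_equiv a b \<mu> \<mu>"
  by (simp add: weight_equiv_def diff_in_lattice_refl)

lemma weight_equiv_sym: "weight_equiv a b \<mu> \<nu> \<Longrightarrow> weight_equiv a b \<nu> \<mu>"
  by (simp add: weight_equiv_def diff_in_lattice_sym)

lemma weight_equiv_trans:
  "weight_equiv a b \<kappa> \<mu> \<Longrightarrow> weight_equiv a b \<mu> \<nu> \<Longrightarrow> weight_equiv a b \<kappa> \<nu>"
  unfolding weight_equiv_def using diff_in_lattice_trans by metis

lemma weight_class_eq:
  "weight_equiv a b \<mu> \<nu> \<Longrightarrow> weight_class k a b \<mu> = weight_class k a b \<nu>"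
  unfolding weight_class_def using weight_equiv_trans weight_equiv_sym by blast

lemma Nats_pred:
  fixes z :: complex
  assumes "z \<in> \<nat>" "z \<noteq> 0"
  shows "z - 1 \<in> \<nat>"
proof -
  obtain n where "z = of_nat n" "n \<noteq> 0" using assms by (auto elim: Nats_cases)
  then have "z - 1 = of_nat (n - 1)" by (simp add: of_nat_diff)
  then show ?thesis by simp
qed

lemma Nats_add_int_nonneg:
  fixes z :: complex
  assumes "z \<in> \<nat>" "n \<ge> 0"
  shows "z + of_int n \<in> \<nat>"
proof -
  have "(of_int n :: complex) = of_nat (nat n)" using assms by simp
  then show ?thesis using assms by (metis Nats_add of_nat_in_Nats)
qed


subsection \<open>The module of an equivalence class\<close>

text \<open>
  \<open>exchange_sign\<close> is a bicharacter on indices, so ordering the indices and letting the letter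
  with index \<open>i\<close> pick up the signs of the letters with smaller index realises all exchange
  relations between different indices (a Jordan-Wigner twist).
\<close>

definition twist :: "kind \<Rightarrow> weight \<Rightarrow> int \<Rightarrow> weight \<Rightarrow> complex" where
  "twist k \<nu> i \<kappa> = (\<Prod>j\<in>{j. j < i \<and> \<kappa> j \<noteq> \<nu> j}.
     exchange_sign k (Cre i) (Cre j) powi \<lfloor>Re (\<kappa> j - \<nu> j)\<rfloor>)"

fun eigenfactor :: "generator \<Rightarrow> weight \<Rightarrow> complex" where
  "eigenfactor (Cre i) \<kappa> = 1"
| "eigenfactor (Ann i) \<kappa> = \<kappa> i"

text \<open>Truncation is built into the coefficient. Only the target is tested; starting from the
  class, \<open>act_closed\<close> keeps every source inside it.\<close>

definition letter_coeff :: "kind \<Rightarrow> enat \<Rightarrow> enat \<Rightarrow> weight \<Rightarrow> generator \<Rightarrow> weight \<Rightarrow> complex" where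
  "letter_coeff k a b \<nu> g \<kappa> =
     (if shift \<kappa> (letter_weight g) \<in> weight_class k a b \<nu>
      then twist k \<nu> (gindex g) \<kappa> * eigenfactor g \<kappa> else 0)"

fun word_coeff :: "kind \<Rightarrow> enat \<Rightarrow> enat \<Rightarrow> weight \<Rightarrow> generator list \<Rightarrow> weight \<Rightarrow> complex" where
  "word_coeff k a b \<nu> [] \<kappa> = 1"
| "word_coeff k a b \<nu> (g # gs) \<kappa> =
     letter_coeff k a b \<nu> g (shift \<kappa> (word_weight (Word gs))) * word_coeff k a b \<nu> gs \<kappa>"

lemma word_weight_append:
  "word_weight (Word (gs @ hs)) = (\<lambda>j. word_weight (Word gs) j + word_weight (Word hs) j)"
  by (simp add: word_weight_def)

lemma word_coeff_append:
  "word_coeff k a b \<nu> (gs @ hs) \<kappa> =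
     word_coeff k a b \<nu> gs (shift \<kappa> (word_weight (Word hs))) * word_coeff k a b \<nu> hs \<kappa>"
  by (induction gs) (simp_all add: shift_shift word_weight_append)

lemma powi_sign_square:
  fixes s :: complex
  assumes "s = 1 \<or> s = - 1"
  shows "(s powi n) * (s powi n) = 1"
proof -
  have "(s powi n) * (s powi n) = (s * s) powi n" by (simp add: power_int_mult_distrib)
  also have "s * s = 1" using assms by auto
  finally show ?thesis by simp
qed

lemma twist_square: "twist k \<nu> i \<kappa> * twist k \<nu> i \<kappa> = 1"
  unfolding twist_def using exchange_sign_cases
  by (simp add: powi_sign_square flip: prod.distrib)

text \<open>Words act through products of letter coefficients, so the free algebra acts on all
  combinations of weights and the algebraic laws carry no side conditions. The restriction to one
  class becomes essential when the relations are checked.\<close>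

definition action ::
    "kind \<Rightarrow> enat \<Rightarrow> enat \<Rightarrow> weight \<Rightarrow> free_elt \<Rightarrow> (weight \<Rightarrow>\<^sub>0 complex) \<Rightarrow> (weight \<Rightarrow>\<^sub>0 complex)" where
  "action k a b \<nu> f v = (\<Sum>w\<in>Poly_Mapping.keys f. \<Sum>\<kappa>\<in>Poly_Mapping.keys v.
     Poly_Mapping.single (shift \<kappa> (word_weight w))
       (Poly_Mapping.lookup f w * Poly_Mapping.lookup v \<kappa> * word_coeff k a b \<nu> (letters w) \<kappa>))"

lemma action_superset:
  assumes "finite A" "finite B" "Poly_Mapping.keys f \<subseteq> A" "Poly_Mapping.keys v \<subseteq> B"
  shows "action k a b \<nu> f v = (\<Sum>w\<in>A. \<Sum>\<kappa>\<in>B.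
     Poly_Mapping.single (shift \<kappa> (word_weight w))
       (Poly_Mapping.lookup f w * Poly_Mapping.lookup v \<kappa> * word_coeff k a b \<nu> (letters w) \<kappa>))"
    (is "_ = (\<Sum>w\<in>A. \<Sum>\<kappa>\<in>B. ?t w \<kappa>)")
proof -
  have "(\<Sum>\<kappa>\<in>Poly_Mapping.keys v. ?t w \<kappa>) = (\<Sum>\<kappa>\<in>B. ?t w \<kappa>)" for w
    using assms by (intro sum.mono_neutral_left) (auto simp: in_keys_iff)
  then have "action k a b \<nu> f v = (\<Sum>w\<in>Poly_Mapping.keys f. \<Sum>\<kappa>\<in>B. ?t w \<kappa>)"
    by (simp add: action_def)
  also have "\<dots> = (\<Sum>w\<in>A. \<Sum>\<kappa>\<in>B. ?t w \<kappa>)"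
    using assms by (intro sum.mono_neutral_left) (auto simp: in_keys_iff)
  finally show ?thesis .
qed

lemma action_add_left: "action k a b \<nu> (f + g) v = action k a b \<nu> f v + action k a b \<nu> g v"
proof -
  let ?A = "Poly_Mapping.keys f \<union> Poly_Mapping.keys g" and ?B = "Poly_Mapping.keys v"
  have "Poly_Mapping.keys (f + g) \<subseteq> ?A" by (rule keys_add)
  then show ?thesis
    using action_superset [of ?A ?B "f + g" v k a b \<nu>] action_superset [of ?A ?B f v k a b \<nu>]
      action_superset [of ?A ?B g v k a b \<nu>]
    by (simp add: lookup_add algebra_simps single_add sum.distrib)
qed

lemma action_add_right: "action k a b \<nu> f (u + v) = action k a b \<nu> f u + action k a b \<nu> f v"
proof -
  let ?B = "Poly_Mapping.keys u \<union> Poly_Mapping.keys v" and ?A = "Poly_Mapping.keys f"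
  have "Poly_Mapping.keys (u + v) \<subseteq> ?B" by (rule keys_add)
  then show ?thesis
    using action_superset [of ?A ?B f "u + v" k a b \<nu>] action_superset [of ?A ?B f u k a b \<nu>]
      action_superset [of ?A ?B f v k a b \<nu>]
    by (simp add: lookup_add algebra_simps single_add sum.distrib)
qed

lemma action_zero_left [simp]: "action k a b \<nu> 0 v = 0"
  by (simp add: action_def)

lemma action_zero_right [simp]: "action k a b \<nu> f 0 = 0"
  by (simp add: action_def)

lemma action_single:
  "action k a b \<nu> (Poly_Mapping.single w c) (Poly_Mapping.single \<kappa> d) =
     Poly_Mapping.single (shift \<kappa> (word_weight w)) (c * d * word_coeff k a b \<nu> (letters w) \<kappa>)"
  by (subst action_superset [of "{w}" "{\<kappa>}"]) auto

text \<open>Linearity in all three arguments reduces the claim to two words and one weight, where it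
  is \<open>word_coeff_append\<close>.\<close>

lemma action_mult: "action k a b \<nu> (f * g) v = action k a b \<nu> f (action k a b \<nu> g v)"
proof -
  have 1: "action k a b \<nu> (Poly_Mapping.single w c * Poly_Mapping.single x d) (Poly_Mapping.single \<kappa> e) =
     action k a b \<nu> (Poly_Mapping.single w c)
       (action k a b \<nu> (Poly_Mapping.single x d) (Poly_Mapping.single \<kappa> e))" for w c x d \<kappa> e
    using word_coeff_append [of k a b \<nu> "letters w" "letters x" \<kappa>]
      word_weight_append [of "letters w" "letters x"]
    by (simp add: mult_single action_single plus_word_def shift_shift ac_simps)
  have 2: "action k a b \<nu> (Poly_Mapping.single w c * Poly_Mapping.single x d) v =
     action k a b \<nu> (Poly_Mapping.single w c) (action k a b \<nu> (Poly_Mapping.single x d) v)" for w c x d v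
    using subset_UNIV [of "Poly_Mapping.keys v"]
    by (induction v rule: free_elt_induct) (simp_all add: action_add_right 1)
  have 3: "action k a b \<nu> (Poly_Mapping.single w c * g) v =
     action k a b \<nu> (Poly_Mapping.single w c) (action k a b \<nu> g v)" for w c g
    using subset_UNIV [of "Poly_Mapping.keys g"]
    by (induction g rule: free_elt_induct)
       (simp_all add: action_add_right action_add_left distrib_left 2)
  show ?thesis
    using subset_UNIV [of "Poly_Mapping.keys f"]
    by (induction f rule: free_elt_induct) (simp_all add: action_add_left distrib_right 3)
qed

lemma action_uminus: "action k a b \<nu> (- f) v = - action k a b \<nu> f v"
  using action_add_left [of k a b \<nu> "- f" f v] by (simp add: eq_neg_iff_add_eq_0)

lemma action_diff: "action k a b \<nu> (f - g) v = action k a b \<nu> f v - action k a b \<nu> g v"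
  using action_add_left [of k a b \<nu> f "- g" v] by (simp add: action_uminus)

lemma lookup_action_const:
  "Poly_Mapping.lookup (action k a b \<nu> (const c) v) \<kappa> = c * Poly_Mapping.lookup v \<kappa>"
  using subset_UNIV [of "Poly_Mapping.keys v"]
proof (induction v rule: free_elt_induct)
  case (add \<kappa>' d v)
  then show ?case
    by (simp add: action_add_right const_def zero_word_def action_single lookup_add lookup_single
        algebra_simps when_def)
qed simp

lemma action_one: "action k a b \<nu> 1 v = v"
  using lookup_action_const [of k a b \<nu> 1 v] by (intro poly_mapping_eqI) simp

lemma action_gen_single:
  "action k a b \<nu> (gen g) (Poly_Mapping.single \<kappa> d) =
     Poly_Mapping.single (shift \<kappa> (letter_weight g)) (d * letter_coeff k a b \<nu> g \<kappa>)"
  by (simp add: gen_def action_single word_weight_def)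

lemma action_const_single:
  "action k a b \<nu> (const c) (Poly_Mapping.single \<kappa> d) = Poly_Mapping.single \<kappa> (c * d)"
  by (simp add: const_def zero_word_def action_single)


section \<open>The relations hold on one equivalence class\<close>

locale weight_class_module =
  fixes k :: kind and a b :: enat and \<nu> :: weight and p :: "weight \<Rightarrow> bit"
  assumes \<nu>_weight: "\<nu> \<in> weights k a b" and p: "parity_map k a b p"
begin

abbreviation "I \<equiv> index_set a b"
abbreviation "F \<equiv> carrier (free_algebra (index_set a b))"
abbreviation "S \<equiv> weight_class k a b \<nu>"
abbreviation "act \<equiv> action k a b \<nu>"
abbreviation "coeff \<equiv> letter_coeff k a b \<nu>"
abbreviation "wcoeff \<equiv> word_coeff k a b \<nu>"

text \<open>Apart from the lattice condition, membership in the class is tested coordinate by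
  coordinate; a letter moves a single coordinate, so only its own index has to be examined.\<close>

definition compatible :: "int \<Rightarrow> complex \<Rightarrow> bool" where
  "compatible i z \<longleftrightarrow> (z \<in> \<nat> \<longleftrightarrow> \<nu> i \<in> \<nat>) \<and> (fermionic k i \<longrightarrow> z \<in> {0, 1})"

lemma S_iff:
  "\<kappa> \<in> S \<longleftrightarrow> diff_in_lattice a b \<kappa> \<nu> \<and> (\<forall>i. i \<notin> I \<longrightarrow> \<kappa> i = 0) \<and> (\<forall>i\<in>I. compatible i (\<kappa> i))"
  unfolding weight_class_def weight_equiv_def weights_def compatible_def fermionic_def
  by (auto simp: set_eq_iff)

lemma \<nu>_in_S: "\<nu> \<in> S"
  using \<nu>_weight by (simp add: weight_class_def weight_equiv_refl)

lemma S_weights: "\<kappa> \<in> S \<Longrightarrow> \<kappa> \<in> weights k a b"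
  by (simp add: weight_class_def)

lemma letter_weight_other: "i \<noteq> gindex g \<Longrightarrow> letter_weight g i = 0"
  by (cases g) auto

lemma shift_letter_in_S:
  assumes "\<kappa> \<in> S" "gindex g \<in> I"
  shows "shift \<kappa> (letter_weight g) \<in> S \<longleftrightarrow>
    compatible (gindex g) (\<kappa> (gindex g) + of_int (letter_weight g (gindex g)))"
proof -
  have "diff_in_lattice a b (shift \<kappa> (letter_weight g)) \<kappa>"
    unfolding diff_in_lattice_def using root_lattice_letter [OF assms(2)] by blast
  then have "diff_in_lattice a b (shift \<kappa> (letter_weight g)) \<nu>"
    using assms(1) diff_in_lattice_trans unfolding S_iff by blast
  moreover have "shift \<kappa> (letter_weight g) i = 0" if "i \<notin> I" for i
    using that assms letter_weight_other [of i g] unfolding S_iff by (auto simp: shift_def)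
  moreover have "compatible i (shift \<kappa> (letter_weight g) i)" if "i \<in> I" "i \<noteq> gindex g" for i
    using that assms letter_weight_other [of i g] unfolding S_iff by (auto simp: shift_def)
  ultimately show ?thesis using assms(2) unfolding S_iff [of "shift _ _"] by (auto simp: shift_def)
qed

lemma finite_difference: "\<kappa> \<in> S \<Longrightarrow> finite {j. \<kappa> j \<noteq> \<nu> j}"
  unfolding S_iff diff_in_lattice_def root_lattice_def shift_def by auto

text \<open>A letter changes one exponent by 1 or -1, and for a sign either change means
  multiplication by that sign. The floor of the real part turns a coordinate difference, an integer
  given as a complex number, into an exponent.\<close>

lemma twist_shift:
  assumes "\<kappa> \<in> S"
  shows "twist k \<nu> i (shift \<kappa> (letter_weight g)) =
    (if gindex g < i then exchange_sign k (Cre i) (Cre (gindex g)) else 1) * twist k \<nu> i \<kappa>"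
proof -
  let ?t = "\<lambda>\<kappa> j. exchange_sign k (Cre i) (Cre j) powi \<lfloor>Re (\<kappa> j - \<nu> j)\<rfloor>"
  let ?\<kappa>' = "shift \<kappa> (letter_weight g)"
  \<comment> \<open>A common finite index set for both products; the index of \<open>g\<close> is
    included because the shift may create or remove a difference there.\<close>
  define B where "B = {j. j < i \<and> (\<kappa> j \<noteq> \<nu> j \<or> j = gindex g)}"
  have fin: "finite B"
    by (rule finite_subset [of _ "insert (gindex g) {j. \<kappa> j \<noteq> \<nu> j}"])
       (auto simp: B_def finite_difference [OF assms])
  have other: "?\<kappa>' j = \<kappa> j" if "j \<noteq> gindex g" for j
    using that letter_weight_other by (simp add: shift_def)
  have 1: "twist k \<nu> i \<kappa> = (\<Prod>j\<in>B. ?t \<kappa> j)"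
    unfolding twist_def using fin by (intro prod.mono_neutral_left) (auto simp: B_def)
  have 2: "twist k \<nu> i ?\<kappa>' = (\<Prod>j\<in>B. ?t ?\<kappa>' j)"
    unfolding twist_def using fin other by (intro prod.mono_neutral_left) (fastforce simp: B_def)+
  show ?thesis
  proof (cases "gindex g < i")
    case False
    then have "?t ?\<kappa>' j = ?t \<kappa> j" if "j \<in> B" for j
      using that other [of j] by (auto simp: B_def)
    then show ?thesis using False unfolding 1 2 by simp
  next
    case True
    let ?s = "exchange_sign k (Cre i) (Cre (gindex g))"
    have s: "?s = 1 \<or> ?s = - 1" by (rule exchange_sign_cases)
    have floor: "\<lfloor>Re (?\<kappa>' (gindex g) - \<nu> (gindex g))\<rfloor> =
        \<lfloor>Re (\<kappa> (gindex g) - \<nu> (gindex g))\<rfloor> + letter_weight g (gindex g)"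
      by (simp add: shift_def) linarith
    have "?s powi (letter_weight g (gindex g)) = ?s" "?s \<noteq> 0"
      using s by (cases g; auto)+
    then have head: "?t ?\<kappa>' (gindex g) = ?s * ?t \<kappa> (gindex g)"
      unfolding floor by (subst power_int_add) (simp_all add: mult.commute)
    have g: "gindex g \<in> B" using True by (simp add: B_def)
    have "(\<Prod>j\<in>B. ?t ?\<kappa>' j) = ?t ?\<kappa>' (gindex g) * (\<Prod>j\<in>B - {gindex g}. ?t ?\<kappa>' j)"
      by (rule prod.remove [OF fin g])
    also have "(\<Prod>j\<in>B - {gindex g}. ?t ?\<kappa>' j) = (\<Prod>j\<in>B - {gindex g}. ?t \<kappa> j)"
      using other by (intro prod.cong) auto
    also have "?t ?\<kappa>' (gindex g) * (\<Prod>j\<in>B - {gindex g}. ?t \<kappa> j) = ?s * (\<Prod>j\<in>B. ?t \<kappa> j)"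
      unfolding head prod.remove [OF fin g, of "?t \<kappa>"] by simp
    finally show ?thesis unfolding 1 2 using True by simp
  qed
qed

lemma shift_commute: "shift (shift \<kappa> \<alpha>) \<beta> = shift (shift \<kappa> \<beta>) \<alpha>"
  by (simp add: shift_shift add.commute)

text \<open>Exactly one of the two indices is larger, and only the letter of larger index picks up a
  sign when the other acts first. Truncation and eigenvalue factor at one index are blind to a move
  at the other.\<close>

lemma coeff_exchange_distinct:
  assumes "\<kappa> \<in> S" "gindex g \<in> I" "gindex h \<in> I" "gindex g \<noteq> gindex h"
  shows "coeff g (shift \<kappa> (letter_weight h)) * coeff h \<kappa> =
    exchange_sign k g h * (coeff h (shift \<kappa> (letter_weight g)) * coeff g \<kappa>)"
proof -
  have val: "shift \<kappa> (letter_weight h) (gindex g) = \<kappa> (gindex g)"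
    "shift \<kappa> (letter_weight g) (gindex h) = \<kappa> (gindex h)"
    using assms(4) letter_weight_other by (simp_all add: shift_def)
  have eig: "eigenfactor g (shift \<kappa> (letter_weight h)) = eigenfactor g \<kappa>"
    "eigenfactor h (shift \<kappa> (letter_weight g)) = eigenfactor h \<kappa>"
    using val by (cases g; simp; fail) (use val in \<open>cases h; simp\<close>)
  have mem: "shift (shift \<kappa> (letter_weight h)) (letter_weight g) \<in> S \<longleftrightarrow> shift \<kappa> (letter_weight g) \<in> S"
    if "shift \<kappa> (letter_weight h) \<in> S"
    using shift_letter_in_S [OF that assms(2)] shift_letter_in_S [OF assms(1,2)] val by simp
  have mem': "shift (shift \<kappa> (letter_weight g)) (letter_weight h) \<in> S \<longleftrightarrow> shift \<kappa> (letter_weight h) \<in> S"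
    if "shift \<kappa> (letter_weight g) \<in> S"
    using shift_letter_in_S [OF that assms(3)] shift_letter_in_S [OF assms(1,3)] val by simp
  have s: "exchange_sign k (Cre (gindex g)) (Cre (gindex h)) = exchange_sign k g h"
    "exchange_sign k (Cre (gindex h)) (Cre (gindex g)) = exchange_sign k g h"
    by (simp_all add: exchange_sign_def mult.commute)
  show ?thesis
  proof (cases "shift \<kappa> (letter_weight g) \<in> S \<and> shift \<kappa> (letter_weight h) \<in> S")
    case False
    then show ?thesis using mem mem' by (auto simp: letter_coeff_def)
  next
    case True
    then show ?thesis
      using mem mem' assms(4) exchange_sign_square [of k g h]
      by (simp add: letter_coeff_def eig twist_shift [OF assms(1)] s)
  qed
qed

lemma fermionic_range: "\<kappa> \<in> S \<Longrightarrow> i \<in> I \<Longrightarrow> fermionic k i \<Longrightarrow> \<kappa> i = 0 \<or> \<kappa> i = 1"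
  unfolding S_iff compatible_def by blast

text \<open>The crucial case is \<open>Cre i\<close> leaving the class: then \<kappa>_i is -1, or 1
  at a fermionic index, and the required value is 0 in both cases.\<close>

lemma coeff_Ann_Cre:
  assumes "\<kappa> \<in> S" "i \<in> I"
  shows "coeff (Ann i) (shift \<kappa> (letter_weight (Cre i))) * coeff (Cre i) \<kappa> =
    (if fermionic k i then 1 - \<kappa> i else \<kappa> i + 1)"
proof -
  have cancel: "shift (shift \<kappa> (letter_weight (Cre i))) (letter_weight (Ann i)) = \<kappa>"
    by (simp add: shift_def fun_eq_iff)
  have compat: "compatible i (\<kappa> i)" using assms unfolding S_iff by blast
  show ?thesis
  proof (cases "shift \<kappa> (letter_weight (Cre i)) \<in> S")
    case True
    then have "coeff (Ann i) (shift \<kappa> (letter_weight (Cre i))) * coeff (Cre i) \<kappa> =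
        (\<kappa> i + 1) * (twist k \<nu> i \<kappa> * twist k \<nu> i \<kappa>)"
    proof -
      have "twist k \<nu> i (shift \<kappa> (letter_weight (Cre i))) = twist k \<nu> i \<kappa>"
        using twist_shift [OF assms(1), of i "Cre i"] by simp
      moreover have "shift \<kappa> (letter_weight (Cre i)) i = \<kappa> i + 1"
        by (simp add: shift_def)
      ultimately show ?thesis
        using assms(1) True unfolding letter_coeff_def cancel by (simp del: letter_weight.simps)
    qed
    \<comment> \<open>Both \<kappa>_i and \<kappa>_i + 1 lie in {0, 1}; at 0 the formulas
      \<open>1 - \<kappa> i\<close> and \<open>\<kappa> i + 1\<close> agree.\<close>
    moreover have "\<kappa> i = 0" if "fermionic k i"
    proof -
      have "\<kappa> i + 1 = 0 \<or> \<kappa> i + 1 = 1"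
        using fermionic_range [OF True assms(2) that] by (simp add: shift_def)
      then show ?thesis using fermionic_range [OF assms that] by auto
    qed
    ultimately show ?thesis by (simp add: twist_square)
  next
    case False
    then have incompat: "\<not> compatible i (\<kappa> i + 1)"
      using shift_letter_in_S [of \<kappa> "Cre i"] assms by simp
    have "\<kappa> i = (if fermionic k i then 1 else - 1)"
    proof (cases "fermionic k i")
      case True
      then show ?thesis
        using incompat compat fermionic_range [OF assms True] by (auto simp: compatible_def)
    next
      case False
      \<comment> \<open>Adding 1 changes membership in the naturals only at -1.\<close>
      then have "(\<kappa> i \<in> \<nat>) \<noteq> (\<kappa> i + 1 \<in> \<nat>)"
        using incompat compat by (auto simp: compatible_def)
      then have "\<kappa> i + 1 \<in> \<nat>" "\<kappa> i \<notin> \<nat>" using Nats_add [of "\<kappa> i" 1] by auto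
      then have "\<kappa> i + 1 = 0" using Nats_pred [of "\<kappa> i + 1"] by auto
      then show ?thesis using False by (simp add: eq_neg_iff_add_eq_0)
    qed
    then show ?thesis using False by (auto simp: letter_coeff_def)
  qed
qed

text \<open>\<open>Ann i\<close> can leave the class only at \<kappa>_i = 0, where its factor is 0
  anyway.\<close>

lemma coeff_Cre_Ann:
  assumes "\<kappa> \<in> S" "i \<in> I"
  shows "coeff (Cre i) (shift \<kappa> (letter_weight (Ann i))) * coeff (Ann i) \<kappa> = \<kappa> i"
proof -
  have cancel: "shift (shift \<kappa> (letter_weight (Ann i))) (letter_weight (Cre i)) = \<kappa>"
    by (simp add: shift_def fun_eq_iff)
  have compat: "compatible i (\<kappa> i)" using assms unfolding S_iff by blast
  show ?thesis
  proof (cases "shift \<kappa> (letter_weight (Ann i)) \<in> S")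
    case True
    then have "coeff (Cre i) (shift \<kappa> (letter_weight (Ann i))) * coeff (Ann i) \<kappa> =
        \<kappa> i * (twist k \<nu> i \<kappa> * twist k \<nu> i \<kappa>)"
    proof -
      have "twist k \<nu> i (shift \<kappa> (letter_weight (Ann i))) = twist k \<nu> i \<kappa>"
        using twist_shift [OF assms(1), of i "Ann i"] by simp
      then show ?thesis
        using assms(1) True unfolding letter_coeff_def cancel by (simp del: letter_weight.simps)
    qed
    then show ?thesis by (simp add: twist_square)
  next
    case False
    then have incompat: "\<not> compatible i (\<kappa> i - 1)"
      using shift_letter_in_S [of \<kappa> "Ann i"] assms by simp
    have "\<kappa> i = 0"
    proof (rule ccontr)
      assume "\<kappa> i \<noteq> 0"
      then have "\<kappa> i - 1 \<in> \<nat> \<longleftrightarrow> \<kappa> i \<in> \<nat>"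
        using Nats_pred [of "\<kappa> i"] Nats_add [of "\<kappa> i - 1" 1] by auto
      moreover have "fermionic k i \<longrightarrow> \<kappa> i - 1 \<in> {0, 1}"
        using fermionic_range [OF assms] \<open>\<kappa> i \<noteq> 0\<close> by auto
      ultimately show False using incompat compat by (auto simp: compatible_def)
    qed
    then show ?thesis by (simp add: letter_coeff_def)
  qed
qed

text \<open>Otherwise a coordinate would take three consecutive integer values inside {0,
  1}.\<close>

lemma coeff_same_fermionic:
  assumes "\<kappa> \<in> S" "gindex g \<in> I" "fermionic k (gindex g)"
  shows "coeff g (shift \<kappa> (letter_weight g)) * coeff g \<kappa> = 0"
proof (rule ccontr)
  assume "\<not> ?thesis"
  then have 1: "shift \<kappa> (letter_weight g) \<in> S"
    and 2: "shift (shift \<kappa> (letter_weight g)) (letter_weight g) \<in> S"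
    by (auto simp: letter_coeff_def split: if_splits)
  have "letter_weight g (gindex g) = 1 \<or> letter_weight g (gindex g) = - 1" by (cases g) auto
  then show False
    using fermionic_range [OF assms] fermionic_range [OF 1 assms(2,3)] fermionic_range [OF 2 assms(2,3)]
    by (auto simp: shift_def)
qed

text \<open>The letter patterns are those of the defining relators. For the pair
  \<open>Ann i\<close>, \<open>Cre i\<close> the contraction 1 arises as
  \<open>(1 - \<kappa> i) + \<kappa> i\<close> at a fermionic index and as
  \<open>(\<kappa> i + 1) - \<kappa> i\<close> otherwise.\<close>

lemma coeff_exchange:
  assumes "\<kappa> \<in> S" "gindex g \<in> I" "gindex h \<in> I" "\<nexists>i j. g = Cre i \<and> h = Ann j"
  shows "coeff g (shift \<kappa> (letter_weight h)) * coeff h \<kappa> =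
    exchange_sign k g h * (coeff h (shift \<kappa> (letter_weight g)) * coeff g \<kappa>) + contraction k g h"
proof (cases "gindex g = gindex h")
  case False
  then have "contraction k g h = 0" using assms(4) by (cases g; cases h) auto
  then show ?thesis using coeff_exchange_distinct [OF assms(1-3) False] by simp
next
  case True
  have nz: "gindex g \<noteq> 0" using assms zero_not_in_index_set by metis
  show ?thesis
  proof (cases "g = h")
    case True
    then have "contraction k g h = 0" by (cases g) auto
    then show ?thesis
      using True coeff_same_fermionic [OF assms(1,2)] exchange_sign_same [of g "gindex g" g k] nz
      by auto
  next
    case False
    then obtain i where gh: "g = Ann i" "h = Cre i"
      using True assms(4) by (cases g; cases h) auto
    have "exchange_sign k g h = (if fermionic k i then - 1 else 1)"
      using gh nz by (intro exchange_sign_same) auto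
    then show ?thesis
      using gh assms coeff_Ann_Cre [OF assms(1), of i] coeff_Cre_Ann [OF assms(1), of i] by simp
  qed
qed

lemma word_coeff_stays:
  assumes "\<kappa> \<in> S" "wcoeff gs \<kappa> \<noteq> 0"
  shows "shift \<kappa> (word_weight (Word gs)) \<in> S"
proof (cases gs)
  case (Cons g hs)
  then have "coeff g (shift \<kappa> (word_weight (Word hs))) \<noteq> 0" using assms by auto
  then have "shift (shift \<kappa> (word_weight (Word hs))) (letter_weight g) \<in> S"
    by (auto simp: letter_coeff_def split: if_splits)
  then show ?thesis by (simp add: Cons word_weight_Cons shift_shift)
qed (use assms in simp)

lemma act_closed:
  assumes "Poly_Mapping.keys v \<subseteq> S"
  shows "Poly_Mapping.keys (act f v) \<subseteq> S"
proof -
  have sub: "Poly_Mapping.keys (x + y) \<subseteq> S" if "Poly_Mapping.keys x \<subseteq> S" "Poly_Mapping.keys y \<subseteq> S"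
    for x y :: "weight \<Rightarrow>\<^sub>0 complex"
    using that keys_add [of x y] by blast
  have single: "Poly_Mapping.keys (act (Poly_Mapping.single w c) (Poly_Mapping.single \<kappa> d)) \<subseteq> S"
    if "\<kappa> \<in> S" for w c \<kappa> d
    using word_coeff_stays [OF that, of "letters w"] by (auto simp: action_single split: if_splits)
  have 1: "Poly_Mapping.keys (act (Poly_Mapping.single w c) v) \<subseteq> S" for w c
    using assms by (induction v rule: free_elt_induct) (simp_all add: action_add_right sub single)
  show ?thesis
    using subset_UNIV [of "Poly_Mapping.keys f"]
    by (induction f rule: free_elt_induct) (simp_all add: action_add_left sub 1)
qed

text \<open>The elements acting as zero on the span of the class. That span is stable, so they form
  a two-sided ideal, and it suffices to find the relators in it for the action to descend to the
  quotient.\<close>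

definition kernel :: "free_elt set" where
  "kernel = {f \<in> F. \<forall>v. Poly_Mapping.keys v \<subseteq> S \<longrightarrow> act f v = 0}"

lemma kernel_ideal: "ideal kernel (free_algebra I)"
proof -
  interpret R: ring "free_algebra I" by (rule ring_free_algebra)
  have neg: "\<ominus>\<^bsub>free_algebra I\<^esub> f = - f" if "f \<in> F" for f
    using that R.minus_equality [of "- f" f] by (simp add: free_uminus)
  show ?thesis
  proof (rule idealI [OF ring_free_algebra])
    show "subgroup kernel (add_monoid (free_algebra I))"
    proof (rule R.add.subgroupI)
      show "kernel \<subseteq> carrier (free_algebra I)" "kernel \<noteq> {}"
        using free_zero by (auto simp: kernel_def)
    qed (auto simp: kernel_def neg action_uminus action_add_left free_uminus free_add)
  qed (auto simp: kernel_def action_mult free_mult act_closed)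
qed

lemma exchange_relator_in_kernel:
  assumes "gindex g \<in> I" "gindex h \<in> I" "\<nexists>i j. g = Cre i \<and> h = Ann j"
  shows "exchange_relator k g h \<in> kernel"
proof -
  have zero: "act (exchange_relator k g h) (Poly_Mapping.single \<kappa> d) = 0" if "\<kappa> \<in> S" for \<kappa> d
  proof -
    \<comment> \<open>A nonzero contraction requires letters of opposite weight, so the scalar term
      sits at the same weight as the products.\<close>
    have c: "shift (shift \<kappa> (letter_weight h)) (letter_weight g) = \<kappa>" if "contraction k g h \<noteq> 0"
      using that assms(3) by (cases g; cases h) (auto simp: shift_def fun_eq_iff split: if_splits)
    let ?\<kappa> = "shift (shift \<kappa> (letter_weight h)) (letter_weight g)"
    have "act (exchange_relator k g h) (Poly_Mapping.single \<kappa> d) =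
      Poly_Mapping.single ?\<kappa> (d * (coeff g (shift \<kappa> (letter_weight h)) * coeff h \<kappa>))
      - Poly_Mapping.single ?\<kappa> (d * (exchange_sign k g h * (coeff h (shift \<kappa> (letter_weight g)) * coeff g \<kappa>)))
      - Poly_Mapping.single \<kappa> (d * contraction k g h)"
      by (simp add: exchange_relator_def action_diff action_mult action_gen_single action_const_single
          shift_commute [of \<kappa> "letter_weight g"] ac_simps)
    also have "Poly_Mapping.single \<kappa> (d * contraction k g h) = Poly_Mapping.single ?\<kappa> (d * contraction k g h)"
      using c by (cases "contraction k g h = 0") simp_all
    finally show ?thesis
      unfolding coeff_exchange [OF that assms] by (simp add: algebra_simps single_add)
  qed
  have "act (exchange_relator k g h) v = 0" if "Poly_Mapping.keys v \<subseteq> S" for v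
    using that by (induction v rule: free_elt_induct) (simp_all add: action_add_right zero)
  then show ?thesis
    using rel_ideal_carrier [OF exchange_relator_in_rel_ideal [OF assms(1,2)]]
    by (simp add: kernel_def)
qed

lemma rel_ideal_kernel: "rel_ideal k I \<subseteq> kernel"
proof (rule ring.genideal_minimal [OF ring_free_algebra kernel_ideal])
  show "relators k I \<subseteq> kernel"
  proof
    fix r assume "r \<in> relators k I"
    then obtain g h where "gindex g \<in> I" "gindex h \<in> I" "\<nexists>i j. g = Cre i \<and> h = Ann j"
      "r = exchange_relator k g h"
      unfolding relators_def bracket_eq exchange_relator_def
      by (elim UnE CollectE exE conjE) (force, force, force)
    then show "r \<in> kernel" using exchange_relator_in_kernel by blast
  qed
qed

text \<open>A coset acts through a chosen representative, and \<open>X_smult\<close> frees the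
  action from the choice. Taking the parity of a monomial from \<open>p\<close> makes the module
  preferred by construction.\<close>

definition X :: "(free_elt set, weight \<Rightarrow>\<^sub>0 complex) supermodule" where
  "X = \<lparr>carrier = {v. Poly_Mapping.keys v \<subseteq> S}, mult = (\<lambda>x y. 0), one = 0, zero = 0, add = (+),
     smult = (\<lambda>r. act (SOME f. f \<in> F \<and> r = cls k a b f)),
     mpart = (\<lambda>d. {v. Poly_Mapping.keys v \<subseteq> {\<kappa> \<in> S. p \<kappa> = d}})\<rparr>"

lemma X_simps [simp]:
  "carrier X = {v. Poly_Mapping.keys v \<subseteq> S}" "zero X = 0" "add X = (+)"
  "mpart X d = {v. Poly_Mapping.keys v \<subseteq> {\<kappa> \<in> S. p \<kappa> = d}}"
  by (simp_all add: X_def)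

lemma X_smult:
  assumes "f \<in> F" "Poly_Mapping.keys v \<subseteq> S"
  shows "cls k a b f \<odot>\<^bsub>X\<^esub> v = act f v"
proof -
  define g where "g = (SOME g. g \<in> F \<and> cls k a b f = cls k a b g)"
  have g: "g \<in> F \<and> cls k a b f = cls k a b g"
    unfolding g_def using assms(1) someI [of "\<lambda>g. g \<in> F \<and> cls k a b f = cls k a b g" f] by simp
  have "f \<in> cls k a b f" by (simp add: cls_mem rel_ideal_zero)
  then have "f - g \<in> kernel" using g rel_ideal_kernel cls_mem by blast
  then have "act f v = act g v" using assms(2) by (simp add: kernel_def action_diff)
  then show ?thesis by (simp add: X_def g_def)
qed

lemma X_abelian_group: "abelian_group X"
proof (rule abelian_groupI)
  show "\<exists>y\<in>carrier X. y \<oplus>\<^bsub>X\<^esub> x = \<zero>\<^bsub>X\<^esub>" if "x \<in> carrier X" for x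
    using that by (intro bexI [of _ "- x"]) simp_all
  show "x \<oplus>\<^bsub>X\<^esub> y \<in> carrier X" if "x \<in> carrier X" "y \<in> carrier X" for x y
    using that keys_add [of x y] by auto
qed (simp_all add: ac_simps)

text \<open>This serves the parity grading and the weight decomposition alike. Blocks may be empty,
  as they are for weights outside the class.\<close>

lemma X_direct_sum:
  assumes B: "\<And>c. c \<in> C \<Longrightarrow> B c \<subseteq> S" "S \<subseteq> (\<Union>c\<in>C. B c)"
    and disjoint: "\<And>c d. c \<in> C \<Longrightarrow> d \<in> C \<Longrightarrow> c \<noteq> d \<Longrightarrow> B c \<inter> B d = {}"
  shows "internal_direct_sum X (\<lambda>c. {v. Poly_Mapping.keys v \<subseteq> B c}) C"
proof -
  interpret X: abelian_group X by (rule X_abelian_group)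
  have neg: "\<ominus>\<^bsub>X\<^esub> v = - v" if "v \<in> carrier X" for v
    using that X.minus_equality [of "- v" v] by simp
  have finsum: "(\<Oplus>\<^bsub>X\<^esub>c\<in>A. f c) = (\<Sum>c\<in>A. f c)"
    if "finite A" "\<And>c. f c \<in> carrier X" for f :: "_ \<Rightarrow> (weight \<Rightarrow>\<^sub>0 complex)" and A
    using that(1)
  proof (induction A rule: finite_induct)
    case (insert c A)
    then show ?case using that(2) X.finsum_insert [of A c f] by simp
  qed simp
  \<comment> \<open>The block that contains a given basis weight; by disjointness there is only
    one.\<close>
  define \<gamma> where "\<gamma> \<kappa> = (THE c. c \<in> C \<and> \<kappa> \<in> B c)" for \<kappa>
  have \<gamma>: "\<gamma> \<kappa> = c" if "c \<in> C" "\<kappa> \<in> B c" for \<kappa> c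
    unfolding \<gamma>_def using that disjoint by (intro the_equality) blast+
  have \<gamma>_in: "\<gamma> \<kappa> \<in> C \<and> \<kappa> \<in> B (\<gamma> \<kappa>)" if "\<kappa> \<in> S" for \<kappa>
    using that B(2) \<gamma> by blast
  have lookup_sum: "Poly_Mapping.lookup (\<Sum>c\<in>A. f c) \<kappa> = (\<Sum>c\<in>A. Poly_Mapping.lookup (f c) \<kappa>)"
    if "finite A" for A \<kappa> and f :: "_ \<Rightarrow> (weight \<Rightarrow>\<^sub>0 complex)"
    using that by (induction A rule: finite_induct) (simp_all add: lookup_add)
  let ?P = "\<lambda>x f. (\<forall>c\<in>C. f c \<in> {v. Poly_Mapping.keys v \<subseteq> B c}) \<and> (\<forall>c. c \<notin> C \<longrightarrow> f c = \<zero>\<^bsub>X\<^esub>) \<and>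
        finite {c. f c \<noteq> \<zero>\<^bsub>X\<^esub>} \<and> x = (\<Oplus>\<^bsub>X\<^esub>c\<in>{c. f c \<noteq> \<zero>\<^bsub>X\<^esub>}. f c)"
  have f_carrier: "f c \<in> carrier X" if "?P x f" for x f c
    using that B(1) by (cases "c \<in> C") fastforce+
  have f_zero: "Poly_Mapping.lookup (f c) \<kappa> = 0" if "?P x f" "\<kappa> \<notin> B c" for x f c \<kappa>
  proof (cases "c \<in> C")
    case True
    then have "Poly_Mapping.keys (f c) \<subseteq> B c" using that by simp
    then show ?thesis using that(2) by (metis in_keys_iff subsetD)
  next
    case False
    then show ?thesis using that by simp
  qed
  \<comment> \<open>Disjointness forces every coordinate of every decomposition, which gives
    uniqueness.\<close>
  have f_lookup: "Poly_Mapping.lookup (f c) \<kappa> = Poly_Mapping.lookup x \<kappa>"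
    if f: "?P x f" and "c \<in> C" "\<kappa> \<in> B c" for x f c \<kappa>
  proof -
    have fin: "finite {c. f c \<noteq> 0}" using f by simp
    have "x = (\<Sum>c\<in>{c. f c \<noteq> 0}. f c)"
      using f finsum [OF fin, of f] f_carrier [OF f] by simp
    then have "Poly_Mapping.lookup x \<kappa> = Poly_Mapping.lookup (\<Sum>c\<in>{c. f c \<noteq> 0}. f c) \<kappa>"
      by (rule arg_cong)
    also have "\<dots> = (\<Sum>c\<in>{c. f c \<noteq> 0}. Poly_Mapping.lookup (f c) \<kappa>)"
      by (rule lookup_sum [OF fin])
    finally have "Poly_Mapping.lookup x \<kappa> = (\<Sum>c\<in>{c. f c \<noteq> 0}. Poly_Mapping.lookup (f c) \<kappa>)" .
    also have "(\<Sum>c\<in>{c. f c \<noteq> 0}. Poly_Mapping.lookup (f c) \<kappa>) = (\<Sum>d\<in>{c}. Poly_Mapping.lookup (f d) \<kappa>)"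
    proof (rule sum.mono_neutral_cong)
      show "Poly_Mapping.lookup (f d) \<kappa> = 0" if "d \<in> {c. f c \<noteq> 0} - {c}" for d
      proof -
        have "d \<in> C" using that f by auto
        then have "\<kappa> \<notin> B d" using that disjoint [of c d] \<open>c \<in> C\<close> \<open>\<kappa> \<in> B c\<close> by blast
        then show ?thesis using f_zero [OF f] by blast
      qed
    qed (use f in auto)
    finally show ?thesis by simp
  qed
  show ?thesis
    unfolding internal_direct_sum_def
  proof (intro conjI ballI)
    fix c assume c: "c \<in> C"
    let ?V = "{v::weight \<Rightarrow>\<^sub>0 complex. Poly_Mapping.keys v \<subseteq> B c}"
    show "additive_subgroup ?V X"
    proof (rule additive_subgroupI, rule X.add.subgroupI)
      show "?V \<subseteq> carrier X" using B(1) [OF c] by auto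
      have "0 \<in> ?V" by simp
      then show "?V \<noteq> {}" by blast
      fix x assume x: "x \<in> ?V"
      then have "x \<in> carrier X" using B(1) [OF c] by auto
      then show "\<ominus>\<^bsub>X\<^esub> x \<in> ?V" using x by (simp add: neg)
      show "x \<oplus>\<^bsub>X\<^esub> y \<in> ?V" if "y \<in> ?V" for y
        using x that keys_add [of x y] by auto
    qed
  next
    fix x assume "x \<in> carrier X"
    then have x: "Poly_Mapping.keys x \<subseteq> S" by simp
    define f where "f c = (if c \<in> C then Poly_Mapping.mapp (\<lambda>\<kappa> z. z when \<kappa> \<in> B c) x else 0)" for c
    have lf: "Poly_Mapping.lookup (f c) \<kappa> = (Poly_Mapping.lookup x \<kappa> when c \<in> C \<and> \<kappa> \<in> B c)" for c \<kappa>
      by (auto simp: f_def lookup_mapp when_def in_keys_iff)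
    have sub: "{c. f c \<noteq> 0} \<subseteq> \<gamma> ` Poly_Mapping.keys x"
    proof
      fix c assume "c \<in> {c. f c \<noteq> 0}"
      then have "Poly_Mapping.keys (f c) \<noteq> {}" by simp
      then obtain \<kappa> where "Poly_Mapping.lookup (f c) \<kappa> \<noteq> 0"
        by (metis ex_in_conv in_keys_iff)
      then have "c \<in> C" "\<kappa> \<in> B c" "\<kappa> \<in> Poly_Mapping.keys x"
        by (auto simp: lf in_keys_iff)
      then show "c \<in> \<gamma> ` Poly_Mapping.keys x" using \<gamma> by blast
    qed
    have fin: "finite {c. f c \<noteq> 0}" by (rule finite_subset [OF sub]) simp
    have keys_f: "Poly_Mapping.keys (f c) \<subseteq> B c" if "c \<in> C" for c
      by (auto simp: in_keys_iff lf)
    have "x = (\<Sum>c\<in>{c. f c \<noteq> 0}. f c)"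
    proof (rule poly_mapping_eqI)
      fix \<kappa>
      have "(\<Sum>c\<in>{c. f c \<noteq> 0}. Poly_Mapping.lookup (f c) \<kappa>) =
         (\<Sum>c\<in>{c. f c \<noteq> 0}. if c = \<gamma> \<kappa> then Poly_Mapping.lookup x \<kappa> else 0)"
      proof (rule sum.cong [OF refl])
        fix c assume "c \<in> {c. f c \<noteq> 0}"
        then have "c \<in> C" by (auto simp: f_def split: if_splits)
        show "Poly_Mapping.lookup (f c) \<kappa> = (if c = \<gamma> \<kappa> then Poly_Mapping.lookup x \<kappa> else 0)"
          using \<gamma>_in [of \<kappa>] \<gamma> [of c \<kappa>] x \<open>c \<in> C\<close> by (auto simp: lf when_def in_keys_iff)
      qed
      also have "\<dots> = Poly_Mapping.lookup x \<kappa>"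
      proof (cases "Poly_Mapping.lookup x \<kappa> = 0")
        case False
        then have "\<kappa> \<in> S" using x by (auto simp: in_keys_iff)
        then have "Poly_Mapping.lookup (f (\<gamma> \<kappa>)) \<kappa> \<noteq> 0"
          using \<gamma>_in False by (simp add: lf)
        then have "f (\<gamma> \<kappa>) \<noteq> 0" by auto
        then show ?thesis using fin by simp
      next
        case True
        then show ?thesis by (intro trans [OF sum.neutral]) auto
      qed
      finally show "Poly_Mapping.lookup x \<kappa> = Poly_Mapping.lookup (\<Sum>c\<in>{c. f c \<noteq> 0}. f c) \<kappa>"
        using lookup_sum [OF fin] by simp
    qed
    moreover have "f c \<in> carrier X" for c
      using keys_f B(1) by (cases "c \<in> C") (fastforce simp: f_def)+
    ultimately have Pf: "?P x f"
      using fin keys_f finsum [OF fin, of f] by (simp add: f_def)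
    show "\<exists>!f. ?P x f"
    proof (rule ex1I [of _ f])
      show "?P x f" by (rule Pf)
      fix g assume g: "?P x g"
      show "g = f"
      proof
        fix c
        show "g c = f c"
        proof (rule poly_mapping_eqI)
          fix \<kappa>
          show "Poly_Mapping.lookup (g c) \<kappa> = Poly_Mapping.lookup (f c) \<kappa>"
            using f_lookup [OF g, of c \<kappa>] f_lookup [OF Pf, of c \<kappa>] f_zero [OF g, of \<kappa> c] f_zero [OF Pf, of \<kappa> c]
              g Pf by (cases "c \<in> C"; cases "\<kappa> \<in> B c") auto
        qed
      qed
    qed
  qed
qed

end


section \<open>Module axioms, grading and weight spaces of the constructed module\<close>

lemma ring_salg: "ring (salg k a b)"
proof -
  let ?Q = "free_algebra (index_set a b) Quot rel_ideal k (index_set a b)"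
  interpret Q: ring ?Q by (rule ideal.quotient_is_ring [OF rel_ideal_ideal])
  show ?thesis
  proof (rule ringI)
    show "abelian_group (salg k a b)"
    proof (rule abelian_groupI)
      fix x assume "x \<in> carrier (salg k a b)"
      then show "\<exists>y\<in>carrier (salg k a b). y \<oplus>\<^bsub>salg k a b\<^esub> x = \<zero>\<^bsub>salg k a b\<^esub>"
        unfolding salg_simps by (intro bexI [of _ "\<ominus>\<^bsub>?Q\<^esub> x"] Q.l_neg Q.a_inv_closed)
    qed (simp_all add: salg_simps Q.a_ac)
    show "Group.monoid (salg k a b)"
      by (rule monoidI) (simp_all add: salg_simps Q.m_assoc)
  qed (simp_all add: salg_simps Q.l_distr Q.r_distr)
qed

lemma lattice_parity_letter: "lattice_parity (letter_weight g) = index_parity (gindex g)"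
proof -
  have "{j. letter_weight g j \<noteq> 0} = {gindex g}" by (cases g) auto
  moreover have "letter_weight g (gindex g) = 1 \<or> letter_weight g (gindex g) = - 1"
    by (cases g) auto
  ultimately show ?thesis unfolding lattice_parity_def by (auto simp: index_parity_def)
qed

lemma word_parity_Cons: "word_parity (Word (g # gs)) = index_parity (gindex g) + word_parity (Word gs)"
  unfolding word_parity_def word.sel list.map sum_list.Cons ..

lemma (in salg_module) wspaceI:
  assumes "x \<in> carrier M"
    and cartan: "\<And>i. i \<in> I \<Longrightarrow> ev (gen (Cre i) * gen (Ann i) - const (\<mu> i)) x = \<zero>\<^bsub>M\<^esub>"
  shows "x \<in> wspace \<mu>"
proof -
  have "ev f x = \<zero>\<^bsub>M\<^esub>" if "left_rel k I \<mu> f" for f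
    using that
  proof (induction rule: left_rel.induct)
    case (left_rel_ideal f)
    then show ?case using ev_cong [of f 0] assms(1) by simp
  next
    case (left_rel_cartan i)
    then show ?case by (rule cartan)
  next
    case (left_rel_add f g)
    then show ?case using assms(1) by (simp add: ev_add left_rel_free)
  next
    case (left_rel_mult f g)
    then show ?case using assms(1) by (simp add: ev_mult left_rel_free)
  qed
  then show ?thesis using assms(1) by (simp add: wspace_iff)
qed

context weight_class_module
begin

lemma parity_letter:
  assumes "\<kappa> \<in> S" "gindex g \<in> I" "shift \<kappa> (letter_weight g) \<in> S"
  shows "p (shift \<kappa> (letter_weight g)) = p \<kappa> + index_parity (gindex g)"
  using p S_weights [OF assms(1)] S_weights [OF assms(3)] root_lattice_letter [OF assms(2)]
    lattice_parity_letter [of g]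
  unfolding parity_map_def by metis

text \<open>The map \<open>p\<close> is controlled between admissible weights only; a nonzero
  coefficient guarantees that all intermediate weights stay in the class.\<close>

lemma parity_word:
  assumes "\<kappa> \<in> S" "wcoeff gs \<kappa> \<noteq> 0" "gindex ` set gs \<subseteq> I"
  shows "p (shift \<kappa> (word_weight (Word gs))) = word_parity (Word gs) + p \<kappa>"
  using assms(2,3)
proof (induction gs)
  case Nil
  then show ?case by (simp add: word_parity_def)
next
  case (Cons g gs)
  let ?\<kappa> = "shift \<kappa> (word_weight (Word gs))"
  have eq: "shift \<kappa> (word_weight (Word (g # gs))) = shift ?\<kappa> (letter_weight g)"
    by (simp add: shift_shift word_weight_Cons)
  have "?\<kappa> \<in> S" "shift ?\<kappa> (letter_weight g) \<in> S"
    using Cons.prems word_coeff_stays [OF assms(1), of gs] word_coeff_stays [OF assms(1), of "g # gs"]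
    by (auto simp: eq)
  then have "p (shift ?\<kappa> (letter_weight g)) = p ?\<kappa> + index_parity (gindex g)"
    using Cons.prems by (intro parity_letter) auto
  also have "p ?\<kappa> = word_parity (Word gs) + p \<kappa>" using Cons by auto
  finally show ?case unfolding eq by (simp only: word_parity_Cons ac_simps)
qed

lemma act_parity:
  assumes f: "f \<in> F" "\<forall>w\<in>Poly_Mapping.keys f. word_parity w = d"
    and v: "Poly_Mapping.keys v \<subseteq> {\<kappa> \<in> S. p \<kappa> = e}"
  shows "Poly_Mapping.keys (act f v) \<subseteq> {\<kappa> \<in> S. p \<kappa> = d + e}" (is "_ \<subseteq> ?T")
proof -
  have sub: "Poly_Mapping.keys (x + y) \<subseteq> ?T" if "Poly_Mapping.keys x \<subseteq> ?T" "Poly_Mapping.keys y \<subseteq> ?T"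
    for x y :: "weight \<Rightarrow>\<^sub>0 complex"
    using that keys_add [of x y] by blast
  have single: "Poly_Mapping.keys (act (Poly_Mapping.single w c) (Poly_Mapping.single \<kappa> z)) \<subseteq> ?T"
    if "w \<in> {w \<in> words_over I. word_parity w = d}" "\<kappa> \<in> {\<kappa> \<in> S. p \<kappa> = e}" for w c \<kappa> z
  proof (cases "c * z * wcoeff (letters w) \<kappa> = 0")
    case False
    then have "shift \<kappa> (word_weight w) \<in> S" "p (shift \<kappa> (word_weight w)) = d + e"
      using that word_coeff_stays [of \<kappa> "letters w"] parity_word [of \<kappa> "letters w"]
      by (auto simp: words_over_def)
    then show ?thesis by (simp add: action_single)
  qed (simp add: action_single)
  have 1: "Poly_Mapping.keys (act (Poly_Mapping.single w c) v) \<subseteq> ?T"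
    if "w \<in> {w \<in> words_over I. word_parity w = d}" for w c
    using v
  proof (induction v rule: free_elt_induct)
    case (add \<kappa> z v)
    then show ?case using sub single [OF that] by (simp only: action_add_right)
  qed simp
  have "Poly_Mapping.keys f \<subseteq> {w \<in> words_over I. word_parity w = d}"
    using f by (auto simp: free_carrier)
  then show ?thesis
  proof (induction f rule: free_elt_induct)
    case (add w c f)
    then show ?case using sub 1 by (simp only: action_add_left)
  qed simp
qed

lemma X_graded: "internal_direct_sum X (mpart X) UNIV"
proof -
  have "internal_direct_sum X (\<lambda>d. {v. Poly_Mapping.keys v \<subseteq> {\<kappa> \<in> S. p \<kappa> = d}}) UNIV"
    by (rule X_direct_sum) auto
  moreover have "mpart X = (\<lambda>d. {v. Poly_Mapping.keys v \<subseteq> {\<kappa> \<in> S. p \<kappa> = d}})"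
    by (rule ext) simp
  ultimately show ?thesis by simp
qed

lemma X_left_supermodule: "left_supermodule (salg k a b) X"
proof -
  have smult: "\<exists>f\<in>F. r = cls k a b f \<and> (\<forall>x\<in>carrier X. r \<odot>\<^bsub>X\<^esub> x = act f x)"
    if "r \<in> carrier (salg k a b)" for r
    using cls_surj [OF that] X_smult by (metis X_simps(1) mem_Collect_eq)
  show ?thesis
  proof (rule left_supermodule.intro [OF ring_salg X_abelian_group], unfold_locales)
    fix r s x y assume r: "r \<in> carrier (salg k a b)" and s: "s \<in> carrier (salg k a b)"
      and x: "x \<in> carrier X" and y: "y \<in> carrier X"
    obtain f where f: "f \<in> F" "r = cls k a b f" using cls_surj [OF r] .
    obtain g where g: "g \<in> F" "s = cls k a b g" using cls_surj [OF s] .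
    have x': "Poly_Mapping.keys x \<subseteq> S" and y': "Poly_Mapping.keys y \<subseteq> S" using x y by simp_all
    have xy: "Poly_Mapping.keys (x + y) \<subseteq> S" using x' y' keys_add [of x y] by blast
    show "r \<odot>\<^bsub>X\<^esub> x \<in> carrier X"
      using f x' by (simp add: X_smult act_closed)
    show "(r \<oplus>\<^bsub>salg k a b\<^esub> s) \<odot>\<^bsub>X\<^esub> x = r \<odot>\<^bsub>X\<^esub> x \<oplus>\<^bsub>X\<^esub> s \<odot>\<^bsub>X\<^esub> x"
      using f g x' by (simp add: X_smult free_add action_add_left flip: cls_add)
    show "r \<odot>\<^bsub>X\<^esub> (x \<oplus>\<^bsub>X\<^esub> y) = r \<odot>\<^bsub>X\<^esub> x \<oplus>\<^bsub>X\<^esub> r \<odot>\<^bsub>X\<^esub> y"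
      using f x' y' xy by (simp add: X_smult action_add_right)
    show "(r \<otimes>\<^bsub>salg k a b\<^esub> s) \<odot>\<^bsub>X\<^esub> x = r \<odot>\<^bsub>X\<^esub> (s \<odot>\<^bsub>X\<^esub> x)"
      using f g x' by (simp add: X_smult free_mult action_mult act_closed flip: cls_mult)
  next
    fix x assume "x \<in> carrier X"
    then show "\<one>\<^bsub>salg k a b\<^esub> \<odot>\<^bsub>X\<^esub> x = x"
      using X_smult [OF free_one, of x] by (simp add: cls_one action_one)
  next
    fix r d x e assume r: "r \<in> part (salg k a b) d" and x: "x \<in> mpart X e"
    then obtain f where f: "f \<in> F" "\<forall>w\<in>Poly_Mapping.keys f. word_parity w = d" "r = cls k a b f"
      unfolding salg_simps by blast
    have "Poly_Mapping.keys x \<subseteq> {\<kappa> \<in> S. p \<kappa> = e}" using x by simp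
    moreover from this have "Poly_Mapping.keys x \<subseteq> S" by blast
    ultimately show "r \<odot>\<^bsub>X\<^esub> x \<in> mpart X (d + e)"
      unfolding f(3) using act_parity [OF f(1,2)] X_smult [OF f(1)] X_simps(4) by simp
  qed (rule X_graded)
qed

lemma salg_module_X: "salg_module k a b X"
  using X_left_supermodule by (simp add: salg_module_def)

lemma X_ev: "f \<in> F \<Longrightarrow> Poly_Mapping.keys v \<subseteq> S \<Longrightarrow> salg_module.ev k a b X f v = act f v"
  by (simp add: salg_module.ev_def [OF salg_module_X] X_smult)

lemma lookup_act_cartan:
  assumes "i \<in> I" "Poly_Mapping.keys v \<subseteq> S"
  shows "Poly_Mapping.lookup (act (gen (Cre i) * gen (Ann i) - const c) v) \<kappa> =
    (\<kappa> i - c) * Poly_Mapping.lookup v \<kappa>"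
proof -
  have "Poly_Mapping.lookup (act (gen (Cre i) * gen (Ann i)) v) \<kappa> = \<kappa> i * Poly_Mapping.lookup v \<kappa>"
    using assms(2)
  proof (induction v rule: free_elt_induct)
    case (add \<kappa>' d v)
    have cancel: "shift (shift \<kappa>' (letter_weight (Ann i))) (letter_weight (Cre i)) = \<kappa>'"
      by (simp add: shift_def fun_eq_iff)
    have "act (gen (Cre i) * gen (Ann i)) (Poly_Mapping.single \<kappa>' d) =
       Poly_Mapping.single \<kappa>' (d * (coeff (Cre i) (shift \<kappa>' (letter_weight (Ann i))) * coeff (Ann i) \<kappa>'))"
      by (simp add: action_mult action_gen_single cancel ac_simps del: letter_weight.simps)
    also have "\<dots> = Poly_Mapping.single \<kappa>' (d * \<kappa>' i)"
      using coeff_Cre_Ann [OF add(1) assms(1)] by simp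
    finally show ?case
      using add by (simp add: action_add_right lookup_add lookup_single when_def algebra_simps)
  qed simp
  then show ?thesis
    by (simp add: action_diff lookup_minus lookup_action_const algebra_simps)
qed

lemma S_outside: "\<kappa> \<in> S \<Longrightarrow> i \<notin> I \<Longrightarrow> \<kappa> i = 0"
  unfolding S_iff by blast

text \<open>The \<open>u_i\<close> are diagonal on monomials, and their eigenvalues together with
  the zeros outside the index set determine the weight.\<close>

lemma X_weight_space:
  assumes "\<kappa> \<in> weights k a b"
  shows "weight_space k a b X \<kappa> = {v. Poly_Mapping.keys v \<subseteq> {\<kappa>} \<inter> S}"
proof -
  interpret X: salg_module k a b X by (rule salg_module_X)
  have ev: "X.ev (gen (Cre i) * gen (Ann i) - const c) v = act (gen (Cre i) * gen (Ann i) - const c) v"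
    if "i \<in> I" "Poly_Mapping.keys v \<subseteq> S" for i c v
    using that by (intro X_ev free_intros) simp_all
  show ?thesis
  proof (intro Set.set_eqI iffI)
    fix v :: "weight \<Rightarrow>\<^sub>0 complex" assume v: "v \<in> weight_space k a b X \<kappa>"
    then have v': "Poly_Mapping.keys v \<subseteq> S" using X.wspace_carrier by simp
    have "\<kappa>' = \<kappa>" if "\<kappa>' \<in> Poly_Mapping.keys v" for \<kappa>'
    proof
      fix i
      show "\<kappa>' i = \<kappa> i"
      proof (cases "i \<in> I")
        case True
        have "act (gen (Cre i) * gen (Ann i) - const (\<kappa> i)) v = 0"
          using v left_rel_cartan [OF True, of k \<kappa>] ev [OF True v', of "\<kappa> i"] by (simp add: X.wspace_iff)
        then show ?thesis
          using lookup_act_cartan [OF True v', of "\<kappa> i" \<kappa>'] that by (simp add: in_keys_iff)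
      next
        case False
        then show ?thesis using S_outside v' that assms unfolding weights_def by auto
      qed
    qed
    then show "v \<in> {v. Poly_Mapping.keys v \<subseteq> {\<kappa>} \<inter> S}" using v' by blast
  next
    fix v :: "weight \<Rightarrow>\<^sub>0 complex" assume "v \<in> {v. Poly_Mapping.keys v \<subseteq> {\<kappa>} \<inter> S}"
    then have v: "Poly_Mapping.keys v \<subseteq> {\<kappa>}" "Poly_Mapping.keys v \<subseteq> S" by auto
    show "v \<in> weight_space k a b X \<kappa>"
    proof (rule X.wspaceI)
      fix i assume i: "i \<in> I"
      have "act (gen (Cre i) * gen (Ann i) - const (\<kappa> i)) v = 0"
      proof (rule poly_mapping_eqI)
        fix \<kappa>'
        have "\<kappa>' = \<kappa> \<or> Poly_Mapping.lookup v \<kappa>' = 0" using v by (auto simp: in_keys_iff)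
        then show "Poly_Mapping.lookup (act (gen (Cre i) * gen (Ann i) - const (\<kappa> i)) v) \<kappa>' =
            Poly_Mapping.lookup 0 \<kappa>'"
          using lookup_act_cartan [OF i v(2), of "\<kappa> i" \<kappa>'] by auto
      qed
      then show "X.ev (gen (Cre i) * gen (Ann i) - const (\<kappa> i)) v = \<zero>\<^bsub>X\<^esub>"
        using ev [OF i v(2)] by simp
    qed (use v in simp)
  qed
qed

lemma X_weight_module: "weight_module k a b X"
proof -
  have "internal_direct_sum X (\<lambda>\<kappa>. {v. Poly_Mapping.keys v \<subseteq> {\<kappa>} \<inter> S}) (weights k a b)"
    using S_weights by (intro X_direct_sum) auto
  then have "internal_direct_sum X (weight_space k a b X) (weights k a b)"
    unfolding internal_direct_sum_def by (simp add: X_weight_space)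
  then show ?thesis unfolding weight_module_def using X_left_supermodule by blast
qed

section \<open>Simplicity: every weight of the class can be reached from every other\<close>

lemma step_up:
  assumes "\<kappa> \<in> S" "\<kappa>' \<in> S" "i \<in> I" "\<kappa>' i = \<kappa> i + of_int n" "n > 0"
  shows "compatible i (\<kappa> i + 1)"
proof -
  have c: "compatible i (\<kappa> i)" "compatible i (\<kappa> i + of_int n)"
    using assms unfolding S_iff by metis+
  have "\<kappa> i + 1 \<in> \<nat> \<longleftrightarrow> \<kappa> i \<in> \<nat>"
  proof
    \<comment> \<open>Adding further ones keeps the number natural up to \<kappa>'_i, and within a
      class \<kappa>_i and \<kappa>'_i are natural together.\<close>
    assume "\<kappa> i + 1 \<in> \<nat>"
    then have "(\<kappa> i + 1) + of_int (n - 1) \<in> \<nat>" using assms(5) by (intro Nats_add_int_nonneg) auto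
    then show "\<kappa> i \<in> \<nat>" using c by (simp add: compatible_def)
  next
    assume "\<kappa> i \<in> \<nat>"
    then show "\<kappa> i + 1 \<in> \<nat>" by (rule Nats_add) simp
  qed
  moreover have "\<kappa> i = 0" if "fermionic k i"
  proof (rule ccontr)
    \<comment> \<open>Otherwise \<kappa>_i is 1, and \<open>1 + n\<close> with \<open>n > 0\<close>
      is neither 0 nor 1.\<close>
    assume "\<kappa> i \<noteq> 0"
    then have "1 + of_int n = (0::complex) \<or> 1 + of_int n = (1::complex)"
      using c that by (auto simp: compatible_def)
    then have "of_int (1 + n) = (0::complex) \<or> of_int n = (0::complex)" by auto
    then show False using assms(5) unfolding of_int_eq_0_iff by linarith
  qed
  ultimately show ?thesis using c by (auto simp: compatible_def)
qed

text \<open>The barrier lies below 0: from \<kappa>_i = 0 a lower target would be a negative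
  integer, hence outside the class. The second conclusion keeps the factor of \<open>Ann i\<close>
  nonzero.\<close>

lemma step_down:
  assumes "\<kappa> \<in> S" "\<kappa>' \<in> S" "i \<in> I" "\<kappa>' i = \<kappa> i + of_int n" "n < 0"
  shows "compatible i (\<kappa> i - 1)" "\<kappa> i \<noteq> 0"
proof -
  have c: "compatible i (\<kappa> i)" "compatible i (\<kappa> i + of_int n)"
    using assms unfolding S_iff by metis+
  show nz: "\<kappa> i \<noteq> 0"
  proof
    assume "\<kappa> i = 0"
    then have "(of_int n :: complex) \<in> \<nat>" using c by (simp add: compatible_def)
    then obtain m where "(of_int n :: complex) = of_nat m" by (auto elim: Nats_cases)
    then have "(of_int n :: complex) = of_int (int m)" by simp
    then show False using assms(5) unfolding of_int_eq_iff by simp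
  qed
  have "\<kappa> i - 1 \<in> \<nat> \<longleftrightarrow> \<kappa> i \<in> \<nat>"
    using Nats_pred [OF _ nz] Nats_add [of "\<kappa> i - 1" 1] by auto
  then show "compatible i (\<kappa> i - 1)" using c nz by (auto simp: compatible_def)
qed

text \<open>Moving one coordinate at a time towards the target never leaves the class, by
  \<open>step_up\<close> and \<open>step_down\<close>, so no step is truncated and no factor
  vanishes along the way.\<close>

lemma reachable:
  assumes "\<kappa> \<in> S" "\<kappa>' \<in> S"
  obtains gs where "gindex ` set gs \<subseteq> I" "shift \<kappa> (word_weight (Word gs)) = \<kappa>'" "wcoeff gs \<kappa> \<noteq> 0"
proof -
  have "diff_in_lattice a b \<kappa>' \<kappa>"
    using assms diff_in_lattice_trans diff_in_lattice_sym unfolding S_iff by blast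
  then obtain \<alpha> where \<alpha>: "\<alpha> \<in> root_lattice a b" "\<kappa>' = shift \<kappa> \<alpha>"
    unfolding diff_in_lattice_def by blast
  define D where "D = {i. \<alpha> i \<noteq> 0}"
  have D: "finite D" "D \<subseteq> I" using \<alpha> by (auto simp: D_def root_lattice_def)
  \<comment> \<open>Induction on the l1-distance to the target: the start varies, while the finite
    set \<open>D\<close> of coordinates is kept so that distances are sums over one set.\<close>
  have "\<exists>gs. gindex ` set gs \<subseteq> I \<and> shift \<kappa> (word_weight (Word gs)) = shift \<kappa> \<beta> \<and> wcoeff gs \<kappa> \<noteq> 0"
    if "\<kappa> \<in> S" "shift \<kappa> \<beta> \<in> S" "{i. \<beta> i \<noteq> 0} \<subseteq> D" for \<kappa> \<beta>
    using that
  proof (induction "\<Sum>i\<in>D. nat \<bar>\<beta> i\<bar>" arbitrary: \<kappa> \<beta> rule: less_induct)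
    case less
    show ?case
    proof (cases "\<forall>i. \<beta> i = 0")
      case True
      then have "\<beta> = (\<lambda>i. 0)" by auto
      then show ?thesis by (intro exI [of _ "[]"]) simp
    next
      case False
      then obtain i where i: "\<beta> i \<noteq> 0" by blast
      then have iI: "i \<in> D" "i \<in> I" using less.prems D by auto
      define g where "g = (if \<beta> i > 0 then Cre i else Ann i)"
      have g: "gindex g = i" by (simp add: g_def)
      have target: "shift \<kappa> \<beta> i = \<kappa> i + of_int (\<beta> i)" by (simp add: shift_def)
      have step: "compatible i (\<kappa> i + of_int (letter_weight g i))" "eigenfactor g \<kappa> \<noteq> 0"
        using step_up [OF less.prems(1,2) iI(2) target] step_down [OF less.prems(1,2) iI(2) target] i
        by (auto simp: g_def)
      let ?\<kappa> = "shift \<kappa> (letter_weight g)"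
      have S1: "?\<kappa> \<in> S" using shift_letter_in_S [OF less.prems(1), of g] step iI by (simp add: g)
      define \<gamma> where "\<gamma> = (\<lambda>j. \<beta> j - letter_weight g j)"
      have \<gamma>: "shift ?\<kappa> \<gamma> = shift \<kappa> \<beta>" by (simp add: \<gamma>_def shift_shift)
      have \<gamma>_other: "\<gamma> j = \<beta> j" if "j \<noteq> i" for j
        using that letter_weight_other [of j g] g by (simp add: \<gamma>_def)
      have \<gamma>_i: "nat \<bar>\<gamma> i\<bar> < nat \<bar>\<beta> i\<bar>"
        using i by (auto simp: \<gamma>_def g_def)
      have "(\<Sum>j\<in>D. nat \<bar>\<gamma> j\<bar>) < (\<Sum>j\<in>D. nat \<bar>\<beta> j\<bar>)"
      proof (rule sum_strict_mono_ex1 [OF D(1)])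
        show "\<forall>j\<in>D. nat \<bar>\<gamma> j\<bar> \<le> nat \<bar>\<beta> j\<bar>"
          using \<gamma>_i \<gamma>_other by (metis less_imp_le order_refl)
      qed (use iI(1) \<gamma>_i in blast)
      moreover have "{j. \<gamma> j \<noteq> 0} \<subseteq> D"
      proof
        fix j assume "j \<in> {j. \<gamma> j \<noteq> 0}"
        then show "j \<in> D" using less.prems(3) \<gamma>_other [of j] iI(1) by (cases "j = i") auto
      qed
      ultimately obtain gs where gs: "gindex ` set gs \<subseteq> I"
        "shift ?\<kappa> (word_weight (Word gs)) = shift \<kappa> \<beta>" "wcoeff gs ?\<kappa> \<noteq> 0"
        using less.hyps [of \<gamma> ?\<kappa>] S1 less.prems(2) \<gamma> by auto
      \<comment> \<open>The twist squares to 1, so it cannot vanish.\<close>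
      have "coeff g \<kappa> \<noteq> 0"
        using S1 step(2) twist_square [of k \<nu> "gindex g" \<kappa>] by (auto simp: letter_coeff_def)
      then have "wcoeff (gs @ [g]) \<kappa> \<noteq> 0"
        using gs(3) by (simp add: word_coeff_append word_weight_Cons)
      moreover have "shift \<kappa> (word_weight (Word (gs @ [g]))) = shift \<kappa> \<beta>"
        using gs(2) by (simp add: word_weight_append shift_shift word_weight_Cons)
      moreover have "gindex ` set (gs @ [g]) \<subseteq> I" using gs(1) iI g by auto
      ultimately show ?thesis by blast
    qed
  qed
  from this [OF assms(1), of \<alpha>] show thesis using \<alpha> assms(2) that by (auto simp: D_def)
qed

text \<open>A nonzero element with the fewest weights is a multiple of one monomial, since otherwise
  a suitable \<open>u_i - \<kappa>_i\<close> would shorten it without killing it. From one monomial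
  all others are reached.\<close>

lemma stable_subset_full:
  assumes N: "additive_subgroup N X" "\<And>f v. f \<in> F \<Longrightarrow> v \<in> N \<Longrightarrow> act f v \<in> N"
    and nonzero: "N \<noteq> {0}"
  shows "N = carrier X"
proof -
  have N_carrier: "Poly_Mapping.keys v \<subseteq> S" if "v \<in> N" for v
    using additive_subgroup.a_Hcarr [OF N(1) that] by simp
  have N_zero: "0 \<in> N" using additive_subgroup.zero_closed [OF N(1)] by simp
  have N_add: "u + v \<in> N" if "u \<in> N" "v \<in> N" for u v
    using additive_subgroup.a_closed [OF N(1) that] by simp
  obtain x0 where "x0 \<in> N \<and> x0 \<noteq> 0" using nonzero N_zero by blast
  then obtain x where x: "x \<in> N" "x \<noteq> 0"
    and least: "\<And>y. y \<in> N \<Longrightarrow> y \<noteq> 0 \<Longrightarrow> card (Poly_Mapping.keys x) \<le> card (Poly_Mapping.keys y)"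
    using ex_has_least_nat [of "\<lambda>x. x \<in> N \<and> x \<noteq> 0" x0 "\<lambda>x. card (Poly_Mapping.keys x)"] by blast
  have unique: "\<kappa> = \<kappa>'" if \<kappa>: "\<kappa> \<in> Poly_Mapping.keys x" and \<kappa>': "\<kappa>' \<in> Poly_Mapping.keys x" for \<kappa> \<kappa>'
  proof (rule ccontr)
    assume "\<kappa> \<noteq> \<kappa>'"
    then obtain i where i: "\<kappa> i \<noteq> \<kappa>' i" by auto
    have "\<kappa> \<in> S" "\<kappa>' \<in> S" using N_carrier [OF x(1)] \<kappa> \<kappa>' by auto
    then have iI: "i \<in> I" using S_outside [of \<kappa> i] S_outside [of \<kappa>' i] i by metis
    \<comment> \<open>The weight \<kappa> is removed, while \<kappa>' survives because the two
      differ at \<open>i\<close>.\<close>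
    define y where "y = act (gen (Cre i) * gen (Ann i) - const (\<kappa> i)) x"
    have ly: "Poly_Mapping.lookup y \<rho> = (\<rho> i - \<kappa> i) * Poly_Mapping.lookup x \<rho>" for \<rho>
      unfolding y_def using lookup_act_cartan [OF iI N_carrier [OF x(1)]] .
    have "y \<in> N" unfolding y_def using iI x by (intro N(2) free_intros) simp_all
    moreover have "Poly_Mapping.lookup y \<kappa>' \<noteq> 0" using ly [of \<kappa>'] i \<kappa>' by (simp add: in_keys_iff)
    then have "y \<noteq> 0" by auto
    moreover have "Poly_Mapping.keys y \<subset> Poly_Mapping.keys x"
      using \<kappa> ly by (auto simp: in_keys_iff)
    then have "card (Poly_Mapping.keys y) < card (Poly_Mapping.keys x)"
      by (simp add: psubset_card_mono)
    ultimately show False using least by fastforce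
  qed
  have "Poly_Mapping.keys x \<noteq> {}" using x by simp
  then obtain \<kappa> where "\<kappa> \<in> Poly_Mapping.keys x" by blast
  then have keys_x: "Poly_Mapping.keys x = {\<kappa>}" using unique by blast
  have \<kappa>: "\<kappa> \<in> S" using N_carrier [OF x(1)] keys_x by simp
  define c where "c = Poly_Mapping.lookup x \<kappa>"
  have c: "c \<noteq> 0" using keys_x by (metis c_def in_keys_iff singletonI)
  have x_eq: "x = Poly_Mapping.single \<kappa> c"
  proof (rule poly_mapping_eqI)
    fix \<kappa>'
    show "Poly_Mapping.lookup x \<kappa>' = Poly_Mapping.lookup (Poly_Mapping.single \<kappa> c) \<kappa>'"
    proof (cases "\<kappa>' = \<kappa>")
      case False
      then have "\<kappa>' \<notin> Poly_Mapping.keys x" by (simp add: keys_x)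
      then have "Poly_Mapping.lookup x \<kappa>' = 0" by (simp only: in_keys_iff not_not)
      with False show ?thesis by (simp add: lookup_single)
    qed (simp add: c_def)
  qed
  have all: "Poly_Mapping.single \<kappa>' d \<in> N" if \<kappa>': "\<kappa>' \<in> S" for \<kappa>' d
  proof -
    obtain gs where gs: "gindex ` set gs \<subseteq> I" "shift \<kappa> (word_weight (Word gs)) = \<kappa>'" "wcoeff gs \<kappa> \<noteq> 0"
      using reachable [OF \<kappa> \<kappa>'] .
    \<comment> \<open>Dividing by the coefficient of \<open>x\<close> and by that of the path yields
      exactly \<open>d\<close>.\<close>
    have "act (Poly_Mapping.single (Word gs) (d / (c * wcoeff gs \<kappa>))) x = Poly_Mapping.single \<kappa>' d"
      using gs c by (simp add: x_eq action_single)
    moreover have "Poly_Mapping.single (Word gs) (d / (c * wcoeff gs \<kappa>)) \<in> F"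
      using gs(1) by (intro free_single) (simp add: words_over_def)
    ultimately show ?thesis using N(2) x(1) by metis
  qed
  have "v \<in> N" if "Poly_Mapping.keys v \<subseteq> S" for v
    using that by (induction v rule: free_elt_induct) (simp_all add: N_zero N_add all)
  then show ?thesis using N_carrier by auto
qed

lemma X_simple: "simple_supermodule (salg k a b) X"
  unfolding simple_supermodule_def
proof (intro conjI allI impI)
  show "left_supermodule (salg k a b) X" by (rule X_left_supermodule)
  have "Poly_Mapping.single \<nu> (1::complex) \<in> carrier X" using \<nu>_in_S by simp
  moreover have "Poly_Mapping.single \<nu> (1::complex) \<noteq> 0"
    by (metis lookup_single_eq lookup_zero zero_neq_one)
  ultimately show "carrier X \<noteq> {\<zero>\<^bsub>X\<^esub>}" by (metis X_simps(2) singletonD)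
  fix N assume N: "graded_submodule (salg k a b) X N"
  then have sub: "additive_subgroup N X" unfolding graded_submodule_def by blast
  have "act f v \<in> N" if "f \<in> F" "v \<in> N" for f v
  proof -
    have "Poly_Mapping.keys v \<subseteq> S" using additive_subgroup.a_Hcarr [OF sub that(2)] by simp
    then have "act f v = cls k a b f \<odot>\<^bsub>X\<^esub> v" using that(1) by (simp add: X_smult)
    then show ?thesis using N that cls_closed unfolding graded_submodule_def by metis
  qed
  then show "N = {\<zero>\<^bsub>X\<^esub>} \<or> N = carrier X" using stable_subset_full [OF sub] by auto
qed

lemma X_simple_weight_module: "simple_weight_module k a b X"
  unfolding simple_weight_module_def using X_weight_module X_simple by blast

lemma X_supp: "supp k a b X = S"
proof -
  have "weight_space k a b X \<kappa> \<noteq> {0} \<longleftrightarrow> \<kappa> \<in> S" if "\<kappa> \<in> weights k a b" for \<kappa>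
  proof
    assume "\<kappa> \<in> S"
    then have "Poly_Mapping.single \<kappa> 1 \<in> weight_space k a b X \<kappa>"
      using that by (simp add: X_weight_space)
    moreover have "Poly_Mapping.single \<kappa> (1::complex) \<noteq> 0"
      by (metis lookup_single_eq lookup_zero zero_neq_one)
    ultimately show "weight_space k a b X \<kappa> \<noteq> {0}" by blast
  next
    assume "weight_space k a b X \<kappa> \<noteq> {0}"
    then show "\<kappa> \<in> S" using that by (cases "\<kappa> \<in> S") (auto simp: X_weight_space)
  qed
  then show ?thesis using S_weights unfolding supp_def by auto
qed

lemma X_preferred: "preferred k a b p X"
  unfolding preferred_def using X_weight_module S_weights
  by (auto simp: X_supp X_weight_space)

lemma X_basis_vector:
  assumes "\<kappa> \<in> S"
  shows "Poly_Mapping.single \<kappa> 1 \<in> weight_space k a b X \<kappa>"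
    and "Poly_Mapping.single \<kappa> 1 \<in> mpart X (p \<kappa>)"
    and "Poly_Mapping.single \<kappa> 1 \<noteq> \<zero>\<^bsub>X\<^esub>"
proof -
  show "Poly_Mapping.single \<kappa> 1 \<noteq> \<zero>\<^bsub>X\<^esub>"
    by (metis X_simps(2) lookup_single_eq lookup_zero zero_neq_one)
qed (use assms S_weights in \<open>simp_all add: X_weight_space\<close>)

end

section \<open>Parity change and the classification\<close>

lemma parity_change_X:
  assumes "weight_class_module k a b \<nu> p"
  shows "weight_class_module k a b \<nu> (\<lambda>\<kappa>. p \<kappa> + 1)"
    and "parity_change (weight_class_module.X k a b \<nu> p) =
      weight_class_module.X k a b \<nu> (\<lambda>\<kappa>. p \<kappa> + 1)"
proof -
  interpret P: weight_class_module k a b \<nu> p by fact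
  \<comment> \<open>Adding a constant to \<open>p\<close> changes both sides of its defining
    identity alike. The parity-changed module is thus another instance of the construction and
    inherits all that is proved about it.\<close>
  show Q: "weight_class_module k a b \<nu> (\<lambda>\<kappa>. p \<kappa> + 1)"
    using P.\<nu>_weight P.p
    by unfold_locales (auto simp only: parity_map_def add.assoc add.left_commute add.commute)
  have flip: "z + 1 = d \<longleftrightarrow> z = d + 1" for z d :: bit
    by (cases z; cases d; simp)
  show "parity_change (weight_class_module.X k a b \<nu> p) =
      weight_class_module.X k a b \<nu> (\<lambda>\<kappa>. p \<kappa> + 1)"
    unfolding parity_change_def P.X_def weight_class_module.X_def [OF Q] flip by simp
qed

text \<open>An even isomorphism would send the monomial of weight \<nu> to a nonzero vector of the
  same weight and parity, but in the parity-changed module that weight space has the opposite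
  parity.\<close>

lemma (in weight_class_module) X_not_iso_parity_change:
  "\<not> supermodule_iso (salg k a b) X (parity_change X)"
proof
  assume "supermodule_iso (salg k a b) X (parity_change X)"
  then obtain \<phi> where \<phi>: "\<phi> \<in> supermodule_hom (salg k a b) X (parity_change X)"
    "bij_betw \<phi> (carrier X) (carrier (parity_change X))"
    unfolding supermodule_iso_def by blast
  interpret Q: weight_class_module k a b \<nu> "\<lambda>\<kappa>. p \<kappa> + 1"
    by (rule parity_change_X(1) [OF weight_class_module_axioms])
  interpret Q': salg_module k a b Q.X by (rule Q.salg_module_X)
  have eq: "parity_change X = Q.X" by (rule parity_change_X(2) [OF weight_class_module_axioms])
  note v = X_basis_vector [OF \<nu>_in_S]
  have zero: "\<phi> \<zero>\<^bsub>X\<^esub> = \<zero>\<^bsub>Q.X\<^esub>"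
    using supermodule_hom_zero [OF X_left_supermodule Q.X_left_supermodule] \<phi>(1) eq by simp
  have "\<phi> (Poly_Mapping.single \<nu> 1) \<noteq> \<phi> \<zero>\<^bsub>X\<^esub>"
    using \<phi>(2) v(3) \<nu>_in_S unfolding bij_betw_def inj_on_def by fastforce
  moreover have "\<phi> (Poly_Mapping.single \<nu> 1) \<in> mpart Q.X (p \<nu>)"
    using \<phi>(1) v(2) unfolding supermodule_hom_def eq by blast
  moreover have "\<phi> (Poly_Mapping.single \<nu> 1) \<in> weight_space k a b Q.X \<nu>"
    using supermodule_hom_weight_space [OF \<phi>(1) v(1)] by (simp add: eq)
  then have "\<phi> (Poly_Mapping.single \<nu> 1) \<in> mpart Q.X (p \<nu> + 1)"
    using Q.X_preferred Q.X_supp Q.\<nu>_in_S unfolding preferred_def by blast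
  moreover have "p \<nu> \<noteq> p \<nu> + 1" by (cases "p \<nu>"; simp)
  ultimately show False using Q'.mpart_disjoint zero by metis
qed

text \<open>The modules \<open>X \<mu>\<close> are concrete, on finitely supported functions of
  weights, whereas the competitors \<open>Y\<close> have an arbitrary carrier type; the isomorphisms
  run across the two types.\<close>

theorem theorem2p11:
  fixes k :: kind and a b :: enat and p :: "weight \<Rightarrow> bit"
  assumes "parity_map k a b p"
  shows
    "(\<forall>Y :: (free_elt set, 'v) supermodule.
        simple_weight_module k a b Y \<longrightarrow> multiplicity_free k a b Y) \<and>
     (\<exists>X :: weight \<Rightarrow> (free_elt set, weight \<Rightarrow>\<^sub>0 complex) supermodule.
        (\<forall>\<mu>\<in>weights k a b.
           simple_weight_module k a b (X \<mu>) \<and> \<mu> \<in> supp k a b (X \<mu>) \<and>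
           simple_weight_module k a b (parity_change (X \<mu>)) \<and>
             \<mu> \<in> supp k a b (parity_change (X \<mu>)) \<and>
           \<not> supermodule_iso (salg k a b) (X \<mu>) (parity_change (X \<mu>)) \<and>
           (\<forall>Y :: (free_elt set, 'v) supermodule.
              simple_weight_module k a b Y \<and> \<mu> \<in> supp k a b Y \<longrightarrow>
              supermodule_iso (salg k a b) Y (X \<mu>) \<or>
              supermodule_iso (salg k a b) Y (parity_change (X \<mu>))) \<and>
           preferred k a b p (X \<mu>)) \<and>
        (\<forall>\<mu>\<in>weights k a b.
           supp k a b (X \<mu>) = {\<kappa> \<in> weights k a b. weight_equiv a b \<kappa> \<mu>}) \<and>
        (\<forall>\<mu>\<in>weights k a b. \<forall>\<nu>\<in>weights k a b.
           diff_in_lattice a b \<mu> \<nu> \<longrightarrow>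
           (supermodule_iso (salg k a b) (X \<mu>) (X \<nu>) \<longleftrightarrow> weight_equiv a b \<mu> \<nu>)))"
proof (intro conjI)
  show "\<forall>Y :: (free_elt set, 'v) supermodule.
      simple_weight_module k a b Y \<longrightarrow> multiplicity_free k a b Y"
    using simple_weight_salg_moduleI simple_weight_salg_module.multiplicity_free by blast
  \<comment> \<open>Equivalent weights get the same representative, hence literally the same module.\<close>
  define rep where "rep \<mu> = (SOME \<kappa>. \<kappa> \<in> weight_class k a b \<mu>)" for \<mu>
  define X where "X \<mu> = weight_class_module.X k a b (rep \<mu>) p" for \<mu>
  have rep: "rep \<mu> \<in> weight_class k a b \<mu>" if "\<mu> \<in> weights k a b" for \<mu>
    unfolding rep_def using that
    by (intro someI [of "\<lambda>\<kappa>. \<kappa> \<in> weight_class k a b \<mu>" \<mu>])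
       (simp add: weight_class_def weight_equiv_refl)
  have module: "weight_class_module k a b (rep \<mu>) p" if "\<mu> \<in> weights k a b" for \<mu>
    using rep [OF that] assms by unfold_locales (auto simp: weight_class_def)
  have class_rep: "weight_class k a b (rep \<mu>) = weight_class k a b \<mu>" if "\<mu> \<in> weights k a b" for \<mu>
    using rep [OF that] by (intro weight_class_eq) (simp add: weight_class_def)
  have supp: "supp k a b (X \<mu>) = weight_class k a b \<mu>" if "\<mu> \<in> weights k a b" for \<mu>
    unfolding X_def weight_class_module.X_supp [OF module [OF that]] class_rep [OF that] ..
  have simple: "simple_weight_module k a b (X \<mu>)" if "\<mu> \<in> weights k a b" for \<mu>
    unfolding X_def by (rule weight_class_module.X_simple_weight_module [OF module [OF that]])
  have left: "left_supermodule (salg k a b) (X \<mu>)" if "\<mu> \<in> weights k a b" for \<mu>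
    using simple [OF that] unfolding simple_weight_module_def weight_module_def by blast
  have self: "\<mu> \<in> weight_class k a b \<mu>" if "\<mu> \<in> weights k a b" for \<mu>
    using that by (simp add: weight_class_def weight_equiv_refl)
  have exhaust: "supermodule_iso (salg k a b) Y (X \<mu>) \<or>
      supermodule_iso (salg k a b) Y (parity_change (X \<mu>))"
    if \<mu>: "\<mu> \<in> weights k a b" and Y: "simple_weight_module k a b Y" "\<mu> \<in> supp k a b Y"
    for \<mu> and Y :: "(free_elt set, 'v) supermodule"
  proof -
    interpret P: weight_class_module k a b "rep \<mu>" p by (rule module [OF \<mu>])
    interpret Q: weight_class_module k a b "rep \<mu>" "\<lambda>\<kappa>. p \<kappa> + 1"
      by (rule parity_change_X(1) [OF module [OF \<mu>]])
    interpret Y: simple_weight_salg_module k a b Y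
      by (rule simple_weight_salg_moduleI [OF Y(1)])
    have PQ: "X \<mu> = P.X" "parity_change (X \<mu>) = Q.X"
      unfolding X_def parity_change_X(2) [OF module [OF \<mu>]] by (rule refl)+
    have \<mu>_in: "\<mu> \<in> weight_class k a b (rep \<mu>)" using self [OF \<mu>] class_rep [OF \<mu>] by simp
    obtain x where "x \<in> weight_space k a b Y \<mu>" "x \<noteq> \<zero>\<^bsub>Y\<^esub>"
      using Y(2) supp_witness [OF Y.left_supermodule_axioms] by blast
    then obtain v e where v: "v \<in> weight_space k a b Y \<mu>" "v \<in> mpart Y e" "v \<noteq> \<zero>\<^bsub>Y\<^esub>"
      using Y.wspace_homogeneous by blast
    show ?thesis
    \<comment> \<open>There are only two parities: a vector of the wrong one matches the basis
      vector of the parity-changed module.\<close>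
    proof (cases "e = p \<mu>")
      case True
      then show ?thesis
        using simple_weight_module_iso [OF Y(1) P.X_simple_weight_module \<mu> v]
          P.X_basis_vector [OF \<mu>_in] PQ by auto
    next
      case False
      then have "e = p \<mu> + 1" by (cases e; cases "p \<mu>"; simp)
      then show ?thesis
        using simple_weight_module_iso [OF Y(1) Q.X_simple_weight_module \<mu> v]
          Q.X_basis_vector [OF \<mu>_in] PQ by auto
    qed
  qed
  show "\<exists>X :: weight \<Rightarrow> (free_elt set, weight \<Rightarrow>\<^sub>0 complex) supermodule.
        (\<forall>\<mu>\<in>weights k a b.
           simple_weight_module k a b (X \<mu>) \<and> \<mu> \<in> supp k a b (X \<mu>) \<and>
           simple_weight_module k a b (parity_change (X \<mu>)) \<and>
             \<mu> \<in> supp k a b (parity_change (X \<mu>)) \<and>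
           \<not> supermodule_iso (salg k a b) (X \<mu>) (parity_change (X \<mu>)) \<and>
           (\<forall>Y :: (free_elt set, 'v) supermodule.
              simple_weight_module k a b Y \<and> \<mu> \<in> supp k a b Y \<longrightarrow>
              supermodule_iso (salg k a b) Y (X \<mu>) \<or>
              supermodule_iso (salg k a b) Y (parity_change (X \<mu>))) \<and>
           preferred k a b p (X \<mu>)) \<and>
        (\<forall>\<mu>\<in>weights k a b.
           supp k a b (X \<mu>) = {\<kappa> \<in> weights k a b. weight_equiv a b \<kappa> \<mu>}) \<and>
        (\<forall>\<mu>\<in>weights k a b. \<forall>\<nu>\<in>weights k a b.
           diff_in_lattice a b \<mu> \<nu> \<longrightarrow>
           (supermodule_iso (salg k a b) (X \<mu>) (X \<nu>) \<longleftrightarrow> weight_equiv a b \<mu> \<nu>))"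
  proof (intro exI [of _ X] conjI ballI allI impI)
    fix \<mu> assume \<mu>: "\<mu> \<in> weights k a b"
    note m = module [OF \<mu>]
    note m' = parity_change_X [OF m]
    show "simple_weight_module k a b (X \<mu>)" using simple [OF \<mu>] .
    show "\<mu> \<in> supp k a b (X \<mu>)" unfolding supp [OF \<mu>] by (rule self [OF \<mu>])
    show "simple_weight_module k a b (parity_change (X \<mu>))"
      unfolding X_def m'(2) by (rule weight_class_module.X_simple_weight_module [OF m'(1)])
    show "\<mu> \<in> supp k a b (parity_change (X \<mu>))"
      unfolding X_def m'(2) weight_class_module.X_supp [OF m'(1)] class_rep [OF \<mu>] by (rule self [OF \<mu>])
    show "\<not> supermodule_iso (salg k a b) (X \<mu>) (parity_change (X \<mu>))"
      unfolding X_def by (rule weight_class_module.X_not_iso_parity_change [OF m])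
    show "preferred k a b p (X \<mu>)"
      unfolding X_def by (rule weight_class_module.X_preferred [OF m])
    show "supp k a b (X \<mu>) = {\<kappa> \<in> weights k a b. weight_equiv a b \<kappa> \<mu>}"
      unfolding supp [OF \<mu>] weight_class_def ..
    show "supermodule_iso (salg k a b) Y (X \<mu>) \<or> supermodule_iso (salg k a b) Y (parity_change (X \<mu>))"
      if "simple_weight_module k a b Y \<and> \<mu> \<in> supp k a b Y" for Y :: "(free_elt set, 'v) supermodule"
      using exhaust \<mu> that by blast
    fix \<nu> assume \<nu>: "\<nu> \<in> weights k a b"
    show "supermodule_iso (salg k a b) (X \<mu>) (X \<nu>) \<longleftrightarrow> weight_equiv a b \<mu> \<nu>"
    proof
      \<comment> \<open>Isomorphisms preserve supports, and the support of \<open>X \<nu>\<close> is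
        the class of \<nu>, so it suffices that \<mu> lies in it.\<close>
      assume "supermodule_iso (salg k a b) (X \<mu>) (X \<nu>)"
      then have "\<mu> \<in> supp k a b (X \<nu>)"
        using supermodule_iso_supp [OF left [OF \<mu>] left [OF \<nu>]] supp [OF \<mu>] self [OF \<mu>] by simp
      then show "weight_equiv a b \<mu> \<nu>" by (simp add: supp [OF \<nu>] weight_class_def)
    next
      assume "weight_equiv a b \<mu> \<nu>"
      \<comment> \<open>The choice in \<open>rep\<close> depends on the class as a set only.\<close>
      then have "X \<mu> = X \<nu>" by (simp add: X_def rep_def weight_class_eq)
      moreover have "supermodule_iso (salg k a b) (X \<nu>) (X \<nu>)"
        unfolding supermodule_iso_def supermodule_hom_def
        by (rule bexI [of _ id]) (auto simp: bij_betw_id)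
      ultimately show "supermodule_iso (salg k a b) (X \<mu>) (X \<nu>)" by simp
    qed
  qed
qed

end
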